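(* Let $\mathcal{X}:=\{u\in\mathcal{U}:\|u\|_{L^2}\le\rho\}$. For every $N\ge1$ let $\mathcal{F}^N:\mathcal{X}\to\mathbb{R}_+$ be $$\mathcal{F}^N(u):=\int_\Theta\int_0^1 a(t,x_u^\theta(t),\theta)\,d\nu(t)\,d\mu_N(\theta)+\frac{\beta}{2}\|u\|_{L^2}^2,$$ and let $\hat u_N\in\mathcal{X}$ be any of its minimizers. Let $\mathcal{F}:\mathcal{X}\to\mathbb{R}_+$ be the restriction to $\mathcal{X}$ of $$\mathcal{F}(u):=\int_\Theta\int_0^1 a(t,x_u^\theta(t),\theta)\,d\nu(t)\,d\mu(\theta)+\frac{\beta}{2}\|u\|_{L^2}^2 .$$ Then $$\inf_{\mathcal{X}}\mathcal{F}=\lim_{N\to\infty}\inf_{\mathcal{X}}\mathcal{F}^N .$$ Moreover, the sequence $(\hat u_N)_{N\in\mathbb{N}}$ is pre-compact with respect to the strong topology of $L^2$, and any limiting point of this sequence is a minimizer of $\mathcal{F}$.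
   Context: Let $n,k\ge 1$ and let $\Theta$ be a compact subset of a finite-dimensional Euclidean space. Let $F_0:\mathbb{R}^n\times\Theta\to\mathbb{R}^n$ and $F=(F_1,\dots,F_k):\mathbb{R}^n\times\Theta\to\mathbb{R}^{n\times k}$ ($F_i$ is the $i$-th column of $F$) be such that, for some $L>0$, $|F_i(x_1,\theta_1)-F_i(x_2,\theta_2)|_2\le L(|x_1-x_2|_2+|\theta_1-\theta_2|_2)$ for all $i=0,\dots,k$ and all $(x_1,\theta_1),(x_2,\theta_2)\in\mathbb{R}^n\times\Theta$. Let $x_0:\Theta\to\mathbb{R}^n$ be continuous. Set $\mathcal{U}:=L^2([0,1],\mathbb{R}^k)$. For $u\in\mathcal{U}$ and $\theta\in\Theta$, $x_u^\theta:[0,1]\to\mathbb{R}^n$ is the unique absolutely continuous solution of $\dot x(t)=F_0(x(t),\theta)+F(x(t),\theta)u(t)$ for a.e. $t\in[0,1]$, $x(0)=x_0(\theta)$. Let $a:[0,1]\times\mathbb{R}^n\times\Theta\to\mathbb{R}_+$ be continuous and non-negative, $\beta>0$, $\nu$ a Borel probability measure on $[0,1]$, $\mu$ a Borel probability measure on $\Theta$. For every $N\ge1$ let $\mu_N=\sum_{j=1}^N\alpha_j\delta_{\theta_j}$ with $\theta_1,\dots,\theta_N\in\Theta$, $\alpha_j>0$, $\sum_{j=1}^N\alpha_j=1$ (points and weights may depend on $N$), and assume $\mu_N\rightharpoonup^*\mu$, i.e. $\int_\Theta f\,d\mu_N\to\int_\Theta f\,d\mu$ for every $f\in C^0(\Theta,\mathbb{R})$.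 The number $\rho>0$ is fixed such that every $\hat u\in\mathcal{U}$ with $\mathcal{F}(\hat u)=\inf_{\mathcal{U}}\mathcal{F}$ satisfies $\|\hat u\|_{L^2}\le\rho$ (such a $\rho$ exists). *)

theory Defs
  imports "HOL-Probability.Probability"
begin

section \<open>The Hilbert space of square-integrable functions on the unit interval\<close>

definition L2_function :: "(real \<Rightarrow> 'a::euclidean_space) \<Rightarrow> bool" where
  "L2_function u \<longleftrightarrow> u \<in> borel_measurable (lebesgue_on {0..1}) \<and>
     integrable (lebesgue_on {0..1}) (\<lambda>t. (norm (u t))\<^sup>2)"

definition L2_eq :: "(real \<Rightarrow> 'a::euclidean_space) \<Rightarrow> (real \<Rightarrow> 'a) \<Rightarrow> bool" where
  "L2_eq u v \<longleftrightarrow> L2_function u \<and> L2_function v \<and> (AE t in lebesgue_on {0..1}. u t = v t)"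

lemma L2_function_zero: "L2_function (\<lambda>_. 0)"
  by (simp add: L2_function_def)

lemma L2_function_add:
  assumes "L2_function u" "L2_function v"
  shows "L2_function (\<lambda>t. u t + v t)"
proof -
  have [measurable]: "u \<in> borel_measurable (lebesgue_on {0..1})" "v \<in> borel_measurable (lebesgue_on {0..1})"
    using assms by (auto simp: L2_function_def)
  have "integrable (lebesgue_on {0..1}) (\<lambda>t. 2 * (norm (u t))\<^sup>2 + 2 * (norm (v t))\<^sup>2)"
    using assms by (auto simp: L2_function_def)
  moreover have "(norm (x + y))\<^sup>2 \<le> 2 * (norm x)\<^sup>2 + 2 * (norm y)\<^sup>2" for x y :: 'a
  proof -
    have "(norm (x + y))\<^sup>2 \<le> (norm x + norm y)\<^sup>2"
      by (simp add: norm_triangle_ineq power_mono)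
    also have "\<dots> \<le> 2 * (norm x)\<^sup>2 + 2 * (norm y)\<^sup>2"
      using sum_squares_bound[of "norm x" "norm y"] by (simp add: power2_sum)
    finally show ?thesis .
  qed
  ultimately have "integrable (lebesgue_on {0..1}) (\<lambda>t. (norm (u t + v t))\<^sup>2)"
    by (intro Bochner_Integration.integrable_bound[where g = "\<lambda>t. (norm (u t + v t))\<^sup>2"]) auto
  then show ?thesis by (simp add: L2_function_def)
qed

lemma L2_function_scaleR:
  assumes "L2_function u"
  shows "L2_function (\<lambda>t. c *\<^sub>R u t)"
  using assms by (auto simp: L2_function_def power_mult_distrib)

lemma L2_function_uminus: "L2_function u \<Longrightarrow> L2_function (\<lambda>t. - u t)"
  using L2_function_scaleR[of u "-1"] by simp

lemma L2_function_diff: "L2_function u \<Longrightarrow> L2_function v \<Longrightarrow> L2_function (\<lambda>t. u t - v t)"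
  using L2_function_add[OF _ L2_function_uminus, of u v] by simp

lemma L2_function_inner_integrable:
  assumes "L2_function u" "L2_function v"
  shows "integrable (lebesgue_on {0..1}) (\<lambda>t. u t \<bullet> v t)"
proof -
  have [measurable]: "u \<in> borel_measurable (lebesgue_on {0..1})" "v \<in> borel_measurable (lebesgue_on {0..1})"
    using assms by (auto simp: L2_function_def)
  have i: "integrable (lebesgue_on {0..1}) (\<lambda>t. (norm (u t))\<^sup>2 + (norm (v t))\<^sup>2)"
    using assms by (auto simp: L2_function_def)
  have "\<bar>x \<bullet> y\<bar> \<le> (norm x)\<^sup>2 + (norm y)\<^sup>2" for x y :: 'a
    using Cauchy_Schwarz_ineq2[of x y] sum_squares_bound[of "norm x" "norm y"]
      mult_nonneg_nonneg[OF norm_ge_zero[of x] norm_ge_zero[of y]] by linarith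
  then show ?thesis
    by (intro Bochner_Integration.integrable_bound[OF i]) auto
qed

quotient_type (overloaded) 'a L2 = "real \<Rightarrow> 'a::euclidean_space" / partial: L2_eq
proof (rule part_equivpI)
  show "\<exists>u :: real \<Rightarrow> 'a. L2_eq u u"
    using L2_function_zero by (intro exI[of _ "\<lambda>_. 0"]) (simp add: L2_eq_def)
  show "symp (L2_eq :: (real \<Rightarrow> 'a) \<Rightarrow> _)"
    by (rule sympI) (auto simp: L2_eq_def elim: eventually_mono)
  show "transp (L2_eq :: (real \<Rightarrow> 'a) \<Rightarrow> _)"
    by (rule transpI) (auto simp: L2_eq_def elim: eventually_elim2)
qed

instantiation L2 :: (euclidean_space) real_inner
begin

lift_definition zero_L2 :: "'a L2" is "\<lambda>_. 0"
  by (simp add: L2_eq_def L2_function_zero)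

lift_definition plus_L2 :: "'a L2 \<Rightarrow> 'a L2 \<Rightarrow> 'a L2" is "\<lambda>u v t. u t + v t"
  by (auto simp: L2_eq_def L2_function_add elim: eventually_elim2)

lift_definition minus_L2 :: "'a L2 \<Rightarrow> 'a L2 \<Rightarrow> 'a L2" is "\<lambda>u v t. u t - v t"
  by (auto simp: L2_eq_def L2_function_diff elim: eventually_elim2)

lift_definition uminus_L2 :: "'a L2 \<Rightarrow> 'a L2" is "\<lambda>u t. - u t"
  by (auto simp: L2_eq_def L2_function_uminus elim: eventually_mono)

lift_definition scaleR_L2 :: "real \<Rightarrow> 'a L2 \<Rightarrow> 'a L2" is "\<lambda>c u t. c *\<^sub>R u t"
  by (auto simp: L2_eq_def L2_function_scaleR elim: eventually_mono)

lift_definition inner_L2 :: "'a L2 \<Rightarrow> 'a L2 \<Rightarrow> real" is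
  "\<lambda>u v. LINT t|lebesgue_on {0..1}. u t \<bullet> v t"
proof -
  fix u u' v v' :: "real \<Rightarrow> 'a"
  assume *: "L2_eq u u'" "L2_eq v v'"
  then have [measurable]:
      "u \<in> borel_measurable (lebesgue_on {0..1})" "u' \<in> borel_measurable (lebesgue_on {0..1})"
      "v \<in> borel_measurable (lebesgue_on {0..1})" "v' \<in> borel_measurable (lebesgue_on {0..1})"
    by (simp_all add: L2_eq_def L2_function_def)
  have "AE t in lebesgue_on {0..1}. u t = u' t" "AE t in lebesgue_on {0..1}. v t = v' t"
    using * by (simp_all add: L2_eq_def)
  then have "AE t in lebesgue_on {0..1}. u t \<bullet> v t = u' t \<bullet> v' t"
    by eventually_elim simp
  then show "(LINT t|lebesgue_on {0..1}. u t \<bullet> v t) = (LINT t|lebesgue_on {0..1}. u' t \<bullet> v' t)"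
    by (intro integral_cong_AE) simp_all
qed

lift_definition norm_L2 :: "'a L2 \<Rightarrow> real" is
  "\<lambda>u. sqrt (LINT t|lebesgue_on {0..1}. (norm (u t))\<^sup>2)"
proof -
  fix u v :: "real \<Rightarrow> 'a"
  assume "L2_eq u v"
  then have "(LINT t|lebesgue_on {0..1}. (norm (u t))\<^sup>2) = (LINT t|lebesgue_on {0..1}. (norm (v t))\<^sup>2)"
    by (intro integral_cong_AE borel_measurable_power borel_measurable_norm)
      (auto simp: L2_eq_def L2_function_def elim: eventually_mono)
  then show "sqrt (LINT t|lebesgue_on {0..1}. (norm (u t))\<^sup>2) =
      sqrt (LINT t|lebesgue_on {0..1}. (norm (v t))\<^sup>2)" by simp
qed

definition dist_L2 :: "'a L2 \<Rightarrow> 'a L2 \<Rightarrow> real" where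
  "dist_L2 u v = norm (u - v)"

definition sgn_L2 :: "'a L2 \<Rightarrow> 'a L2" where
  "sgn_L2 u = inverse (norm u) *\<^sub>R u"

definition uniformity_L2 :: "('a L2 \<times> 'a L2) filter" where
  "uniformity_L2 = (INF e\<in>{0<..}. principal {(u, v). dist u v < e})"

definition open_L2 :: "'a L2 set \<Rightarrow> bool" where
  "open_L2 U \<longleftrightarrow> (\<forall>u\<in>U. eventually (\<lambda>(u', v). u' = u \<longrightarrow> v \<in> U) uniformity)"

instance
proof
  fix u v w :: "'a L2" and c d :: real and U :: "'a L2 set"
  show "u + v + w = u + (v + w)"
    by transfer (auto simp: L2_eq_def L2_function_add add.assoc)
  show "u + v = v + u"
    by transfer (auto simp: L2_eq_def L2_function_add add.commute)
  show "0 + u = u"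
    by transfer (auto simp: L2_eq_def)
  show "- u + u = 0"
    by transfer (auto simp: L2_eq_def L2_function_zero)
  show "u - v = u + - v"
    by transfer (auto simp: L2_eq_def intro: L2_function_diff)
  show "c *\<^sub>R (u + v) = c *\<^sub>R u + c *\<^sub>R v"
    by transfer (auto simp: L2_eq_def scaleR_add_right intro!: L2_function_add L2_function_scaleR)
  show "(c + d) *\<^sub>R u = c *\<^sub>R u + d *\<^sub>R u"
    by transfer (auto simp: L2_eq_def scaleR_add_left intro!: L2_function_add L2_function_scaleR)
  show "c *\<^sub>R d *\<^sub>R u = (c * d) *\<^sub>R u"
    by transfer (auto simp: L2_eq_def intro!: L2_function_scaleR)
  show "1 *\<^sub>R u = u"
    by transfer (auto simp: L2_eq_def)
  show "dist u v = norm (u - v)" by (rule dist_L2_def)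
  show "sgn u = inverse (norm u) *\<^sub>R u" by (rule sgn_L2_def)
  show "(uniformity :: ('a L2 \<times> 'a L2) filter) = (INF e\<in>{0<..}. principal {(u, v). dist u v < e})"
    by (rule uniformity_L2_def)
  show "open U \<longleftrightarrow> (\<forall>u\<in>U. eventually (\<lambda>(u', v). u' = u \<longrightarrow> v \<in> U) uniformity)"
    by (rule open_L2_def)
  show "u \<bullet> v = v \<bullet> u"
    by transfer (simp add: inner_commute)
  show "(u + v) \<bullet> w = u \<bullet> w + v \<bullet> w"
    by transfer (simp add: L2_eq_def inner_add_left L2_function_inner_integrable)
  show "(c *\<^sub>R u) \<bullet> v = c * (u \<bullet> v)"
    by transfer simp
  show "0 \<le> u \<bullet> u"
    by transfer simp
  show "u \<bullet> u = 0 \<longleftrightarrow> u = 0"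
    by transfer
      (simp add: L2_eq_def L2_function_zero L2_function_inner_integrable integral_nonneg_eq_0_iff_AE)
  show "norm u = sqrt (u \<bullet> u)"
    by transfer (simp add: power2_norm_eq_inner)
qed

end

section \<open>The controlled system\<close>

definition abs_continuous_on_Icc :: "real \<Rightarrow> real \<Rightarrow> (real \<Rightarrow> 'a::real_normed_vector) \<Rightarrow> bool" where
  "abs_continuous_on_Icc a b x \<longleftrightarrow>
     (\<forall>\<epsilon>>0. \<exists>\<delta>>0. \<forall>(m::nat) l r.
        (\<forall>i<m. a \<le> l i \<and> l i \<le> r i \<and> r i \<le> b) \<longrightarrow>
        (\<forall>i<m. \<forall>j<m. i \<noteq> j \<longrightarrow> {l i<..<r i} \<inter> {l j<..<r j} = {}) \<longrightarrow>
        (\<Sum>i<m. r i - l i) < \<delta> \<longrightarrow>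
        (\<Sum>i<m. norm (x (r i) - x (l i))) < \<epsilon>)"

text \<open>The choice of the representative \<open>rep_L2 u\<close> of the control is irrelevant, since the
  differential equation is only required almost everywhere.\<close>

definition is_trajectory ::
  "(real^'n \<Rightarrow> 'p \<Rightarrow> real^'n) \<Rightarrow> (real^'n \<Rightarrow> 'p \<Rightarrow> real^'k^'n) \<Rightarrow> ('p \<Rightarrow> real^'n) \<Rightarrow>
   (real^'k) L2 \<Rightarrow> 'p \<Rightarrow> (real \<Rightarrow> real^'n) \<Rightarrow> bool" where
  "is_trajectory F0 F x0 u \<theta> x \<longleftrightarrow>
     abs_continuous_on_Icc 0 1 x \<and>
     (AE t in lebesgue_on {0..1}.
        (x has_vector_derivative (F0 (x t) \<theta> + F (x t) \<theta> *v rep_L2 u t)) (at t within {0..1})) \<and>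
     x 0 = x0 \<theta>"

text \<open>Restricting to \<open>extensional {0..1}\<close> fixes the irrelevant values outside the unit interval,
  so that the description is unique.\<close>

definition trajectory ::
  "(real^'n \<Rightarrow> 'p \<Rightarrow> real^'n) \<Rightarrow> (real^'n \<Rightarrow> 'p \<Rightarrow> real^'k^'n) \<Rightarrow> ('p \<Rightarrow> real^'n) \<Rightarrow>
   (real^'k) L2 \<Rightarrow> 'p \<Rightarrow> real \<Rightarrow> real^'n" where
  "trajectory F0 F x0 u \<theta> = (THE x. x \<in> extensional {0..1} \<and> is_trajectory F0 F x0 u \<theta> x)"

definition ensemble_cost ::
  "(real^'n \<Rightarrow> 'p \<Rightarrow> real^'n) \<Rightarrow> (real^'n \<Rightarrow> 'p \<Rightarrow> real^'k^'n) \<Rightarrow> ('p \<Rightarrow> real^'n) \<Rightarrow>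
   (real \<Rightarrow> real^'n \<Rightarrow> 'p \<Rightarrow> real) \<Rightarrow> real \<Rightarrow> real measure \<Rightarrow> 'p measure \<Rightarrow> (real^'k) L2 \<Rightarrow> real" where
  "ensemble_cost F0 F x0 a \<beta> \<nu> \<mu> u =
     (LINT \<theta>|\<mu>. LINT t|\<nu>. a t (trajectory F0 F x0 u \<theta> t) \<theta>) + \<beta> / 2 * (norm u)\<^sup>2"

section \<open>Finitely supported measures\<close>

definition weighted_dirac_sum ::
  "'p::topological_space set \<Rightarrow> nat \<Rightarrow> (nat \<Rightarrow> real) \<Rightarrow> (nat \<Rightarrow> 'p) \<Rightarrow> 'p measure" where
  "weighted_dirac_sum \<Theta> N \<alpha> \<theta> =
     measure_of \<Theta> (sets (restrict_space borel \<Theta>))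
       (\<lambda>A. \<Sum>j=1..N. ennreal (\<alpha> j) * emeasure (return (restrict_space borel \<Theta>) (\<theta> j)) A)"

lemma space_weighted_dirac_sum [simp]: "space (weighted_dirac_sum \<Theta> N \<alpha> \<theta>) = \<Theta>"
  unfolding weighted_dirac_sum_def by (simp add: space_measure_of_conv)

lemma sets_weighted_dirac_sum [simp]:
  "sets (weighted_dirac_sum \<Theta> N \<alpha> \<theta>) = sets (restrict_space borel \<Theta>)"
proof -
  have "\<Theta> = space (restrict_space borel \<Theta>)" by (simp add: space_restrict_space)
  then show ?thesis unfolding weighted_dirac_sum_def
    by (metis sets.sets_measure_of_eq)
qed

lemma emeasure_weighted_dirac_sum:
  fixes \<Theta> :: "'p::topological_space set"
  assumes "A \<in> sets (restrict_space borel \<Theta>)"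
  shows "emeasure (weighted_dirac_sum \<Theta> N \<alpha> \<theta>) A = (\<Sum>j=1..N. ennreal (\<alpha> j) * indicator A (\<theta> j))"
proof -
  let ?M = "restrict_space borel \<Theta>"
  let ?m = "\<lambda>A. \<Sum>j=1..N. ennreal (\<alpha> j) * emeasure (return ?M (\<theta> j)) A"
  have "countably_additive (sets ?M) ?m"
  proof (rule countably_additiveI)
    fix B :: "nat \<Rightarrow> 'p set"
    assume B: "range B \<subseteq> sets ?M" "disjoint_family B"
    have "(\<Sum>i. ?m (B i)) = (\<Sum>j=1..N. \<Sum>i. ennreal (\<alpha> j) * emeasure (return ?M (\<theta> j)) (B i))"
      by (rule suminf_sum) simp
    also have "\<dots> = ?m (\<Union>i. B i)"
      using B by (intro sum.cong refl) (simp add: suminf_emeasure del: emeasure_return)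
    finally show "(\<Sum>i. ?m (B i)) = ?m (\<Union>i. B i)" .
  qed
  moreover have "positive (sets ?M) ?m" by (simp add: positive_def)
  moreover have "\<Theta> = space ?M" by (simp add: space_restrict_space)
  ultimately have "emeasure (weighted_dirac_sum \<Theta> N \<alpha> \<theta>) A = ?m A"
    unfolding weighted_dirac_sum_def
    using emeasure_measure_of_sigma[OF sets.sigma_algebra_axioms[of ?M], of ?m A] assms by simp
  then show ?thesis using assms by simp
qed

end

theory Submission
  imports Defs
begin

text \<open>
  Let \<open>G\<close> be the integral part of the cost. It depends on the control essentially only through
  its primitive: freezing the coefficients on a grid and applying Gronwall's inequality shows that
  controls in the ball of radius \<open>\<rho>\<close> whose primitives nearly agree at the points \<open>j / M\<close> have
  uniformly close trajectories, for all parameters at once. Hence the ball is covered by finitely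
  many convex cells on which the parameter-wise cost varies by at most \<open>\<eta>\<close>, and this replaces
  every use of weak compactness. Testing the convergence of the measures on one control per cell
  gives uniform convergence of \<open>\<F>N\<close> to \<open>\<F>\<close> on the ball, hence convergence of the infima. Two almost
  minimizers \<open>u\<close>, \<open>v\<close> in the same cell have their midpoint in that cell, and the
  parallelogram identity then forces \<open>\<beta> / 8 * (norm (u - v))\<^sup>2\<close> to be at most \<open>3 * \<eta>\<close>. So the
  minimizers form a totally bounded set, and completeness of \<open>L\<^sup>2\<close> yields compactness of its closure.
\<close>

section \<open>Absolutely continuous functions\<close>

text \<open>Trajectories depend nonlinearly on the control, so \<open>mean_cost\<close> need not be
  convex, and a ball of \<open>L2\<close> has no finite cover by small norm balls. The cells are
  therefore cut out by finitely many linear maps of the control, \<open>primitive (j / M)\<close>: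
  conditions on the trajectories themselves would not define convex sets, and a midpoint could then
  leave its cell. On a cell, small oscillation stands in for convexity of \<open>mean_cost\<close>.
  That primitives suffice rests on a Gronwall estimate with the norm outside the time integral. Two
  trajectories are compared along one fixed curve, where the drift cancels and the fields differ by
  a linear map of the difference of the controls. With the norm inside, only
  \<open>norm (u - v)\<close> would be visible, which need not be small on a cell. Trajectories are
  defined by absolute continuity and an equation almost everywhere, whereas the estimates use the
  integral equation. Passing between the two takes Lebesgue's differentiation theorem in one
  direction and the fundamental theorem for absolutely continuous functions in the other; both are
  proved with the gauge integral.\<close>

lemma lebesgue_differentiation:
  fixes f :: "real \<Rightarrow> 'a::euclidean_space"
  assumes f: "f integrable_on {a..b}"
  shows "\<exists>N. negligible N \<and> (\<forall>x\<in>{a..b} - N.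
    ((\<lambda>t. integral {a..t} f) has_vector_derivative f x) (at x within {a..b}))"
proof -
  define I where "I = (\<lambda>t. integral {a..t} f)"
  define dev where "dev = (\<lambda>x y. norm (I y - I x - (y - x) *\<^sub>R f x))"
  define E where "E = (\<lambda>e. {x\<in>{a..b}. \<forall>d>0. \<exists>y\<in>{a..b}. y \<noteq> x \<and> \<bar>y - x\<bar> < d \<and> dev x y > e * \<bar>y - x\<bar>})"
  have dev_integral: "dev x y = norm ((max x y - min x y) *\<^sub>R f x - integral {min x y..max x y} f)"
    if "x \<in> {a..b}" "y \<in> {a..b}" for x y
  proof -
    have I: "I v = I u + integral {u..v} f" if "u \<in> {a..b}" "v \<in> {a..b}" "u \<le> v" for u v
      unfolding I_def using that integrable_subinterval_real[OF f, of a v]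
      by (auto intro!: Henstock_Kurzweil_Integration.integral_combine[symmetric])
    show ?thesis
    proof (cases "x \<le> y")
      case True
      then show ?thesis using I[OF that] by (simp add: dev_def max_def min_def norm_minus_commute)
    next
      case False
      then have "I y - I x - (y - x) *\<^sub>R f x = (x - y) *\<^sub>R f x - integral {y..x} f"
        using I[OF that(2,1)] by (simp add: algebra_simps)
      then show ?thesis using False by (simp add: dev_def max_def min_def)
    qed
  qed
  \<comment> \<open>Points of \<open>E e\<close> are endpoints of arbitrarily short intervals on
    which the integral deviates by more than \<open>e\<close> times the length. Vitali selects
    disjoint ones that cover \<open>E e\<close> up to a null set; Henstock's lemma bounds the sum of
    their deviations by \<open>e * \<eta>\<close>, hence their total length by
    \<open>\<eta>\<close>.\<close>
  have neg: "negligible (E e)" if epos: "e > 0" for e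
    unfolding negligible_outer_le
  proof (intro allI impI)
    fix \<eta> :: real assume "\<eta> > 0"
    obtain \<gamma> where "gauge \<gamma>" and \<gamma>: "\<And>p. \<lbrakk>p tagged_partial_division_of (cbox a b); \<gamma> fine p\<rbrakk> \<Longrightarrow>
        (\<Sum>(x,k)\<in>p. norm (measure lborel k *\<^sub>R f x - integral k f)) < e * \<eta>"
      using Henstock_lemma[of f a b "e * \<eta>"] f epos \<open>\<eta> > 0\<close> by auto
    define iv where "iv = (\<lambda>(x, y). {min x y..max x y :: real})"
    \<comment> \<open>A pair \<open>(x, y)\<close> keeps the bad point \<open>x\<close> as the tag,
      on either side of \<open>y\<close>. The interval must lie in \<open>\<gamma> x\<close> so that
      finite disjoint families are fine partial divisions.\<close>
    define K where "K = {(x,y). x \<in> {a..b} \<and> y \<in> {a..b} \<and> y \<noteq> x \<and> iv (x,y) \<subseteq> \<gamma> x \<and> dev x y > e * \<bar>y - x\<bar>}"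
    define c where "c = (\<lambda>(x,y). (x + y) / 2 :: real)"
    define r where "r = (\<lambda>(x,y). \<bar>y - x\<bar> / 2 :: real)"
    have iv: "cball (c i) (r i) = iv i" for i
      by (cases i) (auto simp: c_def r_def iv_def cball_eq_atLeastAtMost field_simps max_def min_def abs_if)
    obtain C where C: "countable C" "C \<subseteq> K" "pairwise (\<lambda>i j. disjnt (cball (c i) (r i)) (cball (c j) (r j))) C"
      "negligible (E e - (\<Union>i\<in>C. cball (c i) (r i)))"
    proof (rule Vitali_covering_theorem_cballs[of K r "E e" c])
      show "0 < r i" if "i \<in> K" for i using that by (auto simp: K_def r_def)
      show "\<exists>i. i \<in> K \<and> x \<in> cball (c i) (r i) \<and> r i < d" if x: "x \<in> E e" and d: "0 < d" for x d
      proof -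
        have "open (\<gamma> x)" "x \<in> \<gamma> x" using \<open>gauge \<gamma>\<close> by (auto simp: gauge_def)
        then obtain d' where d': "d' > 0" "ball x d' \<subseteq> \<gamma> x" by (meson openE)
        have "min d d' > 0" using d d' by auto
        then obtain y where y: "y \<in> {a..b}" "y \<noteq> x" "\<bar>y - x\<bar> < min d d'" "dev x y > e * \<bar>y - x\<bar>"
          using x unfolding E_def by blast
        have "iv (x,y) \<subseteq> ball x d'" using y(3) by (auto simp: iv_def ball_def dist_real_def)
        then have "(x,y) \<in> K" using x y d' by (auto simp: K_def E_def)
        moreover have "r (x,y) < d" using y by (auto simp: r_def)
        moreover have "x \<in> iv (x,y)" by (auto simp: iv_def)
        ultimately show ?thesis unfolding iv by blast
      qed
    qed
    have disj: "disjnt (iv i) (iv j)" if "i \<in> C" "j \<in> C" "i \<noteq> j" for i j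
      using C(3) that unfolding iv pairwise_def by blast
    have sum_le: "(\<Sum>i\<in>D. measure lebesgue (iv i)) \<le> \<eta>" if D: "finite D" "D \<subseteq> C" for D
    proof -
      define p where "p = (\<lambda>i. (fst i, iv i)) ` D"
      have inj: "inj_on (\<lambda>i. (fst i, iv i)) D"
      proof (rule inj_onI)
        fix i j assume ij: "i \<in> D" "j \<in> D" "(fst i, iv i) = (fst j, iv j)"
        then have "\<not> disjnt (iv i) (iv j)" by (cases i) (auto simp: iv_def disjnt_def)
        then show "i = j" using disj D ij by blast
      qed
      have inD: "\<exists>i\<in>D. x = fst i \<and> k = iv i" if "(x, k) \<in> p" for x k
        using that unfolding p_def by blast
      have "p tagged_partial_division_of (cbox a b)"
        unfolding tagged_partial_division_of_def
      proof (intro conjI allI impI)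
        show "finite p" using D by (simp add: p_def)
        fix x k assume xk: "(x, k) \<in> p"
        then obtain i where i: "i \<in> D" "x = fst i" "k = iv i" using inD by blast
        then have "i \<in> K" using D C by blast
        then show "x \<in> k" "k \<subseteq> cbox a b" "\<exists>a b. k = cbox a b" using i by (auto simp: iv_def K_def)
      next
        fix x k x' k' assume xk': "(x, k) \<in> p \<and> (x', k') \<in> p \<and> (x, k) \<noteq> (x', k')"
        obtain i where i: "i \<in> D" "x = fst i" "k = iv i" using inD xk' by blast
        obtain j where j: "j \<in> D" "x' = fst j" "k' = iv j" using inD xk' by blast
        have "i \<noteq> j" using i j xk' by blast
        then have "disjnt k k'" using disj i j D by blast
        then show "interior k \<inter> interior k' = {}"
          using interior_subset[of k] interior_subset[of k'] unfolding disjnt_def by blast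
      qed
      moreover have "iv i \<subseteq> \<gamma> (fst i)" if "i \<in> D" for i
      proof -
        have "i \<in> K" using that D C by blast
        then show ?thesis by (cases i) (auto simp: K_def)
      qed
      then have "\<gamma> fine p" by (auto simp: fine_def p_def)
      ultimately have "(\<Sum>(x,k)\<in>p. norm (measure lborel k *\<^sub>R f x - integral k f)) < e * \<eta>" by (rule \<gamma>)
      also have "(\<Sum>(x,k)\<in>p. norm (measure lborel k *\<^sub>R f x - integral k f)) =
          (\<Sum>i\<in>D. norm (measure lborel (iv i) *\<^sub>R f (fst i) - integral (iv i) f))"
        unfolding p_def by (subst sum.reindex[OF inj]) simp
      finally have "(\<Sum>i\<in>D. norm (measure lborel (iv i) *\<^sub>R f (fst i) - integral (iv i) f)) < e * \<eta>" .
      moreover have "(\<Sum>i\<in>D. e * measure lebesgue (iv i)) \<le>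
          (\<Sum>i\<in>D. norm (measure lborel (iv i) *\<^sub>R f (fst i) - integral (iv i) f))"
      proof (rule sum_mono)
        fix i assume "i \<in> D"
        then have "i \<in> K" using D C by blast
        then obtain x y where xy: "i = (x,y)" "x \<in> {a..b}" "y \<in> {a..b}" "dev x y > e * \<bar>y - x\<bar>" by (auto simp: K_def)
        have "measure lebesgue (iv i) = \<bar>y - x\<bar>" "measure lborel (iv i) = max x y - min x y"
          by (auto simp: xy iv_def)
        then show "e * measure lebesgue (iv i) \<le> norm (measure lborel (iv i) *\<^sub>R f (fst i) - integral (iv i) f)"
          using dev_integral[OF xy(2,3)] xy by (simp add: iv_def)
      qed
      ultimately have "e * (\<Sum>i\<in>D. measure lebesgue (iv i)) < e * \<eta>" by (simp add: sum_distrib_left)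
      then show ?thesis using \<open>e > 0\<close> by simp
    qed
    have lm: "iv i \<in> lmeasurable" for i by (cases i) (auto simp: iv_def)
    have UN: "(\<Union>i\<in>C. iv i) \<in> lmeasurable \<and> measure lebesgue (\<Union>i\<in>C. iv i) \<le> \<eta>"
    proof -
      have bnd: "measure lebesgue (\<Union>D) \<le> \<eta>" if D: "D \<subseteq> iv ` C" "finite D" for D
      proof -
        obtain D' where D': "D' \<subseteq> C" "finite D'" "D = iv ` D'"
          using finite_subset_image[OF D(2,1)] by blast
        have "measure lebesgue (\<Union>D) \<le> (\<Sum>i\<in>D'. measure lebesgue (iv i))"
          unfolding D' by (rule measure_UNION_le) (use D' lm in auto)
        then show ?thesis using sum_le[OF D'(2,1)] by linarith
      qed
      have lm': "D \<in> lmeasurable" if "D \<in> iv ` C" for D using lm that by blast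
      show ?thesis
        using fmeasurable_Union_bound[OF countable_image[OF C(1)] lm' bnd]
          measure_Union_bound[OF countable_image[OF C(1)] lm' bnd] by simp
    qed
    have neg': "negligible (E e - (\<Union>i\<in>C. iv i))" using C(4) unfolding iv .
    show "\<exists>T. E e \<subseteq> T \<and> T \<in> lmeasurable \<and> measure lebesgue T \<le> \<eta>"
    proof (intro exI conjI)
      let ?T = "(\<Union>i\<in>C. iv i) \<union> (E e - (\<Union>i\<in>C. iv i))"
      show "E e \<subseteq> ?T" by auto
      show "?T \<in> lmeasurable" using UN neg' by (intro fmeasurable.Un) (auto intro: negligible_imp_measurable)
      have "measure lebesgue ?T = measure lebesgue (\<Union>i\<in>C. iv i)"
        using UN neg' by (intro measure_Un_null_set) (auto simp: negligible_iff_null_sets fmeasurableD)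
      then show "measure lebesgue ?T \<le> \<eta>" using UN by simp
    qed
  qed
  define N where "N = (\<Union>n. E (1 / Suc n))"
  have "negligible N" unfolding N_def by (intro negligible_countable_Union) (auto intro: neg)
  moreover have "(I has_vector_derivative f x) (at x within {a..b})" if x: "x \<in> {a..b} - N" for x
    unfolding has_vector_derivative_def has_derivative_within_alt
  proof (intro conjI allI impI bounded_linear_scaleR_left)
    fix e :: real assume "e > 0"
    then obtain n where n: "1 / Suc n < e" using nat_approx_posE by blast
    have "x \<notin> E (1 / Suc n)" using x by (auto simp: N_def)
    then obtain d where d0: "d > 0"
      "\<not> (\<exists>y\<in>{a..b}. y \<noteq> x \<and> \<bar>y - x\<bar> < d \<and> dev x y > 1 / Suc n * \<bar>y - x\<bar>)"
      using x unfolding E_def by blast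
    then have d: "dev x y \<le> 1 / Suc n * \<bar>y - x\<bar>" if "y \<in> {a..b}" "y \<noteq> x" "\<bar>y - x\<bar> < d" for y
      using that not_less by blast
    have "dev x y \<le> e * \<bar>y - x\<bar>" if "y \<in> {a..b}" "\<bar>y - x\<bar> < d" for y
    proof (cases "y = x")
      case False
      have "dev x y \<le> 1 / Suc n * \<bar>y - x\<bar>" using d that False by blast
      also have "\<dots> \<le> e * \<bar>y - x\<bar>" using n by (intro mult_right_mono) auto
      finally show ?thesis .
    qed (simp add: dev_def)
    then show "\<exists>d>0. \<forall>y\<in>{a..b}. norm (y - x) < d \<longrightarrow>
        norm (I y - I x - (y - x) *\<^sub>R f x) \<le> e * norm (y - x)"
      using d0(1) unfolding dev_def real_norm_def by blast
  qed
  ultimately show ?thesis unfolding I_def by blast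
qed

lemma abs_continuous_on_IccE:
  assumes "abs_continuous_on_Icc a b x" "e > 0"
  obtains d where "d > 0" "\<And>(m::nat) l r. \<lbrakk>\<And>i. i < m \<Longrightarrow> a \<le> l i \<and> l i \<le> r i \<and> r i \<le> b;
      \<And>i j. i < m \<Longrightarrow> j < m \<Longrightarrow> i \<noteq> j \<Longrightarrow> {l i<..<r i} \<inter> {l j<..<r j} = {};
      (\<Sum>i<m. r i - l i) < d\<rbrakk> \<Longrightarrow> (\<Sum>i<m. norm (x (r i) - x (l i))) < e"
proof -
  obtain d where "d > 0" and d: "\<forall>(m::nat) l r. (\<forall>i<m. a \<le> l i \<and> l i \<le> r i \<and> r i \<le> b) \<longrightarrow>
        (\<forall>i<m. \<forall>j<m. i \<noteq> j \<longrightarrow> {l i<..<r i} \<inter> {l j<..<r j} = {}) \<longrightarrow>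
        (\<Sum>i<m. r i - l i) < d \<longrightarrow> (\<Sum>i<m. norm (x (r i) - x (l i))) < e"
    using assms(1)[unfolded abs_continuous_on_Icc_def, THEN spec[of _ e], THEN mp, OF assms(2)] by blast
  show thesis
    by (rule that[OF \<open>d > 0\<close>]) (use d in simp)
qed

text \<open>The Riemann sums are compared with the increments of \<open>g\<close> directly.
  Intervals tagged outside \<open>N\<close> are handled by differentiability at the tag; those
  tagged in \<open>N\<close> lie in an open set of measure below \<open>\<delta>\<close>, where
  absolute continuity bounds the increments. Setting the derivative to 0 on \<open>N\<close> removes
  these tags from the Riemann sum.\<close>

lemma has_integral_abs_continuous:
  fixes g :: "real \<Rightarrow> 'a::euclidean_space"
  assumes ab: "a \<le> b" and ac: "abs_continuous_on_Icc a b g" and N: "negligible N"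
    and g': "\<And>x. x \<in> {a..b} - N \<Longrightarrow> (g has_vector_derivative g' x) (at x within {a..b})"
  shows "(g' has_integral (g b - g a)) {a..b}"
proof -
  define h where "h = (\<lambda>x. if x \<in> N then 0 else g' x)"
  have "(h has_integral (g b - g a)) {a..b}"
    unfolding has_integral_real
  proof (intro allI impI)
    fix e :: real assume "e > 0"
    obtain \<delta> where \<delta>: "\<delta> > 0" "\<And>(m::nat) l r. \<lbrakk>\<And>i. i < m \<Longrightarrow> a \<le> l i \<and> l i \<le> r i \<and> r i \<le> b;
        \<And>i j. i < m \<Longrightarrow> j < m \<Longrightarrow> i \<noteq> j \<Longrightarrow> {l i<..<r i} \<inter> {l j<..<r j} = {};
        (\<Sum>i<m. r i - l i) < \<delta>\<rbrakk> \<Longrightarrow> (\<Sum>i<m. norm (g (r i) - g (l i))) < e / 2"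
      using abs_continuous_on_IccE[OF ac half_gt_zero[OF \<open>e > 0\<close>]] by blast
    have "N \<in> sets lebesgue" using N negligible_imp_sets by blast
    then obtain U where U: "open U" "N \<subseteq> U" "U - N \<in> lmeasurable" "emeasure lebesgue (U - N) < ennreal \<delta>"
      using sets_lebesgue_outer_open[OF _ \<delta>(1)] by blast
    have "U = (U - N) \<union> N" using U by auto
    then have "emeasure lebesgue U = emeasure lebesgue (U - N)"
      by (metis N U(3) emeasure_Un_null_set fmeasurableD negligible_iff_null_sets)
    then have U_small: "emeasure lebesgue U < ennreal \<delta>" using U by simp
    then have U_lm: "U \<in> lmeasurable" using U(1) by (intro fmeasurableI) (auto simp: less_top[symmetric] intro: order.strict_trans)
    have measU: "measure lebesgue U < \<delta>"
      using U_small emeasure_eq_measure2[OF U_lm] \<delta>(1) by (simp add: ennreal_less_iff)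
    \<comment> \<open>The \<open>+ 1\<close> keeps the denominator positive when
      \<open>a = b\<close> and makes \<open>e' * (b - a) < e / 2\<close> strict.\<close>
    define e' where "e' = e / (2 * (b - a + 1))"
    have e': "e' > 0" "e' * (b - a) < e / 2"
      using \<open>e > 0\<close> ab by (auto simp: e'_def field_simps)
    have "\<exists>d>0. \<forall>y\<in>{a..b}. norm (y - x) < d \<longrightarrow> norm (g y - g x - (y - x) *\<^sub>R g' x) \<le> e' * norm (y - x)"
      if "x \<in> {a..b} - N" for x
      using g'[OF that] e'(1) unfolding has_vector_derivative_def has_derivative_within_alt by blast
    then obtain d where d: "\<And>x. x \<in> {a..b} - N \<Longrightarrow> d x > 0"
      "\<And>x y. x \<in> {a..b} - N \<Longrightarrow> y \<in> {a..b} \<Longrightarrow> norm (y - x) < d x \<Longrightarrow>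
         norm (g y - g x - (y - x) *\<^sub>R g' x) \<le> e' * norm (y - x)"
      by metis
    define \<gamma> where "\<gamma> = (\<lambda>x. if x \<in> N then U else if x \<in> {a..b} then ball x (d x) else ball x 1)"
    show "\<exists>\<gamma>. gauge \<gamma> \<and> (\<forall>\<D>. \<D> tagged_division_of {a..b} \<and> \<gamma> fine \<D> \<longrightarrow>
        norm ((\<Sum>(x, k)\<in>\<D>. measure lborel k *\<^sub>R h x) - (g b - g a)) < e)"
    proof (intro exI[of _ \<gamma>] conjI allI impI)
      show "gauge \<gamma>" using U d(1) by (auto simp: gauge_def \<gamma>_def)
      fix p assume p': "p tagged_division_of {a..b} \<and> \<gamma> fine p"
      then have p: "p tagged_division_of {a..b}" and fine: "\<gamma> fine p" by auto
      have [simp]: "finite p" using p by auto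
      have K: "\<exists>l r. k = {l..r} \<and> a \<le> l \<and> l \<le> x \<and> x \<le> r \<and> r \<le> b" if "(x,k) \<in> p" for x k
        using tagged_division_ofD(2,3,4)[OF p that] by fastforce
      define G where "G = (\<lambda>(x::real, k). g (Sup k) - g (Inf k))"
      define pN where "pN = {(x,k) \<in> p. x \<in> N}"
      define pD where "pD = {(x,k) \<in> p. x \<notin> N}"
      have pU: "p = pN \<union> pD" "pN \<inter> pD = {}" "finite pN" "finite pD"
        by (auto simp: pN_def pD_def intro: finite_subset[OF _ \<open>finite p\<close>])
      have sumG: "sum G p = g b - g a"
        unfolding G_def using additive_tagged_division_1[OF ab p, of g] .
      have "(\<Sum>(x, k)\<in>p. measure lborel k *\<^sub>R h x) - (g b - g a) = (\<Sum>z\<in>p. (case z of (x,k) \<Rightarrow> measure lborel k *\<^sub>R h x) - G z)"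
        by (simp add: sum_subtractf sumG)
      also have "\<dots> = (\<Sum>z\<in>pN. (case z of (x,k) \<Rightarrow> measure lborel k *\<^sub>R h x) - G z) + (\<Sum>z\<in>pD. (case z of (x,k) \<Rightarrow> measure lborel k *\<^sub>R h x) - G z)"
        using pU by (simp add: sum.union_disjoint)
      also have "norm \<dots> \<le> norm (\<Sum>z\<in>pN. (case z of (x,k) \<Rightarrow> measure lborel k *\<^sub>R h x) - G z) + norm (\<Sum>z\<in>pD. (case z of (x,k) \<Rightarrow> measure lborel k *\<^sub>R h x) - G z)"
        by (rule norm_triangle_ineq)
      also have "norm (\<Sum>z\<in>pD. (case z of (x,k) \<Rightarrow> measure lborel k *\<^sub>R h x) - G z) \<le> (\<Sum>z\<in>pD. e' * measure lborel (snd z))"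
      proof (rule sum_norm_le)
        fix z assume z: "z \<in> pD"
        obtain x k where xk: "z = (x,k)" "(x,k) \<in> p" "x \<notin> N" using z by (auto simp: pD_def)
        obtain l r where lr: "k = {l..r}" "a \<le> l" "l \<le> x" "x \<le> r" "r \<le> b" using K[OF xk(2)] by blast
        have x: "x \<in> {a..b} - N" using lr xk by auto
        have "k \<subseteq> ball x (d x)" using fineD[OF fine xk(2)] xk(3) x unfolding \<gamma>_def by (simp split: if_splits)
        moreover have "l \<in> k" "r \<in> k" using lr by auto
        ultimately have "norm (l - x) < d x" "norm (r - x) < d x" by (auto simp: dist_norm norm_minus_commute)
        then have *: "norm (g l - g x - (l - x) *\<^sub>R g' x) \<le> e' * norm (l - x)"
          "norm (g r - g x - (r - x) *\<^sub>R g' x) \<le> e' * norm (r - x)"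
          using d(2)[OF x, of l] d(2)[OF x, of r] lr by auto
        \<comment> \<open>Straddle argument: the tag lies between \<open>l\<close> and
          \<open>r\<close>, so the two errors add up to \<open>e' * (r - l)\<close>.\<close>
        have "(r - l) *\<^sub>R g' x - (g r - g l) = (g l - g x - (l - x) *\<^sub>R g' x) - (g r - g x - (r - x) *\<^sub>R g' x)"
          by (simp add: algebra_simps)
        also have "norm \<dots> \<le> e' * norm (l - x) + e' * norm (r - x)"
          using * norm_triangle_ineq4 by (meson add_mono order_trans)
        also have "\<dots> = e' * (r - l)" using lr by (simp add: algebra_simps)
        finally show "norm ((case z of (x,k) \<Rightarrow> measure lborel k *\<^sub>R h x) - G z) \<le> e' * measure lborel (snd z)"
          using xk lr by (simp add: G_def h_def)
      qed
      also have "(\<Sum>z\<in>pD. e' * measure lborel (snd z)) \<le> (\<Sum>z\<in>p. e' * measure lborel (snd z))"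
        using e' by (intro sum_mono2) (auto simp: pU)
      also have "\<dots> = e' * (b - a)"
        using additive_content_tagged_division[of p a b] p ab by (simp add: sum_distrib_left[symmetric] case_prod_unfold)
      also have "norm (\<Sum>z\<in>pN. (case z of (x,k) \<Rightarrow> measure lborel k *\<^sub>R h x) - G z) = norm (\<Sum>z\<in>pN. G z)"
      proof -
        have "(\<Sum>z\<in>pN. (case z of (x,k) \<Rightarrow> measure lborel k *\<^sub>R h x) - G z) = (\<Sum>z\<in>pN. - G z)"
          by (rule sum.cong) (auto simp: pN_def h_def)
        then show ?thesis by (simp add: sum_negf)
      qed
      also have "\<dots> \<le> (\<Sum>z\<in>pN. norm (G z))" by (rule norm_sum)
      also have "\<dots> < e / 2"
      proof -
        \<comment> \<open>Absolute continuity speaks of families indexed by \<open>{..<m}\<close>,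
          so \<open>pN\<close> is enumerated.\<close>
        obtain f where f: "bij_betw f {..<card pN} pN"
          using ex_bij_betw_nat_finite[OF pU(3)] by (auto simp: atLeast0LessThan)
        let ?m = "card pN"
        let ?l = "\<lambda>i. Inf (snd (f i))" and ?r = "\<lambda>i. Sup (snd (f i))"
        have fi: "f i \<in> pN" if "i < ?m" for i using f that by (auto simp: bij_betw_def)
        have iv: "snd (f i) = {?l i..?r i} \<and> a \<le> ?l i \<and> ?l i \<le> ?r i \<and> ?r i \<le> b \<and> snd (f i) \<subseteq> U" if "i < ?m" for i
        proof -
          have i: "(fst (f i), snd (f i)) \<in> p" "fst (f i) \<in> N" using fi[OF that] by (auto simp: pN_def)
          have "snd (f i) \<subseteq> U" using fineD[OF fine i(1)] i(2) by (simp add: \<gamma>_def)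
          then show ?thesis using K[OF i(1)] by auto
        qed
        have disj: "{?l i<..<?r i} \<inter> {?l j<..<?r j} = {}" if "i < ?m" "j < ?m" "i \<noteq> j" for i j
        proof -
          have "f i \<noteq> f j" using f that by (auto simp: bij_betw_def inj_on_def)
          moreover have "(fst (f i), snd (f i)) \<in> p" "(fst (f j), snd (f j)) \<in> p"
            using fi[OF that(1)] fi[OF that(2)] by (auto simp: pN_def)
          ultimately have "interior (snd (f i)) \<inter> interior (snd (f j)) = {}"
            using tagged_division_ofD(5)[OF p] by (metis prod.collapse)
          moreover have "interior (snd (f i)) = {?l i<..<?r i}" "interior (snd (f j)) = {?l j<..<?r j}"
            using iv that by (metis interior_atLeastAtMost_real)+
          ultimately show ?thesis by simp
        qed
        have "(\<Sum>i<?m. ?r i - ?l i) = (\<Sum>i<?m. measure lebesgue {?l i<..<?r i})"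
          using iv by (intro sum.cong) auto
        also have "\<dots> = measure lebesgue (\<Union>i<?m. {?l i<..<?r i})"
          by (rule measure_finite_Union[symmetric]) (use disj iv in \<open>auto simp: disjoint_family_on_def\<close>)
        also have "\<dots> \<le> measure lebesgue U"
        proof (rule measure_mono_fmeasurable[OF _ _ U_lm])
          show "(\<Union>i<?m. {?l i<..<?r i}) \<subseteq> U"
          proof
            fix y assume "y \<in> (\<Union>i<?m. {?l i<..<?r i})"
            then obtain i where "i < ?m" "y \<in> {?l i..?r i}" by fastforce
            then show "y \<in> U" using iv by blast
          qed
        qed auto
        finally have "(\<Sum>i<?m. ?r i - ?l i) < \<delta>" using measU by simp
        then have "(\<Sum>i<?m. norm (g (?r i) - g (?l i))) < e / 2"
          by (intro \<delta>(2) disj conjI) (use iv in auto)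
        also have "(\<Sum>i<?m. norm (g (?r i) - g (?l i))) = (\<Sum>z\<in>pN. norm (G z))"
          by (rule sum.reindex_bij_betw[OF f, of "\<lambda>z. norm (G z)", symmetric, THEN trans, symmetric])
            (auto simp: G_def case_prod_unfold)
        finally show ?thesis .
      qed
      finally show "norm ((\<Sum>(x, k)\<in>p. measure lborel k *\<^sub>R h x) - (g b - g a)) < e"
        using e'(2) by simp
    qed
  qed
  then show ?thesis
    by (rule has_integral_spike[OF N, rotated]) (auto simp: h_def)
qed

section \<open>Square-integrable functions\<close>

lemma L2_function_measurable: "L2_function u \<Longrightarrow> u \<in> borel_measurable (lebesgue_on {0..1})"
  by (simp add: L2_function_def)

lemma L2_function_sq_integrable: "L2_function u \<Longrightarrow> integrable (lebesgue_on {0..1}) (\<lambda>t. (norm (u t))\<^sup>2)"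
  by (simp add: L2_function_def)

lemma L2_function_integrable:
  fixes u :: "real \<Rightarrow> 'a::euclidean_space"
  assumes "L2_function u"
  shows "integrable (lebesgue_on {0..1}) u"
proof -
  interpret finite_measure "lebesgue_on {0..1::real}"
    by (rule finite_measure_lebesgue_on) simp
  have "norm (u t) \<le> norm ((norm (u t))\<^sup>2 + 1)" for t
    using sum_squares_bound[of "norm (u t)" 1, simplified] norm_ge_zero[of "u t"]
    unfolding real_norm_def by linarith
  then show ?thesis
    using assms by (intro Bochner_Integration.integrable_bound[where g=u and f="\<lambda>t. (norm (u t))\<^sup>2 + 1"])
      (auto simp: L2_function_def)
qed

lemma L2_function_absolutely_integrable:
  fixes u :: "real \<Rightarrow> 'a::euclidean_space"
  assumes "L2_function u"
  shows "u absolutely_integrable_on {0..1}"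
  using L2_function_integrable[OF assms]
  by (simp add: set_integrable_def integrable_restrict_space)

lemma L2_function_absolutely_integrable_subset:
  fixes u :: "real \<Rightarrow> 'a::euclidean_space"
  assumes "L2_function u" "{a..b} \<subseteq> {0..1}"
  shows "u absolutely_integrable_on {a..b}"
  using set_integrable_subset[OF L2_function_absolutely_integrable[OF assms(1)] _ assms(2)] by simp

lemma L2_function_integrable_on:
  fixes u :: "real \<Rightarrow> 'a::euclidean_space"
  assumes "L2_function u" "{a..b} \<subseteq> {0..1}"
  shows "u integrable_on {a..b}" "(\<lambda>t. norm (u t)) integrable_on {a..b}"
  using L2_function_absolutely_integrable_subset[OF assms]
  by (auto simp: absolutely_integrable_on_def)

lemma L2_function_sq_integrable_on:
  fixes u :: "real \<Rightarrow> 'a::euclidean_space"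
  assumes "L2_function u" "{a..b} \<subseteq> {0..1}"
  shows "(\<lambda>t. (norm (u t))\<^sup>2) integrable_on {a..b}"
  using integrable_on_lebesgue_on[OF L2_function_sq_integrable[OF assms(1)]] assms(2)
  by (auto intro: integrable_on_subinterval)

lemma L2_function_norm: "L2_function u \<Longrightarrow> L2_function (\<lambda>t. norm (u t))"
  by (auto simp: L2_function_def)

lemma L2_function_bound:
  fixes f :: "real \<Rightarrow> 'a::euclidean_space"
  assumes "L2_function g" "f \<in> borel_measurable (lebesgue_on {0..1})"
    "\<And>t. t \<in> {0..1} \<Longrightarrow> norm (f t) \<le> norm (g t)"
  shows "L2_function f"
  unfolding L2_function_def
proof
  show "integrable (lebesgue_on {0..1}) (\<lambda>t. (norm (f t))\<^sup>2)"
    using assms by (intro Bochner_Integration.integrable_bound[OF L2_function_sq_integrable[OF assms(1)]])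
      (auto simp: power_mono intro!: AE_I2)
qed fact

lemma L2_function_continuous:
  fixes f :: "real \<Rightarrow> 'a::euclidean_space"
  assumes "continuous_on {0..1} f"
  shows "L2_function f"
proof -
  have "continuous_on {0..1} (\<lambda>t. (norm (f t))\<^sup>2)" using assms by (intro continuous_intros)
  then show ?thesis
    unfolding L2_function_def using assms
    by (auto intro!: continuous_imp_measurable_on_sets_lebesgue continuous_imp_integrable_real)
qed

lemma L2_eq_refl: "L2_function u \<Longrightarrow> L2_eq u u"
  by (simp add: L2_eq_def)

text \<open>This is the inequality of the inner product space \<open>L2\<close>, applied to
  functions cut off outside \<open>S\<close>. General measurable \<open>S\<close> is wanted because
  the modulus of absolute continuity involves finite unions of intervals.\<close>

lemma L2_Cauchy_Schwarz:
  fixes f g :: "real \<Rightarrow> real"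
  assumes f: "L2_function f" and g: "L2_function g" and S: "S \<in> sets lebesgue" "S \<subseteq> {0..1}"
  shows "(integral S (\<lambda>t. f t * g t))\<^sup>2 \<le> integral S (\<lambda>t. (f t)\<^sup>2) * integral S (\<lambda>t. (g t)\<^sup>2)"
proof -
  define cut :: "(real \<Rightarrow> real) \<Rightarrow> real \<Rightarrow> real" where "cut = (\<lambda>h t. if t \<in> S then h t else 0)"
  have S': "S \<in> sets (lebesgue_on {0..1})" using S by (auto simp: sets_restrict_space)
  have cut: "L2_function (cut h)" if "L2_function h" for h
  proof (rule L2_function_bound[OF that])
    show "cut h \<in> borel_measurable (lebesgue_on {0..1})"
      unfolding cut_def using L2_function_measurable[OF that] S'
      by (intro measurable_If_set) (auto simp: Int_absorb2 S(2))
  qed (simp add: cut_def)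
  have inner: "abs_L2 (cut h) \<bullet> abs_L2 (cut k) = integral S (\<lambda>t. h t * k t)"
    if "L2_function h" "L2_function k" for h k
  proof -
    have "abs_L2 (cut h) \<bullet> abs_L2 (cut k) = (LINT t|lebesgue_on {0..1}. cut h t \<bullet> cut k t)"
      using that cut by (intro inner_L2.abs_eq L2_eq_refl)
    also have "\<dots> = integral {0..1} (\<lambda>t. cut h t \<bullet> cut k t)"
      using that cut by (intro lebesgue_integral_eq_integral L2_function_inner_integrable) auto
    also have "(\<lambda>t. cut h t \<bullet> cut k t) = (\<lambda>t. if t \<in> S then h t * k t else 0)"
      by (auto simp: cut_def)
    also have "integral {0..1} \<dots> = integral S (\<lambda>t. h t * k t)"
      using S(2) by (simp add: integral_restrict_Int Int_absorb2)
    finally show ?thesis .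
  qed
  show ?thesis
    using Cauchy_Schwarz_ineq[of "abs_L2 (cut f)" "abs_L2 (cut g)"] inner f g
    by (simp add: power2_eq_square)
qed

text \<open>Cauchy--Schwarz against the constant 1. The factor \<open>sqrt (b - a)\<close> is the
  source of the 1/2-Hoelder estimate for trajectories.\<close>

lemma integral_norm_le_sqrt:
  fixes f :: "real \<Rightarrow> 'a::euclidean_space"
  assumes f: "L2_function f" and ab: "0 \<le> a" "a \<le> b" "b \<le> 1"
  shows "integral {a..b} (\<lambda>t. norm (f t)) \<le> sqrt (b - a) * sqrt (integral {0..1} (\<lambda>t. (norm (f t))\<^sup>2))"
proof -
  have sub: "{a..b} \<subseteq> {0..1}" using ab by auto
  have "(integral {a..b} (\<lambda>t. norm (f t) * 1))\<^sup>2
      \<le> integral {a..b} (\<lambda>t. (norm (f t))\<^sup>2) * integral {a..b} (\<lambda>t. 1\<^sup>2)"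
    using sub by (intro L2_Cauchy_Schwarz L2_function_norm f L2_function_continuous) auto
  also have "\<dots> \<le> integral {0..1} (\<lambda>t. (norm (f t))\<^sup>2) * (b - a)"
    using ab sub f
    by (auto intro!: mult_right_mono integral_subset_le L2_function_sq_integrable_on)
  finally have "(integral {a..b} (\<lambda>t. norm (f t)))\<^sup>2 \<le> (b - a) * integral {0..1} (\<lambda>t. (norm (f t))\<^sup>2)"
    by (simp add: mult.commute)
  then show ?thesis by (metis real_le_rsqrt real_sqrt_mult)
qed

lemma norm_integral_le_sqrt:
  fixes f :: "real \<Rightarrow> 'a::euclidean_space"
  assumes f: "L2_function f" and ab: "0 \<le> a" "a \<le> b" "b \<le> 1"
  shows "norm (integral {a..b} f) \<le> sqrt (b - a) * sqrt (integral {0..1} (\<lambda>t. (norm (f t))\<^sup>2))"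
proof -
  have "norm (integral {a..b} f) \<le> integral {a..b} (\<lambda>t. norm (f t))"
    using ab by (intro integral_norm_bound_integral L2_function_integrable_on[OF f]) auto
  then show ?thesis using integral_norm_le_sqrt[OF f ab] by linarith
qed

section \<open>Differential equation almost everywhere versus integral equation\<close>

lemma abs_continuous_imp_continuous_on:
  assumes "abs_continuous_on_Icc a b x"
  shows "continuous_on {a..b} x"
  unfolding continuous_on_iff
proof (intro ballI allI impI)
  fix s e :: real assume s: "s \<in> {a..b}" and "0 < e"
  obtain d where d: "d > 0" "\<And>(m::nat) l r. \<lbrakk>\<And>i. i < m \<Longrightarrow> a \<le> l i \<and> l i \<le> r i \<and> r i \<le> b;
      \<And>i j. i < m \<Longrightarrow> j < m \<Longrightarrow> i \<noteq> j \<Longrightarrow> {l i<..<r i} \<inter> {l j<..<r j} = {};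
      (\<Sum>i<m. r i - l i) < d\<rbrakk> \<Longrightarrow> (\<Sum>i<m. norm (x (r i) - x (l i))) < e"
    using abs_continuous_on_IccE[OF assms \<open>0 < e\<close>] by blast
  have "dist (x t) (x s) < e" if "t \<in> {a..b}" "dist t s < d" for t
    using d(2)[of 1 "\<lambda>_. min s t" "\<lambda>_. max s t"] s that
    by (cases "s \<le> t") (auto simp: dist_norm min_def max_def norm_minus_commute)
  then show "\<exists>d>0. \<forall>t\<in>{a..b}. dist t s < d \<longrightarrow> dist (x t) (x s) < e" using d(1) by blast
qed

text \<open>On the union \<open>S\<close> of the intervals, Cauchy--Schwarz bounds the square of the
  summed increments by \<open>B\<close> times the total length, which yields an explicit
  \<open>\<delta>\<close>.\<close>

lemma abs_continuous_indefinite_integral: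
  fixes f :: "real \<Rightarrow> 'a::euclidean_space"
  assumes f: "L2_function f" and x: "\<And>t. t \<in> {0..1} \<Longrightarrow> x t = c + integral {0..t} f"
  shows "abs_continuous_on_Icc 0 1 x"
  unfolding abs_continuous_on_Icc_def
proof (intro allI impI)
  fix e :: real assume "e > 0"
  define B where "B = integral {0..1} (\<lambda>t. (norm (f t))\<^sup>2)"
  have "B \<ge> 0" unfolding B_def by (rule integral_nonneg[OF L2_function_sq_integrable_on[OF f]]) auto
  \<comment> \<open>With \<open>B + 1\<close> the quotient makes sense for \<open>B = 0\<close>, and
    \<open>B * \<delta> < e\<^sup>2\<close> is strict.\<close>
  define \<delta> where "\<delta> = e\<^sup>2 / (B + 1)"
  have "\<delta> > 0" using \<open>e > 0\<close> \<open>B \<ge> 0\<close> by (simp add: \<delta>_def)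
  moreover have "(\<Sum>i<m. norm (x (r i) - x (l i))) < e"
    if lr: "\<forall>i<m. 0 \<le> l i \<and> l i \<le> r i \<and> r i \<le> 1"
      and disj: "\<forall>i<m. \<forall>j<m. i \<noteq> j \<longrightarrow> {l i<..<r i} \<inter> {l j<..<r j} = {}"
      and small: "(\<Sum>i<m. r i - l i) < \<delta>" for m :: nat and l r :: "nat \<Rightarrow> real"
  proof -
    define S where "S = (\<Union>i<m. {l i<..<r i})"
    have S: "S \<in> sets lebesgue" "S \<subseteq> {0..1}"
      unfolding S_def using lr by (auto intro!: sets.finite_UN)
    have pw: "pairwise (\<lambda>i j. negligible ({l i<..<r i} \<inter> {l j<..<r j})) {..<m}"
      using disj by (auto simp: pairwise_def)
    have UN: "(h has_integral (\<Sum>i<m. integral {l i..r i} h)) S" if "h integrable_on {0..1}" for h :: "real \<Rightarrow> real"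
      unfolding S_def
    proof (rule has_integral_UN[OF _ _ pw])
      fix i assume "i \<in> {..<m}"
      then have "h integrable_on {l i..r i}" using that lr by (intro integrable_subinterval_real[OF that]) auto
      then show "(h has_integral integral {l i..r i} h) {l i<..<r i}"
        using has_integral_Icc_iff_Ioo integrable_integral by blast
    qed simp
    have "norm (x (r i) - x (l i)) \<le> integral {l i..r i} (\<lambda>t. norm (f t))" if "i < m" for i
    proof -
      have i: "0 \<le> l i" "l i \<le> r i" "r i \<le> 1" using lr that by auto
      have "integral {0..l i} f + integral {l i..r i} f = integral {0..r i} f"
        using i by (intro Henstock_Kurzweil_Integration.integral_combine L2_function_integrable_on[OF f]) auto
      then have "x (r i) - x (l i) = integral {l i..r i} f"
        using i x[of "r i"] x[of "l i"] by (auto simp: algebra_simps)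
      moreover have "norm (integral {l i..r i} f) \<le> integral {l i..r i} (\<lambda>t. norm (f t))"
        using i by (intro integral_norm_bound_integral L2_function_integrable_on[OF f]) auto
      ultimately show ?thesis by simp
    qed
    then have "(\<Sum>i<m. norm (x (r i) - x (l i))) \<le> (\<Sum>i<m. integral {l i..r i} (\<lambda>t. norm (f t)))"
      by (intro sum_mono) auto
    also have "\<dots> = integral S (\<lambda>t. norm (f t) * 1)"
      using UN[OF L2_function_integrable_on(2)[OF f]] by (simp add: integral_unique)
    also have "\<dots> < e"
    proof (rule power2_less_imp_less)
      have "(integral S (\<lambda>t. norm (f t) * 1))\<^sup>2 \<le> integral S (\<lambda>t. (norm (f t))\<^sup>2) * integral S (\<lambda>t. 1\<^sup>2)"
        by (intro L2_Cauchy_Schwarz L2_function_norm f L2_function_continuous S) auto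
      also have "\<dots> \<le> B * integral S (\<lambda>t. 1\<^sup>2)"
      proof (rule mult_right_mono)
        show "integral S (\<lambda>t. (norm (f t))\<^sup>2) \<le> B"
          unfolding B_def using UN[OF L2_function_sq_integrable_on[OF f]] L2_function_sq_integrable_on[OF f] S
          by (intro integral_subset_le) auto
      qed (auto intro!: integral_nonneg UN has_integral_integrable)
      also have "integral S (\<lambda>t. 1\<^sup>2 :: real) = (\<Sum>i<m. r i - l i)"
        using UN[of "\<lambda>_. 1"] lr by (auto simp: integral_unique intro!: sum.cong)
      also have "B * \<dots> \<le> B * \<delta>"
        using small \<open>B \<ge> 0\<close> by (intro mult_left_mono) auto
      also have "\<dots> < e\<^sup>2" using \<open>e > 0\<close> \<open>B \<ge> 0\<close> by (simp add: \<delta>_def field_simps)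
      finally show "(integral S (\<lambda>t. norm (f t) * 1))\<^sup>2 < e\<^sup>2" .
    qed (use \<open>e > 0\<close> in simp)
    finally show ?thesis .
  qed
  ultimately show "\<exists>\<delta>>0. \<forall>(m::nat) l r. (\<forall>i<m. 0 \<le> l i \<and> l i \<le> r i \<and> r i \<le> 1) \<longrightarrow>
        (\<forall>i<m. \<forall>j<m. i \<noteq> j \<longrightarrow> {l i<..<r i} \<inter> {l j<..<r j} = {}) \<longrightarrow>
        (\<Sum>i<m. r i - l i) < \<delta> \<longrightarrow> (\<Sum>i<m. norm (x (r i) - x (l i))) < e"
    by blast
qed

lemma AE_lebesgue_on_iff_negligible:
  assumes "S \<in> sets lebesgue"
  shows "(AE t in lebesgue_on S. P t) \<longleftrightarrow> (\<exists>N. negligible N \<and> (\<forall>t\<in>S - N. P t))"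
proof -
  have "(AE t in lebesgue_on S. P t) \<longleftrightarrow> (AE t in lebesgue. t \<in> S \<longrightarrow> P t)"
    using assms by (intro AE_restrict_space_iff) simp
  also have "\<dots> \<longleftrightarrow> (\<exists>N. negligible N \<and> (\<forall>t\<in>S - N. P t))"
    unfolding eventually_ae_filter negligible_iff_null_sets by auto
  finally show ?thesis .
qed

text \<open>In the application \<open>g t\<close> is the right-hand side evaluated along
  \<open>x\<close>, whose square integrability is known only for continuous \<open>x\<close>; hence
  the conditional hypothesis. From left to right the fundamental theorem for absolutely continuous
  functions is used, from right to left Lebesgue's differentiation theorem.\<close>

lemma abs_continuous_derivative_iff_integral:
  fixes x :: "real \<Rightarrow> 'a::euclidean_space"
  assumes g: "continuous_on {0..1} x \<Longrightarrow> L2_function g"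
  shows "abs_continuous_on_Icc 0 1 x \<and>
      (AE t in lebesgue_on {0..1}. (x has_vector_derivative g t) (at t within {0..1})) \<and> x 0 = c
    \<longleftrightarrow> continuous_on {0..1} x \<and> (\<forall>t\<in>{0..1}. x t = c + integral {0..t} g)"
proof safe
  assume ac: "abs_continuous_on_Icc 0 1 x"
    and ae: "AE t in lebesgue_on {0..1}. (x has_vector_derivative g t) (at t within {0..1})"
  show "continuous_on {0..1} x" by (rule abs_continuous_imp_continuous_on[OF ac])
  obtain N where N: "negligible N" "\<And>t. t \<in> {0..1} - N \<Longrightarrow> (x has_vector_derivative g t) (at t within {0..1})"
    using ae by (subst (asm) AE_lebesgue_on_iff_negligible) auto
  fix t :: real assume t: "t \<in> {0..1}"
  have "(g has_integral (x t - x 0)) {0..t}"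
  proof (rule has_integral_abs_continuous[OF _ _ N(1)])
    show "abs_continuous_on_Icc 0 t x"
      unfolding abs_continuous_on_Icc_def
    proof (intro allI impI)
      fix e :: real assume "e > 0"
      then obtain \<delta> where \<delta>: "\<delta> > 0" "\<And>(m::nat) l r. \<lbrakk>\<And>i. i < m \<Longrightarrow> 0 \<le> l i \<and> l i \<le> r i \<and> r i \<le> 1;
          \<And>i j. i < m \<Longrightarrow> j < m \<Longrightarrow> i \<noteq> j \<Longrightarrow> {l i<..<r i} \<inter> {l j<..<r j} = {};
          (\<Sum>i<m. r i - l i) < \<delta>\<rbrakk> \<Longrightarrow> (\<Sum>i<m. norm (x (r i) - x (l i))) < e"
        using abs_continuous_on_IccE[OF ac] by blast
      show "\<exists>\<delta>>0. \<forall>(m::nat) l r. (\<forall>i<m. 0 \<le> l i \<and> l i \<le> r i \<and> r i \<le> t) \<longrightarrow>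
        (\<forall>i<m. \<forall>j<m. i \<noteq> j \<longrightarrow> {l i<..<r i} \<inter> {l j<..<r j} = {}) \<longrightarrow>
        (\<Sum>i<m. r i - l i) < \<delta> \<longrightarrow> (\<Sum>i<m. norm (x (r i) - x (l i))) < e"
        using t by (intro exI[of _ \<delta>] conjI allI impI \<delta>) (auto intro: order_trans)
    qed
    show "(x has_vector_derivative g s) (at s within {0..t})" if "s \<in> {0..t} - N" for s
      using N(2)[of s] that t by (auto intro: has_vector_derivative_within_subset)
  qed (use t in auto)
  then show "x t = x 0 + integral {0..t} g" by (simp add: integral_unique)
next
  assume cont: "continuous_on {0..1} x" and x: "\<forall>t\<in>{0..1}. x t = c + integral {0..t} g"
  have g: "L2_function g" by (rule g[OF cont])
  show "abs_continuous_on_Icc 0 1 x"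
    using abs_continuous_indefinite_integral[OF g, of x c] x by blast
  show "x 0 = c" using x by auto
  obtain N where N: "negligible N"
    "\<And>t. t \<in> {0..1} - N \<Longrightarrow> ((\<lambda>t. integral {0..t} g) has_vector_derivative g t) (at t within {0..1})"
    using lebesgue_differentiation[OF L2_function_integrable_on(1)[OF g, of 0 1]] by auto
  have "(x has_vector_derivative g t) (at t within {0..1})" if "t \<in> {0..1} - N" for t
  proof (rule has_vector_derivative_transform[of t "{0..1}" x "\<lambda>t. c + integral {0..t} g"])
    show "((\<lambda>t. c + integral {0..t} g) has_vector_derivative g t) (at t within {0..1})"
      using N(2)[OF that] by (auto intro!: derivative_eq_intros)
  qed (use that x in auto)
  then show "AE t in lebesgue_on {0..1}. (x has_vector_derivative g t) (at t within {0..1})"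
    using N(1) by (subst AE_lebesgue_on_iff_negligible) auto
qed

section \<open>Completeness of the space of square-integrable functions\<close>

lemma abs_rep_L2 [simp]: "abs_L2 (rep_L2 u) = u"
  by (rule Quotient3_abs_rep[OF Quotient3_L2])

lemma L2_function_rep [simp]: "L2_function (rep_L2 u)"
  using Quotient3_rep_reflp[OF Quotient3_L2, of u] by (simp add: L2_eq_def)

lemma rep_abs_L2: "L2_function f \<Longrightarrow> L2_eq (rep_L2 (abs_L2 f)) f"
  using Quotient3_rel_abs[OF Quotient3_L2] rep_abs_rsp_left[OF Quotient3_L2] L2_eq_refl by metis

lemma L2_eq_cong_integral:
  assumes "L2_eq f g" "{a..b} \<subseteq> {0..1}"
  shows "integral {a..b} f = integral {a..b} g"
proof -
  obtain N where "negligible N" "\<And>t. t \<in> {0..1} - N \<Longrightarrow> f t = g t"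
    using assms(1) unfolding L2_eq_def by (subst (asm) AE_lebesgue_on_iff_negligible) auto
  then show ?thesis using assms(2) by (intro integral_spike) auto
qed

lemma norm_L2_sq: "(norm u)\<^sup>2 = integral {0..1} (\<lambda>t. (norm (rep_L2 u t))\<^sup>2)"
proof -
  have "(norm u)\<^sup>2 = (LINT t|lebesgue_on {0..1}. (norm (rep_L2 u t))\<^sup>2)"
    by (simp add: norm_L2.rep_eq)
  also have "\<dots> = integral {0..1} (\<lambda>t. (norm (rep_L2 u t))\<^sup>2)"
    by (intro lebesgue_integral_eq_integral L2_function_sq_integrable) auto
  finally show ?thesis .
qed

lemma norm_abs_L2:
  assumes "L2_function f"
  shows "(norm (abs_L2 f))\<^sup>2 = (LINT t|lebesgue_on {0..1}. (norm (f t))\<^sup>2)"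
  using norm_L2.abs_eq[OF L2_eq_refl[OF assms]] by simp

lemma abs_L2_diff:
  "L2_function f \<Longrightarrow> L2_function g \<Longrightarrow> abs_L2 f - abs_L2 g = abs_L2 (\<lambda>t. f t - g t)"
  by (intro minus_L2.abs_eq L2_eq_refl)

lemma nn_integral_L2_sq:
  assumes "L2_function f"
  shows "(\<integral>\<^sup>+t. ennreal ((norm (f t))\<^sup>2) \<partial>lebesgue_on {0..1}) = ennreal ((norm (abs_L2 f))\<^sup>2)"
  unfolding norm_abs_L2[OF assms]
  by (intro nn_integral_eq_integral L2_function_sq_integrable assms) auto

lemma nn_integral_L2_norm_le:
  assumes f: "L2_function f"
  shows "(\<integral>\<^sup>+t. ennreal (norm (f t)) \<partial>lebesgue_on {0..1}) \<le> ennreal (norm (abs_L2 f))"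
proof -
  have "(\<integral>\<^sup>+t. ennreal (norm (f t)) \<partial>lebesgue_on {0..1}) = ennreal (LINT t|lebesgue_on {0..1}. norm (f t))"
    by (intro nn_integral_eq_integral integrable_norm L2_function_integrable f) auto
  also have "(LINT t|lebesgue_on {0..1}. norm (f t)) = integral {0..1} (\<lambda>t. norm (f t))"
    by (intro lebesgue_integral_eq_integral integrable_norm L2_function_integrable f) auto
  also have "\<dots> \<le> sqrt (integral {0..1} (\<lambda>t. (norm (f t))\<^sup>2))"
    using integral_norm_le_sqrt[OF f, of 0 1] by simp
  also have "integral {0..1} (\<lambda>t. (norm (f t))\<^sup>2) = (norm (abs_L2 f))\<^sup>2"
    unfolding norm_abs_L2[OF f]
    by (intro lebesgue_integral_eq_integral[symmetric] L2_function_sq_integrable f) auto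
  finally show ?thesis by (simp add: ennreal_leI)
qed

lemma Cauchy_geometric_subseq:
  fixes X :: "nat \<Rightarrow> 'a::metric_space"
  assumes "Cauchy X"
  obtains r where "strict_mono r" "\<And>n. dist (X (r n)) (X (r (Suc n))) < (1/2) ^ n"
proof -
  have "\<exists>r. \<forall>n. (\<forall>m\<ge>r n. dist (X (r n)) (X m) < (1/2) ^ n) \<and> r n < r (Suc n)"
  proof (rule dependent_nat_choice)
    have ex: "\<exists>k>l. \<forall>m\<ge>k. dist (X k) (X m) < (1/2) ^ n" for l n
    proof -
      obtain M where "\<forall>i\<ge>M. \<forall>j\<ge>M. dist (X i) (X j) < (1/2) ^ n"
        using assms unfolding Cauchy_def by (meson zero_less_divide_1_iff zero_less_numeral zero_less_power)
      then show ?thesis by (intro exI[of _ "max (Suc l) M"]) auto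
    qed
    show "\<exists>k. \<forall>m\<ge>k. dist (X k) (X m) < (1/2) ^ 0" using ex by blast
    show "\<exists>k. (\<forall>m\<ge>k. dist (X k) (X m) < (1/2) ^ Suc n) \<and> l < k" for l n using ex by blast
  qed
  then obtain r where r: "\<And>n m. m \<ge> r n \<Longrightarrow> dist (X (r n)) (X m) < (1/2) ^ n" "\<And>n. r n < r (Suc n)"
    by blast
  show thesis
    by (rule that[of r]) (use r in \<open>auto simp: strict_mono_Suc_iff less_imp_le\<close>)
qed

text \<open>The increments have summable \<open>L1\<close> norms, so the sum of their absolute
  values is finite at almost every point, and the telescoping series converges there.\<close>

lemma L2_geometric_AE_convergent:
  fixes u :: "nat \<Rightarrow> real \<Rightarrow> 'a::euclidean_space"
  assumes u: "\<And>n. L2_function (u n)"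
    and geo: "\<And>n. norm (abs_L2 (\<lambda>t. u (Suc n) t - u n t)) \<le> (1/2) ^ n"
  shows "AE t in lebesgue_on {0..1}. convergent (\<lambda>n. u n t)"
proof -
  define d where "d = (\<lambda>n t. u (Suc n) t - u n t)"
  have d: "L2_function (d n)" for n unfolding d_def by (intro L2_function_diff u)
  have [measurable]: "d n \<in> borel_measurable (lebesgue_on {0..1})" for n
    by (rule L2_function_measurable[OF d])
  have "(\<integral>\<^sup>+t. (\<Sum>n. ennreal (norm (d n t))) \<partial>lebesgue_on {0..1}) =
      (\<Sum>n. \<integral>\<^sup>+t. ennreal (norm (d n t)) \<partial>lebesgue_on {0..1})"
    by (intro nn_integral_suminf) measurable
  also have "\<dots> \<le> (\<Sum>n. ennreal ((1/2) ^ n))"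
  proof (intro suminf_le summableI)
    fix n
    show "(\<integral>\<^sup>+t. ennreal (norm (d n t)) \<partial>lebesgue_on {0..1}) \<le> ennreal ((1/2) ^ n)"
      using nn_integral_L2_norm_le[OF d, of n] ennreal_leI[OF geo[of n]]
      unfolding d_def by (rule order_trans)
  qed
  also have "\<dots> = ennreal (\<Sum>n. (1/2) ^ n)"
    by (intro suminf_ennreal2) auto
  finally have "(\<integral>\<^sup>+t. (\<Sum>n. ennreal (norm (d n t))) \<partial>lebesgue_on {0..1}) \<noteq> \<infinity>"
    by (auto simp: top_unique)
  then have "AE t in lebesgue_on {0..1}. (\<Sum>n. ennreal (norm (d n t))) \<noteq> \<infinity>"
    by (intro nn_integral_PInf_AE) measurable
  then show ?thesis
  proof eventually_elim
    case (elim t)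
    then have "summable (\<lambda>n. norm (d n t))"
      by (intro summable_suminf_not_top) auto
    then have "summable (\<lambda>n. d n t)" by (rule summable_norm_cancel)
    then have "convergent (\<lambda>n. u 0 t + (\<Sum>i<n. d i t))"
      by (intro convergent_add convergent_const) (simp add: summable_iff_convergent)
    moreover have "u 0 t + (\<Sum>i<n. d i t) = u n t" for n
      unfolding d_def by (simp add: sum_lessThan_telescope[of "\<lambda>i. u i t"])
    ultimately show ?case by simp
  qed
qed

text \<open>Riesz--Fischer: the pointwise limit of a subsequence with geometrically small increments
  is its limit in norm by Fatou's lemma, and a Cauchy sequence converges as soon as a subsequence
  does.\<close>

instance L2 :: (euclidean_space) complete_space
proof
  fix X :: "nat \<Rightarrow> 'a L2" assume X: "Cauchy X"
  obtain r where r: "strict_mono r" "\<And>n. dist (X (r n)) (X (r (Suc n))) < (1/2) ^ n"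
    using Cauchy_geometric_subseq[OF X] by blast
  define u where "u = (\<lambda>n. rep_L2 (X (r n)))"
  have u: "L2_function (u n)" "abs_L2 (u n) = X (r n)" for n by (simp_all add: u_def)
  have u_diff: "abs_L2 (\<lambda>t. u n t - u m t) = X (r n) - X (r m)" for n m
    using abs_L2_diff[OF u(1) u(1), of n m] u(2) by simp
  have [measurable]: "u n \<in> borel_measurable (lebesgue_on {0..1})" for n
    by (rule L2_function_measurable[OF u(1)])
  have "norm (abs_L2 (\<lambda>t. u (Suc n) t - u n t)) \<le> (1/2) ^ n" for n
    using r(2)[of n] by (simp add: u_diff dist_norm norm_minus_commute)
  then have conv: "AE t in lebesgue_on {0..1}. convergent (\<lambda>n. u n t)"
    by (intro L2_geometric_AE_convergent u)
  \<comment> \<open>On the null set of divergence \<open>lim\<close> returns an unspecified value;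
    \<open>v\<close> is measurable all the same.\<close>
  define v where "v = (\<lambda>t. lim (\<lambda>n. u n t))"
  have [measurable]: "v \<in> borel_measurable (lebesgue_on {0..1})"
    unfolding v_def by measurable
  \<comment> \<open>One bound for two purposes: finiteness makes \<open>v - u n\<close>
    square-integrable, and small \<open>e\<close> gives convergence in norm.\<close>
  have Fatou: "(\<integral>\<^sup>+t. ennreal ((norm (v t - u n t))\<^sup>2) \<partial>lebesgue_on {0..1}) \<le> ennreal (e\<^sup>2)"
    if e: "\<And>m. m \<ge> N \<Longrightarrow> dist (X (r m)) (X (r n)) \<le> e" for n N e
  proof -
    have "AE t in lebesgue_on {0..1}. ennreal ((norm (v t - u n t))\<^sup>2) \<le>
        liminf (\<lambda>m. ennreal ((norm (u m t - u n t))\<^sup>2))"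
      using conv
    proof eventually_elim
      case (elim t)
      then have "(\<lambda>m. u m t) \<longlonglongrightarrow> v t" by (simp add: v_def convergent_LIMSEQ_iff)
      then have "(\<lambda>m. ennreal ((norm (u m t - u n t))\<^sup>2)) \<longlonglongrightarrow> ennreal ((norm (v t - u n t))\<^sup>2)"
        by (intro tendsto_intros tendsto_ennrealI)
      from lim_imp_Liminf[OF trivial_limit_sequentially this] show ?case by simp
    qed
    then have "(\<integral>\<^sup>+t. ennreal ((norm (v t - u n t))\<^sup>2) \<partial>lebesgue_on {0..1}) \<le>
        (\<integral>\<^sup>+t. liminf (\<lambda>m. ennreal ((norm (u m t - u n t))\<^sup>2)) \<partial>lebesgue_on {0..1})"
      by (rule nn_integral_mono_AE)
    also have "\<dots> \<le> liminf (\<lambda>m. \<integral>\<^sup>+t. ennreal ((norm (u m t - u n t))\<^sup>2) \<partial>lebesgue_on {0..1})"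
      by (rule nn_integral_liminf) measurable
    also have "\<dots> = liminf (\<lambda>m. ennreal ((dist (X (r m)) (X (r n)))\<^sup>2))"
      by (simp add: nn_integral_L2_sq[OF L2_function_diff[OF u(1) u(1)]] u_diff dist_norm)
    also have "\<dots> \<le> ennreal (e\<^sup>2)"
    proof (rule Liminf_le)
      show "\<forall>\<^sub>F m in sequentially. ennreal ((dist (X (r m)) (X (r n)))\<^sup>2) \<le> ennreal (e\<^sup>2)"
        using e by (auto simp: eventually_sequentially intro!: exI[of _ N] ennreal_leI power_mono)
    qed simp
    finally show ?thesis .
  qed
  have Cr: "\<exists>N. \<forall>m\<ge>N. \<forall>n\<ge>N. dist (X (r m)) (X (r n)) < e" if "e > 0" for e
    using Cauchy_subseq_Cauchy[OF X r(1)] that unfolding Cauchy_def by (simp add: o_def)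
  have L2v: "L2_function (\<lambda>t. v t - u n t)" if e: "\<And>m. m \<ge> N \<Longrightarrow> dist (X (r m)) (X (r n)) \<le> e" for n N e
    unfolding L2_function_def
  proof
    show "integrable (lebesgue_on {0..1}) (\<lambda>t. (norm (v t - u n t))\<^sup>2)"
    proof (rule integrableI_bounded)
      show "(\<integral>\<^sup>+t. ennreal (norm ((norm (v t - u n t))\<^sup>2)) \<partial>lebesgue_on {0..1}) < \<infinity>"
        using Fatou[OF e] by (auto simp: less_top[symmetric] top_unique)
    qed measurable
  qed measurable
  obtain N where N: "\<forall>m\<ge>N. \<forall>n\<ge>N. dist (X (r m)) (X (r n)) < 1" using Cr[of 1] by auto
  have "L2_function (\<lambda>t. (v t - u N t) + u N t)"
    by (intro L2_function_add u L2v[of N N 1]) (use N in \<open>auto intro: less_imp_le\<close>)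
  then have v: "L2_function v" by simp
  have "(\<lambda>n. X (r n)) \<longlonglongrightarrow> abs_L2 v"
  proof (rule LIMSEQ_I)
    fix e :: real assume "e > 0"
    then obtain N where N: "\<forall>m\<ge>N. \<forall>n\<ge>N. dist (X (r m)) (X (r n)) < e / 2" using Cr[of "e / 2"] by auto
    have "norm (X (r n) - abs_L2 v) < e" if "n \<ge> N" for n
    proof -
      have "abs_L2 v - X (r n) = abs_L2 (\<lambda>t. v t - u n t)"
        using abs_L2_diff[OF v u(1)] u(2) by simp
      then have "ennreal ((norm (abs_L2 v - X (r n)))\<^sup>2) \<le> ennreal ((e / 2)\<^sup>2)"
        using nn_integral_L2_sq[OF L2_function_diff[OF v u(1)], of n] Fatou[of N n "e / 2"] N that
        by (auto intro: less_imp_le)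
      then have "(norm (abs_L2 v - X (r n)))\<^sup>2 \<le> (e / 2)\<^sup>2" by simp
      then have "norm (abs_L2 v - X (r n)) \<le> e / 2" using \<open>e > 0\<close> by (simp add: power2_le_iff_abs_le)
      then show ?thesis using \<open>e > 0\<close> by (simp add: norm_minus_commute)
    qed
    then show "\<exists>N. \<forall>n\<ge>N. norm (X (r n) - abs_L2 v) < e" by blast
  qed
  then have "X \<longlonglongrightarrow> abs_L2 v"
    using Cauchy_converges_subseq[OF X r(1), of "abs_L2 v"] by (simp add: o_def)
  then show "convergent X" by (rule convergentI)
qed

section \<open>Integral equations with square-integrable Lipschitz constants\<close>

text \<open>The right-hand side \<open>\<Psi>\<close> of the hypothesis satisfies
  \<open>\<Psi>' \<le> c * \<Psi>\<close>, so \<open>exp (- c * t) * \<Psi> t\<close> is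
  non-increasing.\<close>

lemma Gronwall:
  fixes \<psi> :: "real \<Rightarrow> real"
  assumes cont: "continuous_on {0..1} \<psi>" and "c \<ge> 0"
    and le: "\<And>t. t \<in> {0..1} \<Longrightarrow> \<psi> t \<le> B + c * integral {0..t} \<psi>"
    and t: "t \<in> {0..1}"
  shows "\<psi> t \<le> B * exp (c * t)"
proof -
  define \<Psi> where "\<Psi> = (\<lambda>t. B + c * integral {0..t} \<psi>)"
  define E where "E = (\<lambda>t. exp (- c * t) * \<Psi> t)"
  have der: "(\<Psi> has_real_derivative c * \<psi> s) (at s within {0..1})" if "s \<in> {0..1}" for s
    unfolding \<Psi>_def
    using integral_has_real_derivative[OF cont that] by (auto intro!: derivative_eq_intros)
  have "E t \<le> E 0"
  proof (rule DERIV_nonpos_imp_decreasing_open[of 0 t E])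
    show "0 \<le> t" using t by simp
    have "continuous_on {0..1} \<Psi>"
      using der by (meson DERIV_continuous continuous_on_eq_continuous_within)
    then show "continuous_on {0..t} E"
      unfolding E_def using t by (intro continuous_intros) (auto elim: continuous_on_subset)
    fix s assume s: "0 < s" "s < t"
    have "(\<Psi> has_real_derivative c * \<psi> s) (at s)"
      using der[of s] s t at_within_interior[of s "{0..1}"] by auto
    then have "(E has_real_derivative exp (- c * s) * (c * (\<psi> s - \<Psi> s))) (at s)"
      unfolding E_def by (auto intro!: derivative_eq_intros simp: algebra_simps)
    moreover have "exp (- c * s) * (c * (\<psi> s - \<Psi> s)) \<le> 0"
      using le[of s] s t \<open>c \<ge> 0\<close> by (intro mult_nonneg_nonpos) (auto simp: \<Psi>_def)
    ultimately show "\<exists>y. (E has_real_derivative y) (at s) \<and> y \<le> 0" by blast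
  qed
  then have "exp (- (c * t)) * \<Psi> t \<le> B" by (simp add: E_def \<Psi>_def)
  then have "\<Psi> t \<le> B * exp (c * t)" by (simp add: exp_minus field_simps)
  then show ?thesis using le[OF t] by (simp add: \<Psi>_def)
qed

lemma L2_mult_integrable_on:
  fixes f g :: "real \<Rightarrow> real"
  assumes "L2_function f" "L2_function g" "{a..b} \<subseteq> {0..1}"
  shows "(\<lambda>t. f t * g t) integrable_on {a..b}"
  using integrable_on_lebesgue_on[OF L2_function_inner_integrable[OF assms(1,2)]] assms(3)
  by (auto intro: integrable_subinterval_real)

lemma L2_Cauchy_Schwarz_interval:
  fixes f g :: "real \<Rightarrow> real"
  assumes f: "L2_function f" and g: "L2_function g" and t: "t \<in> {0..1}"
  shows "(integral {0..t} (\<lambda>s. f s * g s))\<^sup>2 \<le> integral {0..1} (\<lambda>s. (f s)\<^sup>2) * integral {0..t} (\<lambda>s. (g s)\<^sup>2)"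
proof -
  have "(integral {0..t} (\<lambda>s. f s * g s))\<^sup>2 \<le> integral {0..t} (\<lambda>s. (f s)\<^sup>2) * integral {0..t} (\<lambda>s. (g s)\<^sup>2)"
    using t by (intro L2_Cauchy_Schwarz f g) auto
  also have "\<dots> \<le> integral {0..1} (\<lambda>s. (f s)\<^sup>2) * integral {0..t} (\<lambda>s. (g s)\<^sup>2)"
    using t L2_function_sq_integrable_on[OF f] L2_function_sq_integrable_on[OF g]
    by (intro mult_right_mono integral_subset_le integral_nonneg) auto
  finally show ?thesis .
qed

text \<open>Squaring and the Cauchy--Schwarz inequality reduce a square-integrable kernel to the
  constant kernel of the classical inequality.\<close>

lemma L2_Gronwall:
  fixes \<phi> k :: "real \<Rightarrow> real"
  assumes cont: "continuous_on {0..1} \<phi>" and nonneg: "\<And>t. t \<in> {0..1} \<Longrightarrow> \<phi> t \<ge> 0"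
    and k: "L2_function k" and "A \<ge> 0"
    and le: "\<And>t. t \<in> {0..1} \<Longrightarrow> \<phi> t \<le> A + integral {0..t} (\<lambda>s. k s * \<phi> s)"
    and t: "t \<in> {0..1}"
  shows "\<phi> t \<le> 2 * A * exp (integral {0..1} (\<lambda>s. (k s)\<^sup>2))"
proof -
  define K where "K = integral {0..1} (\<lambda>s. (k s)\<^sup>2)"
  have "K \<ge> 0" unfolding K_def using L2_function_sq_integrable_on[OF k] by (intro integral_nonneg) auto
  have "(\<phi> t)\<^sup>2 \<le> 2 * A\<^sup>2 * exp (2 * K * t)"
  proof (rule Gronwall[OF _ _ _ t])
    show "continuous_on {0..1} (\<lambda>t. (\<phi> t)\<^sup>2)" using cont by (intro continuous_intros)
    fix t :: real assume t: "t \<in> {0..1}"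
    define I where "I = integral {0..t} (\<lambda>s. k s * \<phi> s)"
    have "(\<phi> t)\<^sup>2 \<le> (A + I)\<^sup>2" using le[OF t] nonneg[OF t] unfolding I_def by (intro power_mono)
    also have "\<dots> \<le> 2 * A\<^sup>2 + 2 * I\<^sup>2"
      using sum_squares_bound[of A I] by (simp add: power2_sum)
    also have "I\<^sup>2 \<le> K * integral {0..t} (\<lambda>s. (\<phi> s)\<^sup>2)"
      unfolding I_def K_def by (intro L2_Cauchy_Schwarz_interval k L2_function_continuous cont t)
    finally show "(\<phi> t)\<^sup>2 \<le> 2 * A\<^sup>2 + 2 * K * integral {0..t} (\<lambda>s. (\<phi> s)\<^sup>2)" by simp
  qed (use \<open>K \<ge> 0\<close> in simp)
  also have "\<dots> \<le> 2 * A\<^sup>2 * exp (2 * K)"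
    using t \<open>K \<ge> 0\<close> by (intro mult_left_mono) (auto intro: mult_left_le)
  \<comment> \<open>Enlarging the factor 2 to 4 gives a perfect square, so that \<open>A\<close>
    enters with the constant 2 instead of \<open>sqrt 2\<close>.\<close>
  also have "\<dots> \<le> (2 * A * exp K)\<^sup>2"
  proof -
    have "exp (2 * K) = (exp K)\<^sup>2" by (simp add: exp_double)
    then show ?thesis by (simp add: power_mult_distrib mult_right_mono)
  qed
  finally show ?thesis
    unfolding K_def by (rule power2_le_imp_le) (use \<open>A \<ge> 0\<close> in simp)
qed

text \<open>Caratheodory conditions at the level of \<open>L2\<close>. The last clause bundles
  measurability and integrability along continuous curves, which the Picard operator needs. The
  Lipschitz bound holds at every \<open>t\<close>, which forces \<open>k t \<ge> 0\<close> on the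
  unit interval.\<close>

definition L2_Lipschitz_field :: "(real \<Rightarrow> 'a::euclidean_space \<Rightarrow> 'a) \<Rightarrow> (real \<Rightarrow> real) \<Rightarrow> bool" where
  "L2_Lipschitz_field f k \<longleftrightarrow> L2_function k \<and>
     (\<forall>t\<in>{0..1}. \<forall>x y. norm (f t x - f t y) \<le> k t * norm (x - y)) \<and>
     (\<forall>x. continuous_on {0..1} x \<longrightarrow> L2_function (\<lambda>t. f t (x t)))"

definition integral_solution ::
  "(real \<Rightarrow> 'a::euclidean_space \<Rightarrow> 'a) \<Rightarrow> 'a \<Rightarrow> (real \<Rightarrow> 'a) \<Rightarrow> bool" where
  "integral_solution f c x \<longleftrightarrow> continuous_on {0..1} x \<and>
     (\<forall>t\<in>{0..1}. x t = c + integral {0..t} (\<lambda>s. f s (x s)))"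

text \<open>The defect of \<open>y\<close> in the equation of \<open>x\<close> is measured with the
  norm outside the integral. Fields whose difference is large but rapidly oscillating thus count as
  close, which is what allows controls to be compared through their primitives.\<close>

lemma integral_solution_stability:
  assumes f: "L2_Lipschitz_field f k"
    and x: "integral_solution f c x" and y: "integral_solution g d y"
    and g: "L2_function (\<lambda>s. g s (y s))" and "A \<ge> 0"
    and A: "\<And>t. t \<in> {0..1} \<Longrightarrow> norm (c - d + integral {0..t} (\<lambda>s. f s (y s) - g s (y s))) \<le> A"
    and t: "t \<in> {0..1}"
  shows "norm (x t - y t) \<le> 2 * A * exp (integral {0..1} (\<lambda>s. (k s)\<^sup>2))"
proof (rule L2_Gronwall[OF _ _ _ \<open>A \<ge> 0\<close> _ t])
  have cont: "continuous_on {0..1} x" "continuous_on {0..1} y"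
    using x y by (auto simp: integral_solution_def)
  show contn: "continuous_on {0..1} (\<lambda>t. norm (x t - y t))" using cont by (intro continuous_intros)
  show k: "L2_function k" using f by (simp add: L2_Lipschitz_field_def)
  have fx: "L2_function (\<lambda>s. f s (x s))" and fy: "L2_function (\<lambda>s. f s (y s))"
    using f cont by (auto simp: L2_Lipschitz_field_def)
  fix t :: real assume t: "t \<in> {0..1}"
  have sub: "{0..t} \<subseteq> {0..1}" using t by auto
  note int = L2_function_integrable_on(1)[OF _ sub]
  have "x t - y t = c - d + (integral {0..t} (\<lambda>s. f s (x s)) - integral {0..t} (\<lambda>s. g s (y s)))"
    using x y t by (simp add: integral_solution_def)
  also have "integral {0..t} (\<lambda>s. f s (x s)) - integral {0..t} (\<lambda>s. g s (y s)) =
      integral {0..t} (\<lambda>s. f s (y s) - g s (y s)) + integral {0..t} (\<lambda>s. f s (x s) - f s (y s))"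
    by (simp add: Henstock_Kurzweil_Integration.integral_diff int[OF fx] int[OF fy] int[OF g])
  finally have "norm (x t - y t) \<le> norm (c - d + integral {0..t} (\<lambda>s. f s (y s) - g s (y s))) +
      norm (integral {0..t} (\<lambda>s. f s (x s) - f s (y s)))"
    by (metis add.assoc norm_triangle_ineq)
  moreover have "norm (integral {0..t} (\<lambda>s. f s (x s) - f s (y s))) \<le> integral {0..t} (\<lambda>s. k s * norm (x s - y s))"
  proof (rule integral_norm_bound_integral)
    show "(\<lambda>s. f s (x s) - f s (y s)) integrable_on {0..t}"
      by (intro Henstock_Kurzweil_Integration.integrable_diff int fx fy)
    show "(\<lambda>s. k s * norm (x s - y s)) integrable_on {0..t}"
      by (intro L2_mult_integrable_on k L2_function_continuous contn sub)
  qed (use f sub in \<open>auto simp: L2_Lipschitz_field_def\<close>)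
  ultimately show "norm (x t - y t) \<le> A + integral {0..t} (\<lambda>s. k s * norm (x s - y s))"
    using A[OF t] by linarith
qed auto

lemma integral_solution_unique:
  assumes f: "L2_Lipschitz_field f k"
    and x: "integral_solution f c x" and y: "integral_solution f c y" and t: "t \<in> {0..1}"
  shows "x t = y t"
proof -
  have "L2_function (\<lambda>s. f s (y s))"
    using f y by (auto simp: L2_Lipschitz_field_def integral_solution_def)
  then have "norm (x t - y t) \<le> 2 * 0 * exp (integral {0..1} (\<lambda>s. (k s)\<^sup>2))"
    by (intro integral_solution_stability[OF f x y _ _ _ t]) auto
  then show ?thesis by simp
qed

text \<open>The weight \<^term>\<open>exp (- \<omega> * t)\<close> turns the Picard operator into a contraction of the bounded
  continuous functions on the line; \<^term>\<open>max 0 (min 1 t)\<close> retracts the line to the unit interval.\<close>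

lemma integral_solution_exists:
  assumes f: "L2_Lipschitz_field (f :: real \<Rightarrow> 'a::euclidean_space \<Rightarrow> 'a) k"
  shows "\<exists>x. integral_solution f c x"
proof -
  have k: "L2_function k" using f by (simp add: L2_Lipschitz_field_def)
  define K where "K = integral {0..1} (\<lambda>s. (k s)\<^sup>2)"
  have "K \<ge> 0" unfolding K_def using L2_function_sq_integrable_on[OF k] by (intro integral_nonneg) auto
  \<comment> \<open>Cauchy--Schwarz bounds the contraction factor by
    \<open>sqrt (K / (2 * \<omega>))\<close>, and \<open>4 * K \<le> 2 * \<omega>\<close> makes this
    at most 1/2.\<close>
  define \<omega> where "\<omega> = 2 * K + 1"
  have "\<omega> > 0" using \<open>K \<ge> 0\<close> by (simp add: \<omega>_def)
  \<comment> \<open>The fixed point is sought among weighted curves \<open>z\<close>;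
    \<open>X z\<close> is the curve with the weight removed.\<close>
  define X where "X = (\<lambda>(z :: real \<Rightarrow>\<^sub>C 'a) s. exp (\<omega> * s) *\<^sub>R z s)"
  define P where "P = (\<lambda>z t. exp (- (\<omega> * t)) *\<^sub>R (c + integral {0..t} (\<lambda>s. f s (X z s))))"
  define cl where "cl = (\<lambda>t::real. max 0 (min 1 t))"
  have cl: "cl t \<in> {0..1}" "t \<in> {0..1} \<Longrightarrow> cl t = t" for t by (auto simp: cl_def)
  define T where "T = (\<lambda>z. Bcontfun (\<lambda>t. P z (cl t)))"
  have contX: "continuous_on {0..1} (X z)" for z
    unfolding X_def by (intro continuous_intros continuous_on_apply_bcontfun)
  have fX: "L2_function (\<lambda>s. f s (X z s))" for z
    using f contX by (auto simp: L2_Lipschitz_field_def)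
  have contP: "continuous_on {0..1} (P z)" for z
    unfolding P_def
    by (intro continuous_intros indefinite_integral_continuous_1 L2_function_integrable_on fX) auto
  have T: "apply_bcontfun (T z) = (\<lambda>t. P z (cl t))" for z
    unfolding T_def
  proof (rule Bcontfun_inverse)
    have "continuous_on UNIV (\<lambda>t. P z (cl t))"
      by (rule continuous_on_compose2[OF contP]) (use cl in \<open>auto simp: cl_def intro!: continuous_intros\<close>)
    moreover have "bounded (P z ` {0..1})"
      by (intro compact_imp_bounded compact_continuous_image contP compact_Icc)
    then have "bounded (range (\<lambda>t. P z (cl t)))"
      by (rule bounded_subset) (use cl in auto)
    ultimately show "(\<lambda>t. P z (cl t)) \<in> bcontfun" by (simp add: bcontfun_def)
  qed
  have contraction: "dist (P z t) (P w t) \<le> 1/2 * dist z w" if t: "t \<in> {0..1}" for z w t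
  proof -
    have sub: "{0..t} \<subseteq> {0..1}" using t by auto
    have L2e: "L2_function (\<lambda>s. exp (\<omega> * s))" by (intro L2_function_continuous continuous_intros)
    have ie: "(\<lambda>s. k s * exp (\<omega> * s)) integrable_on {0..t}"
      by (intro L2_mult_integrable_on k L2e sub)
    have "dist (P z t) (P w t) = exp (- (\<omega> * t)) * norm (integral {0..t} (\<lambda>s. f s (X z s)) - integral {0..t} (\<lambda>s. f s (X w s)))"
      by (simp add: P_def dist_norm flip: scaleR_diff_right)
    also have "integral {0..t} (\<lambda>s. f s (X z s)) - integral {0..t} (\<lambda>s. f s (X w s)) = integral {0..t} (\<lambda>s. f s (X z s) - f s (X w s))"
      by (intro Henstock_Kurzweil_Integration.integral_diff[symmetric] L2_function_integrable_on fX sub)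
    also have "norm \<dots> \<le> integral {0..t} (\<lambda>s. k s * exp (\<omega> * s) * dist z w)"
    proof (rule integral_norm_bound_integral)
      show "(\<lambda>s. f s (X z s) - f s (X w s)) integrable_on {0..t}"
        by (intro Henstock_Kurzweil_Integration.integrable_diff L2_function_integrable_on fX sub)
      show "(\<lambda>s. k s * exp (\<omega> * s) * dist z w) integrable_on {0..t}"
        by (intro integrable_on_mult_left ie)
      fix s assume "s \<in> {0..t}"
      then have s: "s \<in> {0..1}" using sub by auto
      then have le: "norm (f s x - f s y) \<le> k s * norm (x - y)" for x y
        using f by (auto simp: L2_Lipschitz_field_def)
      \<comment> \<open>Testing the Lipschitz bound on a unit vector shows that \<open>k s\<close>
        is nonnegative.\<close>
      have "0 \<le> norm (f s (SOME x. x \<in> Basis) - f s 0)" by simp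
      also have "\<dots> \<le> k s" using le[of "SOME x. x \<in> Basis" 0] by (simp add: norm_Basis SOME_Basis)
      finally have "k s \<ge> 0" .
      have "norm (X z s - X w s) = exp (\<omega> * s) * dist (z s) (w s)"
        by (simp add: X_def dist_norm flip: scaleR_diff_right)
      also have "\<dots> \<le> exp (\<omega> * s) * dist z w" by (intro mult_left_mono dist_bounded) auto
      finally have "k s * norm (X z s - X w s) \<le> k s * (exp (\<omega> * s) * dist z w)"
        using \<open>k s \<ge> 0\<close> by (rule mult_left_mono)
      then show "norm (f s (X z s) - f s (X w s)) \<le> k s * exp (\<omega> * s) * dist z w"
        using le[of "X z s" "X w s"] by (simp add: mult.assoc)
    qed
    also have "\<dots> = integral {0..t} (\<lambda>s. k s * exp (\<omega> * s)) * dist z w"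
      by simp
    also have "integral {0..t} (\<lambda>s. k s * exp (\<omega> * s)) \<le> exp (\<omega> * t) / 2"
    proof (rule power2_le_imp_le)
      have "(integral {0..t} (\<lambda>s. k s * exp (\<omega> * s)))\<^sup>2 \<le> K * integral {0..t} (\<lambda>s. (exp (\<omega> * s))\<^sup>2)"
        unfolding K_def by (intro L2_Cauchy_Schwarz_interval k L2e t)
      also have "integral {0..t} (\<lambda>s. (exp (\<omega> * s))\<^sup>2) = (exp (\<omega> * t))\<^sup>2 / (2 * \<omega>) - 1 / (2 * \<omega>)"
      proof (rule integral_unique)
        have "((\<lambda>s. (exp (\<omega> * s))\<^sup>2) has_integral (exp (\<omega> * t))\<^sup>2 / (2 * \<omega>) - (exp (\<omega> * 0))\<^sup>2 / (2 * \<omega>)) {0..t}"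
          using t \<open>\<omega> > 0\<close>
          by (intro fundamental_theorem_of_calculus)
            (auto intro!: derivative_eq_intros simp: has_real_derivative_iff_has_vector_derivative[symmetric] power2_eq_square)
        then show "((\<lambda>s. (exp (\<omega> * s))\<^sup>2) has_integral (exp (\<omega> * t))\<^sup>2 / (2 * \<omega>) - 1 / (2 * \<omega>)) {0..t}"
          by simp
      qed
      also have "K * \<dots> \<le> K * ((exp (\<omega> * t))\<^sup>2 / (2 * \<omega>))"
        using \<open>K \<ge> 0\<close> \<open>\<omega> > 0\<close> by (intro mult_left_mono) auto
      also have "\<dots> = (K / (2 * \<omega>)) * (exp (\<omega> * t))\<^sup>2" by simp
      also have "\<dots> \<le> (1/4) * (exp (\<omega> * t))\<^sup>2"
        using \<open>K \<ge> 0\<close> by (intro mult_right_mono) (auto simp: \<omega>_def field_simps)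
      also have "\<dots> = (exp (\<omega> * t) / 2)\<^sup>2" by (simp add: power_divide)
      finally show "(integral {0..t} (\<lambda>s. k s * exp (\<omega> * s)))\<^sup>2 \<le> (exp (\<omega> * t) / 2)\<^sup>2" .
    qed simp
    finally show ?thesis
      by (simp add: mult_right_mono mult_left_mono exp_minus field_simps)
  qed
  have "\<forall>z w. dist (T z) (T w) \<le> 1/2 * dist z w"
    by (intro allI dist_bound) (use contraction cl in \<open>auto simp: T\<close>)
  then obtain z where z: "T z = z" using banach_fix_type[of "1/2" T] by auto
  have "integral_solution f c (X z)"
    unfolding integral_solution_def
  proof (intro conjI ballI contX)
    fix t :: real assume "t \<in> {0..1}"
    then have "z t = P z t" using fun_cong[OF T[of z], of t] z cl by simp
    then show "X z t = c + integral {0..t} (\<lambda>s. f s (X z s))"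
      by (simp add: X_def P_def exp_minus)
  qed
  then show ?thesis by blast
qed

section \<open>Trajectories of the controlled system\<close>

lemma integral_step_bound:
  fixes w :: "real \<Rightarrow> 'b::euclidean_space" and B :: "real \<Rightarrow> 'b \<Rightarrow> 'a::euclidean_space"
  assumes w: "L2_function w" and g: "L2_function (\<lambda>s. B s (w s))"
    and lin: "bounded_linear (B p)" and pq: "0 \<le> p" "p \<le> q" "q \<le> 1"
    and osc: "\<And>s v. p \<le> s \<Longrightarrow> s \<le> q \<Longrightarrow> norm (B s v - B p v) \<le> \<epsilon> * norm v"
    and D: "\<And>v. norm (B p v) \<le> D * norm v"
  shows "norm (integral {p..q} (\<lambda>s. B s (w s))) \<le>
    \<epsilon> * integral {p..q} (\<lambda>s. norm (w s)) + D * norm (integral {p..q} w)"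
proof -
  have sub: "{p..q} \<subseteq> {0..1}" using pq by auto
  note int = L2_function_integrable_on[OF _ sub]
  have lin_int: "(\<lambda>s. B p (w s)) integrable_on {p..q}" "integral {p..q} (\<lambda>s. B p (w s)) = B p (integral {p..q} w)"
    using integrable_linear[OF int(1)[OF w] lin] integral_linear[OF int(1)[OF w] lin] by (simp_all add: o_def)
  have "integral {p..q} (\<lambda>s. B s (w s)) = integral {p..q} (\<lambda>s. B s (w s) - B p (w s)) + B p (integral {p..q} w)"
    by (simp add: Henstock_Kurzweil_Integration.integral_diff int(1)[OF g] lin_int)
  also have "norm \<dots> \<le> norm (integral {p..q} (\<lambda>s. B s (w s) - B p (w s))) + norm (B p (integral {p..q} w))"
    by (rule norm_triangle_ineq)
  also have "norm (integral {p..q} (\<lambda>s. B s (w s) - B p (w s))) \<le> integral {p..q} (\<lambda>s. \<epsilon> * norm (w s))"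
    using osc by (intro integral_norm_bound_integral Henstock_Kurzweil_Integration.integrable_diff
        int(1)[OF g] lin_int integrable_on_mult_right int(2)[OF w]) auto
  also have "\<dots> = \<epsilon> * integral {p..q} (\<lambda>s. norm (w s))" by simp
  finally show ?thesis using D[of "integral {p..q} w"] by linarith
qed

text \<open>No derivative of \<open>B\<close> is available for an integration by parts, so \<open>B\<close> is frozen on each
  interval of the grid instead; only the primitive of \<open>w\<close> at the grid points then matters.\<close>

lemma integral_grid_bound:
  fixes w :: "real \<Rightarrow> 'b::euclidean_space" and B :: "real \<Rightarrow> 'b \<Rightarrow> 'a::euclidean_space"
  assumes w: "L2_function w" and g: "L2_function (\<lambda>s. B s (w s))" and M: "M \<ge> (1::nat)"
    and lin: "\<And>s. bounded_linear (B s)"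
    and osc: "\<And>r s v. 0 \<le> r \<Longrightarrow> r \<le> s \<Longrightarrow> s \<le> 1 \<Longrightarrow> s - r \<le> 1 / M \<Longrightarrow> norm (B s v - B r v) \<le> \<epsilon> * norm v"
    and D: "\<And>s v. s \<in> {0..1} \<Longrightarrow> norm (B s v) \<le> D * norm v" and "D \<ge> 0" "\<epsilon> \<ge> 0"
    and W: "\<And>j::nat. j \<le> M \<Longrightarrow> norm (integral {0..j / M} w) \<le> \<delta>"
    and N: "sqrt (integral {0..1} (\<lambda>s. (norm (w s))\<^sup>2)) \<le> n"
    and t: "t \<in> {0..1}"
  shows "norm (integral {0..t} (\<lambda>s. B s (w s))) \<le> \<epsilon> * n + 2 * real M * D * \<delta> + D * n / sqrt M"
proof -
  have M0: "real M > 0" using M by simp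
  have "\<delta> \<ge> 0" using W[of 0] by simp
  have split: "integral {0..q} h = integral {0..p} h + integral {p..q} h"
    if "L2_function h" "0 \<le> p" "p \<le> q" "q \<le> 1" for p q and h :: "real \<Rightarrow> 'c::euclidean_space"
    using that by (intro Henstock_Kurzweil_Integration.integral_combine[symmetric] L2_function_integrable_on) auto
  have grid: "norm (integral {0..j / M} (\<lambda>s. B s (w s))) \<le>
      \<epsilon> * integral {0..j / M} (\<lambda>s. norm (w s)) + j * (2 * D * \<delta>)" if "j \<le> M" for j
    using that
  proof (induction j)
    case (Suc j)
    let ?p = "real j / M" and ?q = "real (Suc j) / M"
    have pq: "0 \<le> ?p" "?p \<le> ?q" "?q \<le> 1" "?p \<le> 1" using M0 Suc.prems by (auto simp: field_simps)
    have "norm (integral {?p..?q} (\<lambda>s. B s (w s))) \<le>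
        \<epsilon> * integral {?p..?q} (\<lambda>s. norm (w s)) + D * norm (integral {?p..?q} w)"
    proof (rule integral_step_bound[OF w g lin pq(1-3)])
      show "norm (B s v - B ?p v) \<le> \<epsilon> * norm v" if "?p \<le> s" "s \<le> ?q" for s v
      proof (rule osc)
        have "?q - ?p = 1 / M" by (simp add: diff_divide_distrib[symmetric])
        then show "s - ?p \<le> 1 / M" using that by linarith
      qed (use pq that in auto)
      show "norm (B ?p v) \<le> D * norm v" for v using D pq by auto
    qed
    \<comment> \<open>The increment over one grid interval is a difference of two grid values of the
      primitive, hence the factor 2.\<close>
    moreover have "norm (integral {?p..?q} w) \<le> 2 * \<delta>"
      using split[OF w pq(1-3)] W[of j] W[of "Suc j"] Suc.prems
        norm_triangle_ineq4[of "integral {0..?q} w" "integral {0..?p} w"] by simp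
    then have "D * norm (integral {?p..?q} w) \<le> 2 * D * \<delta>"
      using \<open>D \<ge> 0\<close> mult_left_mono[of "norm (integral {?p..?q} w)" "2 * \<delta>" D] by simp
    moreover have "norm (integral {0..?q} (\<lambda>s. B s (w s))) \<le>
        norm (integral {0..?p} (\<lambda>s. B s (w s))) + norm (integral {?p..?q} (\<lambda>s. B s (w s)))"
      unfolding split[OF g pq(1-3)] by (rule norm_triangle_ineq)
    moreover have "\<epsilon> * integral {0..?q} (\<lambda>s. norm (w s)) =
        \<epsilon> * integral {0..?p} (\<lambda>s. norm (w s)) + \<epsilon> * integral {?p..?q} (\<lambda>s. norm (w s))"
      unfolding split[OF L2_function_norm[OF w] pq(1-3)] by (simp add: algebra_simps)
    moreover have "real (Suc j) * (2 * D * \<delta>) = j * (2 * D * \<delta>) + 2 * D * \<delta>" by (simp add: algebra_simps)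
    ultimately show ?case using Suc.IH Suc.prems by simp
  qed simp
  define j where "j = nat \<lfloor>t * M\<rfloor>"
  let ?p = "real j / M"
  have "real j = of_int \<lfloor>t * M\<rfloor>" using t M0 by (simp add: j_def)
  then have j: "real j \<le> t * M" "t * M < j + 1" by linarith+
  have "t * M \<le> M" using t M0 by (simp add: mult_left_le_one_le)
  then have "j \<le> M" using j by linarith
  have p: "0 \<le> ?p" "?p \<le> t" "t \<le> 1" using j t M0 by (auto simp: field_simps)
  have "t \<le> (j + 1) / M" using j M0 by (simp add: pos_le_divide_eq)
  then have p4: "t - ?p \<le> 1 / M" by (simp add: add_divide_distrib)
  have "norm (integral {?p..t} (\<lambda>s. B s (w s))) \<le>
      \<epsilon> * integral {?p..t} (\<lambda>s. norm (w s)) + D * norm (integral {?p..t} w)"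
  proof (rule integral_step_bound[OF w g lin p(1-3)])
    show "norm (B s v - B ?p v) \<le> \<epsilon> * norm v" if "?p \<le> s" "s \<le> t" for s v
      using osc[of ?p s] that p p4 by auto
    show "norm (B ?p v) \<le> D * norm v" for v using D p by auto
  qed
  moreover have "D * norm (integral {?p..t} w) \<le> D * n / sqrt M"
  proof -
    have "norm (integral {?p..t} w) \<le> sqrt (t - ?p) * sqrt (integral {0..1} (\<lambda>s. (norm (w s))\<^sup>2))"
      by (rule norm_integral_le_sqrt[OF w p(1-3)])
    also have "\<dots> \<le> sqrt (1 / M) * n"
      using p p4 N by (intro mult_mono real_sqrt_le_mono) (auto intro!: integral_nonneg L2_function_sq_integrable_on w)
    finally show ?thesis using mult_left_mono[OF _ \<open>D \<ge> 0\<close>] by (fastforce simp: real_sqrt_divide)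
  qed
  moreover have "norm (integral {0..t} (\<lambda>s. B s (w s))) \<le>
      norm (integral {0..?p} (\<lambda>s. B s (w s))) + norm (integral {?p..t} (\<lambda>s. B s (w s)))"
    unfolding split[OF g p(1-3)] by (rule norm_triangle_ineq)
  moreover have "\<epsilon> * integral {0..?p} (\<lambda>s. norm (w s)) + \<epsilon> * integral {?p..t} (\<lambda>s. norm (w s)) \<le> \<epsilon> * n"
  proof -
    have "integral {0..t} (\<lambda>s. norm (w s)) \<le> sqrt (t - 0) * sqrt (integral {0..1} (\<lambda>s. (norm (w s))\<^sup>2))"
      using t by (intro integral_norm_le_sqrt w) auto
    also have "\<dots> \<le> 1 * n"
      using t N by (intro mult_mono) (auto intro!: integral_nonneg L2_function_sq_integrable_on w)
    finally have "\<epsilon> * integral {0..t} (\<lambda>s. norm (w s)) \<le> \<epsilon> * n"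
      using \<open>\<epsilon> \<ge> 0\<close> by (simp add: mult_left_mono)
    then show ?thesis unfolding split[OF L2_function_norm[OF w] p(1-3)] by (simp add: algebra_simps)
  qed
  moreover have "j * (2 * D * \<delta>) \<le> 2 * real M * D * \<delta>"
    using \<open>j \<le> M\<close> \<open>D \<ge> 0\<close> \<open>\<delta> \<ge> 0\<close> mult_right_mono[of "real j" M "2 * D * \<delta>"] by (simp add: mult_ac)
  ultimately show ?thesis using grid[OF \<open>j \<le> M\<close>] by linarith
qed

text \<open>The hypotheses on the system concern single columns; the crude factor
  \<open>CARD('k)\<close> comes from bounding every coordinate of \<open>v\<close> by
  \<open>norm v\<close>.\<close>

lemma norm_matrix_vector_le:
  fixes A :: "real^'k^'n"
  assumes "\<And>i. norm (column i A) \<le> c"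
  shows "norm (A *v v) \<le> c * (CARD('k) * norm v)"
proof -
  have c: "c \<ge> 0" using assms norm_ge_zero order_trans by blast
  have "norm (A *v v) = norm (\<Sum>i\<in>UNIV. v $ i *s column i A)" by (simp add: matrix_mult_sum)
  also have "\<dots> \<le> (\<Sum>i\<in>(UNIV::'k set). norm v * c)"
  proof (rule sum_norm_le)
    fix i show "norm (v $ i *s column i A) \<le> norm v * c"
      using mult_mono[OF component_le_norm_cart[of v i] assms[of i]] by (simp add: scalar_mult_eq_scaleR)
  qed
  finally show ?thesis by (simp add: mult_ac)
qed

section \<open>Standing assumptions, Lipschitz and growth bounds\<close>

locale controlled_system =
  fixes \<Theta> :: "'p::euclidean_space set"
    and F0 :: "real^'n \<Rightarrow> 'p \<Rightarrow> real^'n"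
    and F :: "real^'n \<Rightarrow> 'p \<Rightarrow> real^'k^'n"
    and x0 :: "'p \<Rightarrow> real^'n"
    and L :: real
  assumes compact_params: "compact \<Theta>"
    and L_pos: "L > 0"
    and F0_Lipschitz: "\<And>x1 x2 \<theta>1 \<theta>2. \<theta>1 \<in> \<Theta> \<Longrightarrow> \<theta>2 \<in> \<Theta> \<Longrightarrow>
      norm (F0 x1 \<theta>1 - F0 x2 \<theta>2) \<le> L * (norm (x1 - x2) + norm (\<theta>1 - \<theta>2))"
    and F_Lipschitz: "\<And>i x1 x2 \<theta>1 \<theta>2. \<theta>1 \<in> \<Theta> \<Longrightarrow> \<theta>2 \<in> \<Theta> \<Longrightarrow>
      norm (column i (F x1 \<theta>1) - column i (F x2 \<theta>2)) \<le> L * (norm (x1 - x2) + norm (\<theta>1 - \<theta>2))"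
    and continuous_x0: "continuous_on \<Theta> x0"
begin

abbreviation traj :: "(real^'k) L2 \<Rightarrow> 'p \<Rightarrow> real \<Rightarrow> real^'n" where
  "traj \<equiv> trajectory F0 F x0"

definition rhs :: "(real^'k) L2 \<Rightarrow> 'p \<Rightarrow> real \<Rightarrow> real^'n \<Rightarrow> real^'n" where
  "rhs u \<theta> t x = F0 x \<theta> + F x \<theta> *v rep_L2 u t"

text \<open>A common factor for two bounds: times \<open>L\<close> it is a Lipschitz constant of
  \<open>rhs u \<theta> t\<close>, and times \<open>C * (1 + norm x)\<close> it bounds the size of
  the field.\<close>

definition weight :: "(real^'k) L2 \<Rightarrow> real \<Rightarrow> real" where
  "weight u t = 1 + CARD('k) * norm (rep_L2 u t)"

lemma weight_ge_1: "weight u t \<ge> 1" by (simp add: weight_def)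

lemma L2_weight: "L2_function (weight u)"
  using L2_function_add[OF L2_function_continuous[OF continuous_on_const[of _ "1::real"]]
      L2_function_scaleR[OF L2_function_norm[OF L2_function_rep[of u]], of "CARD('k)"]]
  by (simp add: weight_def[abs_def])

text \<open>The bound involves the control only through \<open>\<rho>\<close>; this is what makes
  the Gronwall factors uniform on the ball.\<close>

lemma integral_weight_sq_le:
  fixes \<rho> :: real
  assumes "norm u \<le> \<rho>"
  shows "integral {0..1} (\<lambda>t. (weight u t)\<^sup>2) \<le> 2 + 2 * (real CARD('k))\<^sup>2 * \<rho>\<^sup>2"
proof -
  have "integral {0..1} (\<lambda>t. (weight u t)\<^sup>2) \<le> integral {0..1} (\<lambda>t. 2 + 2 * (real CARD('k))\<^sup>2 * (norm (rep_L2 u t))\<^sup>2)"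
  proof (rule integral_le)
    show "(\<lambda>t. (weight u t)\<^sup>2) integrable_on {0..1}"
      using L2_function_sq_integrable_on[OF L2_weight, of 0 1 u] by simp
    show "(\<lambda>t. 2 + 2 * (real CARD('k))\<^sup>2 * (norm (rep_L2 u t))\<^sup>2) integrable_on {0..1}"
      by (intro Henstock_Kurzweil_Integration.integrable_add integrable_on_mult_right L2_function_sq_integrable_on) auto
    show "(weight u t)\<^sup>2 \<le> 2 + 2 * (real CARD('k))\<^sup>2 * (norm (rep_L2 u t))\<^sup>2" for t
      using sum_squares_bound[of 1 "CARD('k) * norm (rep_L2 u t)"]
      by (simp add: weight_def power2_sum power_mult_distrib)
  qed
  also have "\<dots> = 2 + 2 * (real CARD('k))\<^sup>2 * (norm u)\<^sup>2"
    unfolding norm_L2_sq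
    by (subst Henstock_Kurzweil_Integration.integral_add)
      (auto intro!: integrable_on_mult_right L2_function_sq_integrable_on)
  also have "\<dots> \<le> 2 + 2 * (real CARD('k))\<^sup>2 * \<rho>\<^sup>2"
    using assms by (intro add_left_mono mult_left_mono power_mono) auto
  finally show ?thesis .
qed

lemma integral_weight_le:
  fixes \<rho> :: real
  assumes "norm u \<le> \<rho>" "0 \<le> s" "s \<le> t" "t \<le> 1"
  shows "integral {s..t} (weight u) \<le> sqrt (t - s) * sqrt (2 + 2 * (real CARD('k))\<^sup>2 * \<rho>\<^sup>2)"
proof -
  have "integral {s..t} (weight u) = integral {s..t} (\<lambda>r. norm (weight u r))"
    using weight_ge_1[of u] by (intro integral_cong) (metis abs_of_nonneg order_trans real_norm_def zero_le_one)
  also have "\<dots> \<le> sqrt (t - s) * sqrt (integral {0..1} (\<lambda>t. (weight u t)\<^sup>2))"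
    using integral_norm_le_sqrt[OF L2_weight assms(2-4), of u] by simp
  also have "\<dots> \<le> sqrt (t - s) * sqrt (2 + 2 * (real CARD('k))\<^sup>2 * \<rho>\<^sup>2)"
    using integral_weight_sq_le[OF assms(1)] assms by (intro mult_left_mono) auto
  finally show ?thesis .
qed

lemma F_mult_Lipschitz:
  assumes "\<theta>1 \<in> \<Theta>" "\<theta>2 \<in> \<Theta>"
  shows "norm (F x \<theta>1 *v v - F y \<theta>2 *v v) \<le> L * (norm (x - y) + norm (\<theta>1 - \<theta>2)) * (CARD('k) * norm v)"
proof -
  have "column i (F x \<theta>1 - F y \<theta>2) = column i (F x \<theta>1) - column i (F y \<theta>2)" for i
    by (simp add: column_def vec_eq_iff)
  then show ?thesis
    using norm_matrix_vector_le[of "F x \<theta>1 - F y \<theta>2" _ v] F_Lipschitz[OF assms]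
    by (simp add: matrix_vector_mult_diff_rdistrib)
qed

lemma rhs_Lipschitz:
  assumes "\<theta>1 \<in> \<Theta>" "\<theta>2 \<in> \<Theta>"
  shows "norm (rhs u \<theta>1 t x - rhs u \<theta>2 t y) \<le> L * weight u t * (norm (x - y) + norm (\<theta>1 - \<theta>2))"
proof -
  have "rhs u \<theta>1 t x - rhs u \<theta>2 t y = (F0 x \<theta>1 - F0 y \<theta>2) + (F x \<theta>1 *v rep_L2 u t - F y \<theta>2 *v rep_L2 u t)"
    by (simp add: rhs_def)
  also have "norm \<dots> \<le> norm (F0 x \<theta>1 - F0 y \<theta>2) + norm (F x \<theta>1 *v rep_L2 u t - F y \<theta>2 *v rep_L2 u t)"
    by (rule norm_triangle_ineq)
  also have "\<dots> \<le> L * (norm (x - y) + norm (\<theta>1 - \<theta>2)) +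
      L * (norm (x - y) + norm (\<theta>1 - \<theta>2)) * (CARD('k) * norm (rep_L2 u t))"
    by (intro add_mono F0_Lipschitz F_mult_Lipschitz assms)
  also have "\<dots> = L * weight u t * (norm (x - y) + norm (\<theta>1 - \<theta>2))"
    by (simp add: weight_def algebra_simps)
  finally show ?thesis .
qed

text \<open>Joint Lipschitz continuity compares every value with the one at state 0 and a fixed
  parameter \<open>\<theta>0\<close>, and by compactness all parameters stay within
  \<open>2 * B\<close> of it. If \<open>\<Theta>\<close> is empty there is no
  \<open>\<theta>0\<close>, and any positive constant will do.\<close>

lemma growth:
  obtains C where "C > 0" "\<And>x \<theta>. \<theta> \<in> \<Theta> \<Longrightarrow> norm (F0 x \<theta>) \<le> C * (1 + norm x)"
    "\<And>x \<theta> i. \<theta> \<in> \<Theta> \<Longrightarrow> norm (column i (F x \<theta>)) \<le> C * (1 + norm x)"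
    "\<And>\<theta>. \<theta> \<in> \<Theta> \<Longrightarrow> norm (x0 \<theta>) \<le> C"
proof -
  have "bounded (x0 ` \<Theta>)"
    by (intro compact_imp_bounded compact_continuous_image continuous_x0 compact_params)
  then obtain M where M: "\<And>\<theta>. \<theta> \<in> \<Theta> \<Longrightarrow> norm (x0 \<theta>) \<le> M" by (auto simp: bounded_iff)
  obtain B where B: "\<And>\<theta>. \<theta> \<in> \<Theta> \<Longrightarrow> norm \<theta> \<le> B"
    using compact_imp_bounded[OF compact_params] by (auto simp: bounded_iff)
  show thesis
  proof (cases "\<Theta> = {}")
    case True
    then show ?thesis using that[of 1] by auto
  next
    case False
    then obtain \<theta>0 where \<theta>0: "\<theta>0 \<in> \<Theta>" by auto
    define S where "S = norm (F0 0 \<theta>0) + (\<Sum>i\<in>UNIV. norm (column i (F 0 \<theta>0)))"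
    define C where "C = L + S + L * (2 * B) + M"
    have "B \<ge> 0" "M \<ge> 0" using B[OF \<theta>0] M[OF \<theta>0] norm_ge_zero order_trans by blast+
    have "S \<ge> 0" by (auto simp: S_def intro!: add_nonneg_nonneg sum_nonneg)
    have "C > 0" using L_pos \<open>B \<ge> 0\<close> \<open>M \<ge> 0\<close> \<open>S \<ge> 0\<close> by (simp add: C_def add_pos_nonneg)
    have *: "norm z \<le> C * (1 + norm x)"
      if "\<theta> \<in> \<Theta>" "norm (z - z0) \<le> L * (norm (x - 0) + norm (\<theta> - \<theta>0))" "norm z0 \<le> S"
      for z z0 :: "real^'n" and x :: "real^'n" and \<theta>
    proof -
      have "norm (\<theta> - \<theta>0) \<le> 2 * B" using norm_triangle_ineq4[of \<theta> \<theta>0] B[OF that(1)] B[OF \<theta>0] by linarith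
      then have "L * (norm x + norm (\<theta> - \<theta>0)) \<le> L * (norm x + 2 * B)" using L_pos by (intro mult_left_mono) auto
      then have "norm z \<le> L * (norm x + 2 * B) + S"
        using that(2,3) norm_triangle_ineq2[of z z0] by simp
      also have "\<dots> \<le> C + C * norm x"
      proof -
        have "L * norm x \<le> C * norm x"
          using L_pos \<open>B \<ge> 0\<close> \<open>M \<ge> 0\<close> \<open>S \<ge> 0\<close> by (intro mult_right_mono) (auto simp: C_def)
        then show ?thesis using L_pos \<open>M \<ge> 0\<close> by (simp add: C_def distrib_left)
      qed
      finally show ?thesis by (simp add: distrib_left)
    qed
    show ?thesis
    proof (rule that[OF \<open>C > 0\<close>])
      fix x \<theta> assume \<theta>: "\<theta> \<in> \<Theta>"
      show "norm (F0 x \<theta>) \<le> C * (1 + norm x)"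
        by (rule *[OF \<theta> F0_Lipschitz[OF \<theta> \<theta>0]]) (simp add: S_def sum_nonneg)
      show "norm (column i (F x \<theta>)) \<le> C * (1 + norm x)" for i
        by (rule *[OF \<theta> F_Lipschitz[OF \<theta> \<theta>0]])
          (use member_le_sum[of i UNIV "\<lambda>i. norm (column i (F 0 \<theta>0))"] in \<open>simp add: S_def add_increasing\<close>)
      show "norm (x0 \<theta>) \<le> C"
        using M[OF \<theta>] L_pos \<open>B \<ge> 0\<close> \<open>S \<ge> 0\<close> by (simp add: C_def add_increasing)
    qed
  qed
qed

lemma rhs_growth:
  obtains C where "C > 0" "\<And>u \<theta> t x. \<theta> \<in> \<Theta> \<Longrightarrow> norm (rhs u \<theta> t x) \<le> C * (1 + norm x) * weight u t"
    "\<And>\<theta>. \<theta> \<in> \<Theta> \<Longrightarrow> norm (x0 \<theta>) \<le> C"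
proof -
  obtain C where C: "C > 0" "\<And>x \<theta>. \<theta> \<in> \<Theta> \<Longrightarrow> norm (F0 x \<theta>) \<le> C * (1 + norm x)"
    "\<And>x \<theta> i. \<theta> \<in> \<Theta> \<Longrightarrow> norm (column i (F x \<theta>)) \<le> C * (1 + norm x)"
    "\<And>\<theta>. \<theta> \<in> \<Theta> \<Longrightarrow> norm (x0 \<theta>) \<le> C"
    using growth by blast
  have "norm (rhs u \<theta> t x) \<le> C * (1 + norm x) * weight u t" if "\<theta> \<in> \<Theta>" for u \<theta> t x
  proof -
    have "norm (rhs u \<theta> t x) \<le> norm (F0 x \<theta>) + norm (F x \<theta> *v rep_L2 u t)"
      unfolding rhs_def by (rule norm_triangle_ineq)
    also have "\<dots> \<le> C * (1 + norm x) + C * (1 + norm x) * (CARD('k) * norm (rep_L2 u t))"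
      by (intro add_mono C(2) norm_matrix_vector_le C(3) that)
    finally show ?thesis by (simp add: weight_def algebra_simps)
  qed
  with C that show thesis by blast
qed

lemma continuous_F0: "\<theta> \<in> \<Theta> \<Longrightarrow> continuous_on S (\<lambda>x. F0 x \<theta>)"
  using F0_Lipschitz[of \<theta> \<theta>] L_pos
  by (intro lipschitz_onI[of _ _ L, THEN lipschitz_on_continuous_on])
    (auto simp: dist_norm)

lemma continuous_F_column: "\<theta> \<in> \<Theta> \<Longrightarrow> continuous_on S (\<lambda>x. column i (F x \<theta>))"
  using F_Lipschitz[of \<theta> \<theta> i] L_pos
  by (intro lipschitz_onI[of _ _ L, THEN lipschitz_on_continuous_on]) (auto simp: dist_norm)

text \<open>The function \<open>w\<close> is arbitrary because both a control and the difference of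
  two controls are inserted later. Measurability comes from the expansion in columns: each is
  continuous in time and is multiplied by a measurable scalar.\<close>

lemma L2_function_F_mult:
  assumes \<theta>: "\<theta> \<in> \<Theta>" and x: "continuous_on {0..1} x" and w: "L2_function w"
  shows "L2_function (\<lambda>t. F (x t) \<theta> *v w t)"
proof -
  obtain C where C: "C > 0" "\<And>x i. norm (column i (F x \<theta>)) \<le> C * (1 + norm x)"
    using growth \<theta> by metis
  have "bounded (x ` {0..1})"
    by (intro compact_imp_bounded compact_continuous_image x compact_Icc)
  then obtain B where B: "\<And>t. t \<in> {0..1} \<Longrightarrow> norm (x t) \<le> B"
    unfolding bounded_iff by (meson imageI)
  have cont: "continuous_on {0..1} (\<lambda>t. column i (F (x t) \<theta>))" for i
    using continuous_on_compose2[OF continuous_F_column[OF \<theta>, of UNIV i] x] by auto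
  have F_meas: "(\<lambda>t. column i (F (x t) \<theta>)) \<in> borel_measurable (lebesgue_on {0..1})" for i
    by (intro continuous_imp_measurable_on_sets_lebesgue cont) auto
  have w_meas: "(\<lambda>t. w t $ i) \<in> borel_measurable (lebesgue_on {0..1})" for i
    by (rule measurable_compose[OF L2_function_measurable[OF w]])
      (intro borel_measurable_continuous_onI continuous_intros)
  have "(\<lambda>t. F (x t) \<theta> *v w t) = (\<lambda>t. \<Sum>i\<in>UNIV. (w t $ i) *\<^sub>R column i (F (x t) \<theta>))"
    by (simp add: matrix_mult_sum scalar_mult_eq_scaleR)
  then have meas: "(\<lambda>t. F (x t) \<theta> *v w t) \<in> borel_measurable (lebesgue_on {0..1})"
    by (simp only:) (intro borel_measurable_sum borel_measurable_scaleR w_meas F_meas)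
  show ?thesis
  proof (rule L2_function_bound[OF L2_function_scaleR[OF L2_function_norm[OF w], of "C * (1 + B) * CARD('k)"] meas])
    fix t :: real assume t: "t \<in> {0..1}"
    have "norm (column i (F (x t) \<theta>)) \<le> C * (1 + B)" for i
      by (rule order_trans[OF C(2)]) (use B[OF t] C(1) in \<open>auto intro!: mult_left_mono\<close>)
    then have "norm (F (x t) \<theta> *v w t) \<le> C * (1 + B) * (CARD('k) * norm (w t))"
      by (rule norm_matrix_vector_le)
    also have "\<dots> \<le> norm ((C * (1 + B) * CARD('k)) *\<^sub>R norm (w t))" by simp
    finally show "norm (F (x t) \<theta> *v w t) \<le> norm ((C * (1 + B) * CARD('k)) *\<^sub>R norm (w t))" .
  qed
qed

lemma L2_Lipschitz_field_rhs:
  assumes \<theta>: "\<theta> \<in> \<Theta>"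
  shows "L2_Lipschitz_field (rhs u \<theta>) (\<lambda>t. L * weight u t)"
  unfolding L2_Lipschitz_field_def
proof (intro conjI ballI allI impI)
  show "L2_function (\<lambda>t. L * weight u t)" using L2_function_scaleR[OF L2_weight, of L] by simp
  show "norm (rhs u \<theta> t x - rhs u \<theta> t y) \<le> L * weight u t * norm (x - y)" for t x y
    using rhs_Lipschitz[OF \<theta> \<theta>, of u t x y] by simp
  fix x :: "real \<Rightarrow> real^'n" assume x: "continuous_on {0..1} x"
  have "continuous_on {0..1} (\<lambda>t. F0 (x t) \<theta>)"
    using continuous_on_compose2[OF continuous_F0[OF \<theta>, of UNIV] x] by auto
  then show "L2_function (\<lambda>t. rhs u \<theta> t (x t))"
    unfolding rhs_def by (intro L2_function_add L2_function_continuous L2_function_F_mult \<theta> x L2_function_rep)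
qed

lemma is_trajectory_iff:
  assumes \<theta>: "\<theta> \<in> \<Theta>"
  shows "is_trajectory F0 F x0 u \<theta> x \<longleftrightarrow> integral_solution (rhs u \<theta>) (x0 \<theta>) x"
proof -
  have "continuous_on {0..1} x \<Longrightarrow> L2_function (\<lambda>t. rhs u \<theta> t (x t))"
    using L2_Lipschitz_field_rhs[OF \<theta>] by (simp add: L2_Lipschitz_field_def)
  from abs_continuous_derivative_iff_integral[OF this, where c = "x0 \<theta>"]
  show ?thesis by (simp add: is_trajectory_def integral_solution_def rhs_def)
qed

text \<open>Here the definite description in \<open>trajectory\<close> is shown to denote. Solutions
  are unique only on the unit interval, so the Picard solution is restricted to obtain the unique
  \<open>extensional\<close> one.\<close>

lemma integral_solution_traj:
  assumes \<theta>: "\<theta> \<in> \<Theta>"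
  shows "integral_solution (rhs u \<theta>) (x0 \<theta>) (traj u \<theta>)"
proof -
  note field = L2_Lipschitz_field_rhs[OF \<theta>, of u]
  obtain x where x: "integral_solution (rhs u \<theta>) (x0 \<theta>) x"
    using integral_solution_exists[OF field] by blast
  have restr: "integral_solution (rhs u \<theta>) (x0 \<theta>) (restrict x {0..1})"
    unfolding integral_solution_def
  proof (intro conjI ballI)
    show "continuous_on {0..1} (restrict x {0..1})"
      using x by (subst continuous_on_cong[of _ "{0..1}" _ x]) (auto simp: integral_solution_def)
    fix t :: real assume t: "t \<in> {0..1}"
    have "integral {0..t} (\<lambda>s. rhs u \<theta> s (restrict x {0..1} s)) = integral {0..t} (\<lambda>s. rhs u \<theta> s (x s))"
      using t by (intro integral_cong) auto
    then show "restrict x {0..1} t = x0 \<theta> + integral {0..t} (\<lambda>s. rhs u \<theta> s (restrict x {0..1} s))"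
      using x t by (simp add: integral_solution_def)
  qed
  have "\<exists>!x. x \<in> extensional {0..1} \<and> is_trajectory F0 F x0 u \<theta> x"
  proof (rule ex1I[of _ "restrict x {0..1}"])
    show "restrict x {0..1} \<in> extensional {0..1} \<and> is_trajectory F0 F x0 u \<theta> (restrict x {0..1})"
      using restr by (simp add: is_trajectory_iff[OF \<theta>])
    fix y assume y: "y \<in> extensional {0..1} \<and> is_trajectory F0 F x0 u \<theta> y"
    then show "y = restrict x {0..1}"
      using integral_solution_unique[OF field _ restr, of y]
      by (intro extensionalityI[of _ "{0..1}"]) (auto simp: is_trajectory_iff[OF \<theta>])
  qed
  from theI'[OF this] show ?thesis unfolding trajectory_def by (simp add: is_trajectory_iff[OF \<theta>])
qed

end

section \<open>Stability of trajectories\<close>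

lemma norm_L2_diff_sq:
  "integral {0..1} (\<lambda>t. (norm (rep_L2 u t - rep_L2 v t))\<^sup>2) = (norm (u - v))\<^sup>2"
proof -
  let ?w = "\<lambda>t. rep_L2 u t - rep_L2 v t"
  have w: "L2_function ?w" by (intro L2_function_diff L2_function_rep)
  have "u - v = abs_L2 ?w" using abs_L2_diff[OF L2_function_rep L2_function_rep, of u v] by simp
  then have "(norm (u - v))\<^sup>2 = (LINT t|lebesgue_on {0..1}. (norm (?w t))\<^sup>2)" using norm_abs_L2[OF w] by simp
  also have "\<dots> = integral {0..1} (\<lambda>t. (norm (?w t))\<^sup>2)"
    by (intro lebesgue_integral_eq_integral L2_function_sq_integrable w) auto
  finally show ?thesis ..
qed

section \<open>Primitives of controls and convex cells\<close>

definition primitive :: "real \<Rightarrow> 'a::euclidean_space L2 \<Rightarrow> 'a" where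
  "primitive t u = integral {0..t} (rep_L2 u)"

lemma linear_primitive:
  assumes "t \<in> {0..1}"
  shows "linear (primitive t)"
proof
  have sub: "{0..t} \<subseteq> {0..1}" using assms by auto
  note int = L2_function_integrable_on(1)[OF L2_function_rep sub]
  fix u v :: "'a L2" and c :: real
  have "u + v = abs_L2 (\<lambda>t. rep_L2 u t + rep_L2 v t)"
    using plus_L2.abs_eq[OF L2_eq_refl L2_eq_refl, OF L2_function_rep L2_function_rep, of u v] by simp
  \<comment> \<open>Representatives are additive only almost everywhere; the integral does not see
    the difference.\<close>
  then have "L2_eq (rep_L2 (u + v)) (\<lambda>t. rep_L2 u t + rep_L2 v t)"
    using rep_abs_L2[OF L2_function_add[OF L2_function_rep[of u] L2_function_rep[of v]]] by simp
  then show "primitive t (u + v) = primitive t u + primitive t v"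
    unfolding primitive_def
    by (simp add: L2_eq_cong_integral[OF _ sub] Henstock_Kurzweil_Integration.integral_add int)
  have "c *\<^sub>R u = abs_L2 (\<lambda>t. c *\<^sub>R rep_L2 u t)"
    using scaleR_L2.abs_eq[OF L2_eq_refl, OF L2_function_rep, of c u] by simp
  then have "L2_eq (rep_L2 (c *\<^sub>R u)) (\<lambda>t. c *\<^sub>R rep_L2 u t)"
    using rep_abs_L2[OF L2_function_scaleR[OF L2_function_rep[of u], of c]] by simp
  then show "primitive t (c *\<^sub>R u) = c *\<^sub>R primitive t u"
    unfolding primitive_def by (simp add: L2_eq_cong_integral[OF _ sub])
qed

text \<open>Used twice: it keeps the grid values in a compact ball of a Euclidean space, and it
  makes closeness in norm a special case of closeness of primitives.\<close>

lemma norm_primitive_le: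
  assumes "t \<in> {0..1}"
  shows "norm (primitive t u) \<le> norm u"
proof -
  have "norm (primitive t u) \<le> sqrt (t - 0) * sqrt ((norm u)\<^sup>2)"
    unfolding primitive_def norm_L2_sq using assms by (intro norm_integral_le_sqrt) auto
  also have "\<dots> \<le> 1 * norm u" using assms by (intro mult_mono) auto
  finally show ?thesis by simp
qed

lemma integral_rep_diff:
  assumes "t \<in> {0..1}"
  shows "integral {0..t} (\<lambda>s. rep_L2 u s - rep_L2 v s) = primitive t u - primitive t v"
  unfolding primitive_def
  using assms by (intro Henstock_Kurzweil_Integration.integral_diff L2_function_integrable_on L2_function_rep) auto

text \<open>A cell prescribes the finitely many vectors \<open>primitive (j / M) u\<close> up to
  \<open>\<delta> / 2\<close>, with centres from a finite net of a compact Euclidean ball; so there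
  are finitely many cells. Each is convex, being the intersection of the ball of controls with
  preimages of balls under linear maps.\<close>

lemma primitive_grid_cells:
  fixes \<rho> \<delta> :: real
  assumes "\<delta> > 0"
  obtains \<C> :: "'a::euclidean_space L2 set set" where "finite \<C>" "cball 0 \<rho> \<subseteq> \<Union>\<C>"
    "\<And>C. C \<in> \<C> \<Longrightarrow> convex C" "\<And>C. C \<in> \<C> \<Longrightarrow> C \<subseteq> cball 0 \<rho>"
    "\<And>C u v j. C \<in> \<C> \<Longrightarrow> u \<in> C \<Longrightarrow> v \<in> C \<Longrightarrow> j \<le> M \<Longrightarrow>
       norm (primitive (real j / real M) u - primitive (real j / real M) v) \<le> \<delta>"
proof -
  have "compact (cball (0::'a) \<rho>)" by simp
  then obtain D :: "'a set" where D: "finite D" "cball 0 \<rho> \<subseteq> (\<Union>x\<in>D. ball x (\<delta> / 2))"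
    unfolding compact_eq_totally_bounded using assms half_gt_zero by blast
  let ?p = "\<lambda>j::nat. primitive (real j / real M)"
  \<comment> \<open>Division by zero yields 0, so \<open>M = 0\<close> leaves the single grid point
    0.\<close>
  have t: "real j / real M \<in> {0..1}" if "j \<le> M" for j
    using that by (cases "M = 0") (auto simp: field_simps)
  define cell where "cell = (\<lambda>c. {u \<in> cball (0::'a L2) \<rho>. \<forall>j\<le>M. norm (?p j u - c j) \<le> \<delta> / 2})"
  show thesis
  proof (rule that[of "cell ` (PiE {..M} (\<lambda>_. D))"])
    show "finite (cell ` (PiE {..M} (\<lambda>_. D)))" using D by (intro finite_imageI finite_PiE) auto
    show "cball 0 \<rho> \<subseteq> \<Union> (cell ` (PiE {..M} (\<lambda>_. D)))"
    proof
      fix u :: "'a L2" assume u: "u \<in> cball 0 \<rho>"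
      have "\<exists>d\<in>D. norm (?p j u - d) \<le> \<delta> / 2" if "j \<le> M" for j
      proof -
        have "?p j u \<in> cball 0 \<rho>" using norm_primitive_le[OF t[OF that], of u] u by simp
        then obtain d where "d \<in> D" "?p j u \<in> ball d (\<delta> / 2)" using D by blast
        then show ?thesis by (intro bexI[of _ d]) (auto simp: dist_norm norm_minus_commute)
      qed
      then obtain c where c: "\<And>j. j \<le> M \<Longrightarrow> c j \<in> D \<and> norm (?p j u - c j) \<le> \<delta> / 2" by metis
      have "restrict c {..M} \<in> PiE {..M} (\<lambda>_. D)" using c by auto
      moreover have "u \<in> cell (restrict c {..M})" using c u by (auto simp: cell_def)
      ultimately show "u \<in> \<Union> (cell ` (PiE {..M} (\<lambda>_. D)))" by blast
    qed
    fix C assume "C \<in> cell ` (PiE {..M} (\<lambda>_. D))"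
    then obtain c where C: "C = cell c" by blast
    have "C = cball 0 \<rho> \<inter> (\<Inter>j\<in>{..M}. ?p j -` cball (c j) (\<delta> / 2))"
      unfolding C cell_def by (auto simp: dist_norm norm_minus_commute)
    then show "convex C"
      using t by (auto intro!: convex_Int convex_INT convex_linear_vimage linear_primitive)
    show "C \<subseteq> cball 0 \<rho>" unfolding C cell_def by blast
    fix u v j assume "u \<in> C" "v \<in> C" "j \<le> M"
    then have "norm (?p j u - c j) \<le> \<delta> / 2" "norm (?p j v - c j) \<le> \<delta> / 2" unfolding C cell_def by auto
    then show "norm (?p j u - ?p j v) \<le> \<delta>"
      using norm_triangle_ineq4[of "?p j u - c j" "?p j v - c j"] by simp
  qed
qed

section \<open>Estimates uniform on a ball of controls\<close>

context controlled_system
begin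

definition weight_bound :: "real \<Rightarrow> real" where
  "weight_bound \<rho> = sqrt (2 + 2 * (real CARD('k))\<^sup>2 * \<rho>\<^sup>2)"

lemma weight_bound_nonneg: "weight_bound \<rho> \<ge> 0"
  by (simp add: weight_bound_def)

lemma integral_weight_le_bound:
  assumes "norm u \<le> \<rho>" "0 \<le> s" "s \<le> t" "t \<le> 1"
  shows "integral {s..t} (weight u) \<le> sqrt (t - s) * weight_bound \<rho>"
  using integral_weight_le[OF assms] by (simp add: weight_bound_def)

lemma integral_weight_le_bound_initial:
  assumes "norm u \<le> \<rho>" "t \<in> {0..1}"
  shows "integral {0..t} (weight u) \<le> weight_bound \<rho>"
proof -
  have "integral {0..t} (weight u) \<le> sqrt (t - 0) * weight_bound \<rho>"
    using assms by (intro integral_weight_le_bound) auto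
  also have "\<dots> \<le> 1 * weight_bound \<rho>" using assms by (intro mult_right_mono weight_bound_nonneg) auto
  finally show ?thesis by simp
qed

text \<open>The factor from \<open>L2_Gronwall\<close> for the kernel \<open>L * weight u\<close>,
  bounded uniformly over the controls of norm at most \<open>\<rho>\<close>.\<close>

definition stability_const :: "real \<Rightarrow> real" where
  "stability_const \<rho> = 2 * exp (L\<^sup>2 * (weight_bound \<rho>)\<^sup>2)"

lemma stability_const_pos: "stability_const \<rho> > 0"
  by (simp add: stability_const_def)

lemma traj_stability:
  assumes u: "norm u \<le> \<rho>" and \<theta>: "\<theta> \<in> \<Theta>" and y: "integral_solution g d y"
    and g: "L2_function (\<lambda>s. g s (y s))" and "A \<ge> 0"
    and A: "\<And>t. t \<in> {0..1} \<Longrightarrow> norm (x0 \<theta> - d + integral {0..t} (\<lambda>s. rhs u \<theta> s (y s) - g s (y s))) \<le> A"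
    and t: "t \<in> {0..1}"
  shows "norm (traj u \<theta> t - y t) \<le> stability_const \<rho> * A"
proof -
  have "integral {0..1} (\<lambda>s. (L * weight u s)\<^sup>2) = L\<^sup>2 * integral {0..1} (\<lambda>s. (weight u s)\<^sup>2)"
    by (simp add: power_mult_distrib)
  also have "\<dots> \<le> L\<^sup>2 * (weight_bound \<rho>)\<^sup>2"
    using integral_weight_sq_le[OF u] by (intro mult_left_mono) (auto simp: weight_bound_def)
  finally have "2 * A * exp (integral {0..1} (\<lambda>s. (L * weight u s)\<^sup>2)) \<le> stability_const \<rho> * A"
    using \<open>A \<ge> 0\<close> by (simp add: stability_const_def mult_left_mono mult.assoc mult.commute)
  then show ?thesis
    using integral_solution_stability[OF L2_Lipschitz_field_rhs[OF \<theta>] integral_solution_traj[OF \<theta>] y g \<open>A \<ge> 0\<close> A t]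
    by linarith
qed

lemma L2_function_rhs:
  assumes "\<theta> \<in> \<Theta>" "continuous_on {0..1} x"
  shows "L2_function (\<lambda>s. rhs u \<theta> s (x s))"
  using L2_Lipschitz_field_rhs[OF assms(1), of u] assms(2) by (simp add: L2_Lipschitz_field_def)

lemma continuous_traj:
  assumes "\<theta> \<in> \<Theta>"
  shows "continuous_on {0..1} (traj u \<theta>)"
  using integral_solution_traj[OF assms] by (simp add: integral_solution_def)

text \<open>Comparison with the zero curve, which solves the equation with zero field and zero
  initial value: its defect is the initial value plus the integral of the field at state 0, which is
  at most \<open>A\<close>.\<close>

lemma traj_bounded:
  obtains R where "R > 0" "\<And>u \<theta> t. norm u \<le> \<rho> \<Longrightarrow> \<theta> \<in> \<Theta> \<Longrightarrow> t \<in> {0..1} \<Longrightarrow> norm (traj u \<theta> t) \<le> R"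
proof -
  obtain C where C: "C > 0" "\<And>u \<theta> t x. \<theta> \<in> \<Theta> \<Longrightarrow> norm (rhs u \<theta> t x) \<le> C * (1 + norm x) * weight u t"
    "\<And>\<theta>. \<theta> \<in> \<Theta> \<Longrightarrow> norm (x0 \<theta>) \<le> C"
    by (rule rhs_growth) blast
  define A where "A = C + C * weight_bound \<rho>"
  have "A > 0" using C(1) weight_bound_nonneg[of \<rho>] by (simp add: A_def add_pos_nonneg)
  show thesis
  proof (rule that[of "stability_const \<rho> * A"])
    show "stability_const \<rho> * A > 0" using \<open>A > 0\<close> stability_const_pos by simp
    fix u :: "(real^'k) L2" and \<theta> and t :: real assume u: "norm u \<le> \<rho>" and \<theta>: "\<theta> \<in> \<Theta>" and t: "t \<in> {0..1}"
    have "norm (traj u \<theta> t - 0) \<le> stability_const \<rho> * A"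
    proof (rule traj_stability[OF u \<theta> _ _ _ _ t])
      show "integral_solution (\<lambda>_ _. 0) 0 (\<lambda>_. 0 :: real^'n)" by (simp add: integral_solution_def)
      fix t :: real assume t: "t \<in> {0..1}"
      have sub: "{0..t} \<subseteq> {0..1}" using t by auto
      have "norm (integral {0..t} (\<lambda>s. rhs u \<theta> s 0)) \<le> integral {0..t} (\<lambda>s. C * weight u s)"
        using C(2)[OF \<theta>, of u _ 0]
        by (intro integral_norm_bound_integral integrable_on_mult_right L2_function_integrable_on[OF _ sub] L2_weight
            L2_function_rhs \<theta>) auto
      also have "\<dots> \<le> C * weight_bound \<rho>"
        using integral_weight_le_bound_initial[OF u t] C(1) by simp
      finally show "norm (x0 \<theta> - 0 + integral {0..t} (\<lambda>s. rhs u \<theta> s 0 - 0)) \<le> A"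
        using C(3)[OF \<theta>] norm_triangle_ineq[of "x0 \<theta>" "integral {0..t} (\<lambda>s. rhs u \<theta> s 0)"]
        by (simp add: A_def)
    qed (use \<open>A > 0\<close> L2_function_zero in auto)
    then show "norm (traj u \<theta> t) \<le> stability_const \<rho> * A" by simp
  qed
qed

text \<open>A square-integrable bound on the speed gives the exponent 1/2, uniformly in control and
  parameter. It limits how much \<open>F\<close> along a trajectory can vary on a grid
  interval.\<close>

lemma traj_Hoelder:
  obtains H where "H > 0" "\<And>u \<theta> s t. norm u \<le> \<rho> \<Longrightarrow> \<theta> \<in> \<Theta> \<Longrightarrow> 0 \<le> s \<Longrightarrow> s \<le> t \<Longrightarrow> t \<le> 1 \<Longrightarrow>
      norm (traj u \<theta> t - traj u \<theta> s) \<le> H * sqrt (t - s)"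
proof -
  obtain C where C: "C > 0" "\<And>u \<theta> t x. \<theta> \<in> \<Theta> \<Longrightarrow> norm (rhs u \<theta> t x) \<le> C * (1 + norm x) * weight u t"
    "\<And>\<theta>. \<theta> \<in> \<Theta> \<Longrightarrow> norm (x0 \<theta>) \<le> C"
    by (rule rhs_growth) blast
  obtain R where R: "R > 0" "\<And>u \<theta> t. norm u \<le> \<rho> \<Longrightarrow> \<theta> \<in> \<Theta> \<Longrightarrow> t \<in> {0..1} \<Longrightarrow> norm (traj u \<theta> t) \<le> R"
    by (rule traj_bounded) blast
  define H where "H = C * (1 + R) * (weight_bound \<rho> + 1)"
  have "H > 0" using C(1) R(1) weight_bound_nonneg[of \<rho>] by (simp add: H_def add_nonneg_pos)
  moreover have "norm (traj u \<theta> t - traj u \<theta> s) \<le> H * sqrt (t - s)"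
    if u: "norm u \<le> \<rho>" and \<theta>: "\<theta> \<in> \<Theta>" and st: "0 \<le> s" "s \<le> t" "t \<le> 1" for u \<theta> s t
  proof -
    let ?f = "\<lambda>r. rhs u \<theta> r (traj u \<theta> r)"
    have f: "L2_function ?f" by (intro L2_function_rhs continuous_traj \<theta>)
    have sub: "{s..t} \<subseteq> {0..1}" using st by auto
    have "integral {0..s} ?f + integral {s..t} ?f = integral {0..t} ?f"
      using st by (intro Henstock_Kurzweil_Integration.integral_combine L2_function_integrable_on f) auto
    then have "traj u \<theta> t - traj u \<theta> s = integral {s..t} ?f"
      using integral_solution_traj[OF \<theta>, of u] st by (auto simp: integral_solution_def algebra_simps)
    also have "norm \<dots> \<le> integral {s..t} (\<lambda>r. C * (1 + R) * weight u r)"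
    proof (intro integral_norm_bound_integral integrable_on_mult_right L2_function_integrable_on f L2_weight sub)
      fix r assume "r \<in> {s..t}"
      then have "norm (traj u \<theta> r) \<le> R" using R(2)[OF u \<theta>] sub by auto
      then have "C * (1 + norm (traj u \<theta> r)) * weight u r \<le> C * (1 + R) * weight u r"
        using C(1) weight_ge_1[of u r] by (intro mult_right_mono mult_left_mono) auto
      then show "norm (?f r) \<le> C * (1 + R) * weight u r" using C(2)[OF \<theta>, of u r "traj u \<theta> r"] by linarith
    qed
    also have "\<dots> \<le> C * (1 + R) * (sqrt (t - s) * weight_bound \<rho>)"
      using integral_weight_le_bound[OF u st] C(1) R(1) by simp
    also have "\<dots> \<le> H * sqrt (t - s)"
      using C(1) R(1) st by (simp add: H_def algebra_simps)
    finally show ?thesis .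
  qed
  ultimately show thesis by (rule that)
qed

text \<open>Along the fixed curve \<open>traj v \<theta>\<close> the drift \<open>F0\<close> cancels
  in the difference of the two fields. What remains is \<open>F (traj v \<theta> s) \<theta>\<close>
  applied to the difference of the controls, the situation of
  \<open>integral_grid_bound\<close>.\<close>

lemma traj_control_stability:
  assumes "\<eta> > 0" and "\<rho> \<ge> 0"
  obtains M \<delta> where "\<delta> > 0" "\<And>u v \<theta> t. norm u \<le> \<rho> \<Longrightarrow> norm v \<le> \<rho> \<Longrightarrow>
    (\<And>j. j \<le> M \<Longrightarrow> norm (primitive (real j / real M) u - primitive (real j / real M) v) \<le> \<delta>) \<Longrightarrow>
    \<theta> \<in> \<Theta> \<Longrightarrow> t \<in> {0..1} \<Longrightarrow> norm (traj u \<theta> t - traj v \<theta> t) \<le> \<eta>"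
proof -
  obtain C where C: "C > 0" "\<And>x \<theta>. \<theta> \<in> \<Theta> \<Longrightarrow> norm (F0 x \<theta>) \<le> C * (1 + norm x)"
    "\<And>x \<theta> i. \<theta> \<in> \<Theta> \<Longrightarrow> norm (column i (F x \<theta>)) \<le> C * (1 + norm x)"
    "\<And>\<theta>. \<theta> \<in> \<Theta> \<Longrightarrow> norm (x0 \<theta>) \<le> C"
    by (rule growth) blast
  obtain R where R: "R > 0" "\<And>u \<theta> t. norm u \<le> \<rho> \<Longrightarrow> \<theta> \<in> \<Theta> \<Longrightarrow> t \<in> {0..1} \<Longrightarrow> norm (traj u \<theta> t) \<le> R"
    by (rule traj_bounded) blast
  obtain H where H: "H > 0" "\<And>u \<theta> s t. norm u \<le> \<rho> \<Longrightarrow> \<theta> \<in> \<Theta> \<Longrightarrow> 0 \<le> s \<Longrightarrow> s \<le> t \<Longrightarrow> t \<le> 1 \<Longrightarrow>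
      norm (traj u \<theta> t - traj u \<theta> s) \<le> H * sqrt (t - s)"
    by (rule traj_Hoelder) blast
  define D where "D = C * (1 + R) * CARD('k)"
  \<comment> \<open>\<open>P / sqrt M\<close> collects the oscillation and remainder terms of
    \<open>integral_grid_bound\<close> for \<open>n = 2 * \<rho>\<close>. First \<open>M\<close> is
    chosen to make them at most \<open>\<eta> / 2\<close> after multiplication by \<open>S\<close>;
    only then \<open>\<delta>\<close>, since the grid term carries the factor
    \<open>M\<close>.\<close>
  define P where "P = 2 * \<rho> * (L * H * CARD('k) + D)"
  have "D > 0" using C(1) R(1) by (simp add: D_def)
  have "P \<ge> 0" using \<open>D > 0\<close> \<open>\<rho> \<ge> 0\<close> L_pos H(1) by (simp add: P_def)
  define S where "S = stability_const \<rho>"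
  have "S > 0" by (simp add: S_def stability_const_pos)
  define M where "M = nat \<lceil>(2 * S * P / \<eta>)\<^sup>2\<rceil> + 1"
  have "M \<ge> 1" by (simp add: M_def)
  then have M: "M \<ge> 1" "real M > 0" by simp_all
  have "(2 * S * P / \<eta>)\<^sup>2 \<le> real M" unfolding M_def by linarith
  then have "2 * S * P / \<eta> \<le> sqrt M" by (rule real_le_rsqrt)
  then have bound1: "S * (P / sqrt M) \<le> \<eta> / 2"
    using \<open>\<eta> > 0\<close> M(2) by (simp add: field_simps)
  define \<delta> where "\<delta> = \<eta> / (4 * S * M * D)"
  have "\<delta> > 0" using \<open>\<eta> > 0\<close> \<open>S > 0\<close> \<open>D > 0\<close> M(2) by (simp add: \<delta>_def)
  have bound2: "S * (2 * real M * D * \<delta>) = \<eta> / 2"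
    using \<open>S > 0\<close> \<open>D > 0\<close> M(2) by (simp add: \<delta>_def field_simps)
  show thesis
  proof (rule that[OF \<open>\<delta> > 0\<close>, of M])
    fix u v :: "(real^'k) L2" and \<theta> and t :: real
    assume u: "norm u \<le> \<rho>" and v: "norm v \<le> \<rho>" and \<theta>: "\<theta> \<in> \<Theta>" and t: "t \<in> {0..1}"
      and close: "\<And>j. j \<le> M \<Longrightarrow> norm (primitive (real j / real M) u - primitive (real j / real M) v) \<le> \<delta>"
    let ?y = "traj v \<theta>"
    let ?w = "\<lambda>s. rep_L2 u s - rep_L2 v s"
    have y: "continuous_on {0..1} ?y" by (rule continuous_traj[OF \<theta>])
    have w: "L2_function ?w" by (intro L2_function_diff L2_function_rep)
    define A where "A = L * H / sqrt M * CARD('k) * (2 * \<rho>) + 2 * real M * D * \<delta> + D * (2 * \<rho>) / sqrt M"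
    have A: "A = P / sqrt M + 2 * real M * D * \<delta>"
      by (simp add: A_def P_def add_divide_distrib algebra_simps)
    have "norm (traj u \<theta> t - ?y t) \<le> S * A"
      unfolding S_def
    proof (rule traj_stability[OF u \<theta> integral_solution_traj[OF \<theta>] _ _ _ t])
      show "L2_function (\<lambda>s. rhs v \<theta> s (?y s))" by (intro L2_function_rhs \<theta> y)
      show "A \<ge> 0" using \<open>P \<ge> 0\<close> \<open>D > 0\<close> \<open>\<delta> > 0\<close> by (simp add: A)
      fix t :: real assume t: "t \<in> {0..1}"
      have "norm (integral {0..t} (\<lambda>s. F (?y s) \<theta> *v ?w s)) \<le> A"
        unfolding A_def
      proof (rule integral_grid_bound[where B = "\<lambda>s z. F (?y s) \<theta> *v z", OF w _ M(1) _ _ _ _ _ _ _ t])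
        show "L2_function (\<lambda>s. F (?y s) \<theta> *v ?w s)" by (intro L2_function_F_mult \<theta> y w)
        show "bounded_linear (\<lambda>v. F (?y s) \<theta> *v v)" for s by (rule matrix_vector_mul_bounded_linear)
        show "norm (F (?y s) \<theta> *v z - F (?y r) \<theta> *v z) \<le> L * H / sqrt M * CARD('k) * norm z"
          if r: "0 \<le> r" "r \<le> s" "s \<le> 1" "s - r \<le> 1 / M" for r s z
        proof -
          have "norm (?y s - ?y r) \<le> H * sqrt (s - r)" by (rule H(2)[OF v \<theta> r(1-3)])
          also have "\<dots> \<le> H * sqrt (1 / M)" using H(1) r by (intro mult_left_mono real_sqrt_le_mono) auto
          finally have "L * norm (?y s - ?y r) * (CARD('k) * norm z) \<le> L * (H / sqrt M) * (CARD('k) * norm z)"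
            using L_pos by (intro mult_right_mono mult_left_mono) (auto simp: real_sqrt_divide)
          then show ?thesis using F_mult_Lipschitz[OF \<theta> \<theta>, of "?y s" z "?y r"] by (simp add: mult_ac)
        qed
        show "norm (F (?y s) \<theta> *v z) \<le> D * norm z" if s: "s \<in> {0..1}" for s z
        proof -
          have "norm (column i (F (?y s) \<theta>)) \<le> C * (1 + R)" for i
            by (rule order_trans[OF C(3)[OF \<theta>]]) (use R(2)[OF v \<theta> s] C(1) in \<open>auto intro!: mult_left_mono\<close>)
          from norm_matrix_vector_le[of _ "C * (1 + R)", OF this] show ?thesis by (simp add: D_def mult.assoc)
        qed
        show "norm (integral {0..real j / real M} ?w) \<le> \<delta>" if "j \<le> M" for j
          using close[OF that] that M by (subst integral_rep_diff) (auto simp: field_simps)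
        show "sqrt (integral {0..1} (\<lambda>s. (norm (?w s))\<^sup>2)) \<le> 2 * \<rho>"
          using norm_triangle_ineq4[of u v] u v by (simp add: norm_L2_diff_sq)
      qed (use \<open>D > 0\<close> L_pos H(1) in auto)
      moreover have "(\<lambda>s. rhs u \<theta> s (?y s) - rhs v \<theta> s (?y s)) = (\<lambda>s. F (?y s) \<theta> *v ?w s)"
        by (simp add: rhs_def matrix_vector_mult_diff_distrib)
      ultimately show "norm (x0 \<theta> - x0 \<theta> + integral {0..t} (\<lambda>s. rhs u \<theta> s (?y s) - rhs v \<theta> s (?y s))) \<le> A"
        by simp
    qed
    also have "S * A = S * (P / sqrt M) + S * (2 * real M * D * \<delta>)" by (simp only: A distrib_left)
    also have "\<dots> \<le> \<eta>" using bound1 bound2 by linarith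
    finally show "norm (traj u \<theta> t - ?y t) \<le> \<eta>" .
  qed
qed

text \<open>Both trajectories have the same control, so the Lipschitz dependence of the fields on
  the parameter can be integrated with the norm inside.\<close>

lemma traj_param_stability:
  assumes u: "norm u \<le> \<rho>" and \<theta>: "\<theta>1 \<in> \<Theta>" "\<theta>2 \<in> \<Theta>" and t: "t \<in> {0..1}"
  shows "norm (traj u \<theta>1 t - traj u \<theta>2 t) \<le>
    stability_const \<rho> * (norm (x0 \<theta>1 - x0 \<theta>2) + L * weight_bound \<rho> * norm (\<theta>1 - \<theta>2))"
proof (rule traj_stability[OF u \<theta>(1) integral_solution_traj[OF \<theta>(2)] _ _ _ t])
  let ?y = "traj u \<theta>2"
  have y: "continuous_on {0..1} ?y" by (rule continuous_traj[OF \<theta>(2)])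
  show "L2_function (\<lambda>s. rhs u \<theta>2 s (?y s))" by (intro L2_function_rhs \<theta> y)
  show "norm (x0 \<theta>1 - x0 \<theta>2) + L * weight_bound \<rho> * norm (\<theta>1 - \<theta>2) \<ge> 0"
    using L_pos weight_bound_nonneg by simp
  fix t :: real assume t: "t \<in> {0..1}"
  have sub: "{0..t} \<subseteq> {0..1}" using t by auto
  have "norm (integral {0..t} (\<lambda>s. rhs u \<theta>1 s (?y s) - rhs u \<theta>2 s (?y s))) \<le>
      integral {0..t} (\<lambda>s. L * norm (\<theta>1 - \<theta>2) * weight u s)"
  proof (intro integral_norm_bound_integral Henstock_Kurzweil_Integration.integrable_diff integrable_on_mult_right
      L2_function_integrable_on[OF _ sub] L2_weight L2_function_rhs \<theta> y)
    show "norm (rhs u \<theta>1 s (?y s) - rhs u \<theta>2 s (?y s)) \<le> L * norm (\<theta>1 - \<theta>2) * weight u s" for s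
      using rhs_Lipschitz[OF \<theta>, of u s "?y s" "?y s"] by (simp add: mult_ac)
  qed
  also have "\<dots> \<le> L * norm (\<theta>1 - \<theta>2) * weight_bound \<rho>"
    using mult_left_mono[OF integral_weight_le_bound_initial[OF u t], of "L * norm (\<theta>1 - \<theta>2)"] L_pos by simp
  finally show "norm (x0 \<theta>1 - x0 \<theta>2 + integral {0..t} (\<lambda>s. rhs u \<theta>1 s (?y s) - rhs u \<theta>2 s (?y s))) \<le>
      norm (x0 \<theta>1 - x0 \<theta>2) + L * weight_bound \<rho> * norm (\<theta>1 - \<theta>2)"
    by (intro norm_triangle_le) (simp add: mult_ac)
qed

end

section \<open>Minimizers of quadratically perturbed functionals\<close>

lemma cINF_le_add:
  fixes f h :: "'a \<Rightarrow> real"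
  assumes "X \<noteq> {}" "bdd_below (f ` X)" "\<And>u. u \<in> X \<Longrightarrow> f u \<le> h u + \<eta>"
  shows "(INF u\<in>X. f u) \<le> (INF u\<in>X. h u) + \<eta>"
proof -
  have "(INF u\<in>X. f u) - \<eta> \<le> (INF u\<in>X. h u)"
  proof (rule cINF_greatest[OF assms(1)])
    fix u assume u: "u \<in> X"
    show "(INF u\<in>X. f u) - \<eta> \<le> h u" using cINF_lower[OF assms(2) u] assms(3)[OF u] by linarith
  qed
  then show ?thesis by simp
qed

text \<open>A three-term estimate with one representative per nonempty cell; it needs the
  oscillation of all \<open>GN N\<close> on a cell to be small simultaneously. The restriction
  \<open>N \<ge> 1\<close> reflects that the discrete measures are probabilities only from index 1
  on.\<close>

lemma uniform_limit_on_finite_cover: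
  fixes G :: "'a \<Rightarrow> real" and GN :: "nat \<Rightarrow> 'a \<Rightarrow> real"
  assumes lim: "\<And>u. u \<in> X \<Longrightarrow> (\<lambda>N. GN N u) \<longlonglongrightarrow> G u"
    and cover: "\<And>\<eta>. \<eta> > 0 \<Longrightarrow> \<exists>\<C>. finite \<C> \<and> X = \<Union>\<C> \<and> (\<forall>C\<in>\<C>. \<forall>u\<in>C. \<forall>v\<in>C.
      \<bar>G u - G v\<bar> \<le> \<eta> \<and> (\<forall>N\<ge>1. \<bar>GN N u - GN N v\<bar> \<le> \<eta>))"
    and "\<eta> > 0"
  obtains N0 where "N0 \<ge> 1" "\<And>N u. N \<ge> N0 \<Longrightarrow> u \<in> X \<Longrightarrow> \<bar>GN N u - G u\<bar> \<le> \<eta>"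
proof -
  obtain \<C> where \<C>: "finite \<C>" "X = \<Union>\<C>"
    and osc: "\<And>C u v. C \<in> \<C> \<Longrightarrow> u \<in> C \<Longrightarrow> v \<in> C \<Longrightarrow> \<bar>G u - G v\<bar> \<le> \<eta> / 3"
      "\<And>C u v N. C \<in> \<C> \<Longrightarrow> u \<in> C \<Longrightarrow> v \<in> C \<Longrightarrow> N \<ge> 1 \<Longrightarrow> \<bar>GN N u - GN N v\<bar> \<le> \<eta> / 3"
    using cover[of "\<eta> / 3"] \<open>\<eta> > 0\<close> by (metis divide_pos_pos zero_less_numeral)
  have "\<exists>p. \<forall>C\<in>\<C>. C \<noteq> {} \<longrightarrow> p C \<in> C" by (intro exI[of _ "\<lambda>C. SOME x. x \<in> C"]) (auto intro: someI)
  then obtain p where p: "\<And>C. C \<in> \<C> \<Longrightarrow> C \<noteq> {} \<Longrightarrow> p C \<in> C" by blast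
  have "\<forall>\<^sub>F N in sequentially. \<forall>C\<in>\<C>. C \<noteq> {} \<longrightarrow> \<bar>GN N (p C) - G (p C)\<bar> \<le> \<eta> / 3"
  proof (intro eventually_ball_finite \<C>(1) ballI)
    fix C assume C: "C \<in> \<C>"
    show "\<forall>\<^sub>F N in sequentially. C \<noteq> {} \<longrightarrow> \<bar>GN N (p C) - G (p C)\<bar> \<le> \<eta> / 3"
    proof (cases "C = {}")
      case False
      then have "p C \<in> X" using p[OF C] \<C>(2) C by blast
      then have "\<forall>\<^sub>F N in sequentially. dist (GN N (p C)) (G (p C)) < \<eta> / 3"
        using tendstoD[OF lim, of "p C" "\<eta> / 3"] \<open>\<eta> > 0\<close> by simp
      then show ?thesis by eventually_elim (simp add: dist_real_def)
    qed simp
  qed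
  then obtain N1 where N1: "\<And>N C. N \<ge> N1 \<Longrightarrow> C \<in> \<C> \<Longrightarrow> C \<noteq> {} \<Longrightarrow> \<bar>GN N (p C) - G (p C)\<bar> \<le> \<eta> / 3"
    unfolding eventually_sequentially by blast
  show thesis
  proof (rule that[of "max 1 N1"])
    fix N u assume N: "N \<ge> max 1 N1" and "u \<in> X"
    then obtain C where C: "C \<in> \<C>" "u \<in> C" using \<C>(2) by blast
    then have pC: "p C \<in> C" "C \<noteq> {}" using p by auto
    show "\<bar>GN N u - G u\<bar> \<le> \<eta>"
      using osc(1)[OF C pC(1)] osc(2)[OF C pC(1), of N] N1[of N, OF _ C(1) pC(2)] N by linarith
  qed simp
qed

lemma INF_tendsto_uniform:
  fixes f :: "'a \<Rightarrow> real" and fN :: "nat \<Rightarrow> 'a \<Rightarrow> real"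
  assumes "X \<noteq> {}" and bdd: "bdd_below (f ` X)" "\<And>N. bdd_below (fN N ` X)"
    and unif: "\<And>\<eta>. \<eta> > 0 \<Longrightarrow> \<exists>N0. \<forall>N\<ge>N0. \<forall>u\<in>X. \<bar>fN N u - f u\<bar> \<le> \<eta>"
  shows "(\<lambda>N. INF u\<in>X. fN N u) \<longlonglongrightarrow> (INF u\<in>X. f u)"
proof (rule LIMSEQ_I)
  fix e :: real assume "e > 0"
  then obtain N0 where N0: "\<And>N u. N \<ge> N0 \<Longrightarrow> u \<in> X \<Longrightarrow> \<bar>fN N u - f u\<bar> \<le> e / 2"
    using unif[of "e / 2"] by auto
  have "norm ((INF u\<in>X. fN N u) - (INF u\<in>X. f u)) < e" if "N \<ge> N0" for N
  proof -
    have le: "fN N u \<le> f u + e / 2" "f u \<le> fN N u + e / 2" if "u \<in> X" for u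
      using N0[OF \<open>N \<ge> N0\<close> that] by linarith+
    have "(INF u\<in>X. fN N u) \<le> (INF u\<in>X. f u) + e / 2" by (intro cINF_le_add assms(1) bdd le)
    moreover have "(INF u\<in>X. f u) \<le> (INF u\<in>X. fN N u) + e / 2" by (intro cINF_le_add assms(1) bdd le)
    ultimately show ?thesis using \<open>e > 0\<close> by (simp add: abs_le_iff)
  qed
  then show "\<exists>N0. \<forall>N\<ge>N0. norm ((INF u\<in>X. fN N u) - (INF u\<in>X. f u)) < e" by blast
qed

text \<open>A finite union of closed balls is closed, so a cover of \<open>S\<close> by such balls
  also covers its closure; completeness does the rest.\<close>

lemma totally_bounded_imp_compact_closure:
  fixes S :: "'a::complete_space set"
  assumes tb: "\<And>e. e > 0 \<Longrightarrow> \<exists>K. finite K \<and> S \<subseteq> (\<Union>x\<in>K. cball x e)"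
  shows "compact (closure S)"
proof -
  have "\<exists>K. finite K \<and> closure S \<subseteq> (\<Union>x\<in>K. ball x e)" if "e > 0" for e
  proof -
  obtain K where K: "finite K" "S \<subseteq> (\<Union>x\<in>K. cball x (e / 2))" using tb[of "e / 2"] \<open>e > 0\<close> by auto
  have "closed (\<Union>x\<in>K. cball x (e / 2))" using K(1) by (intro closed_UN) auto
  then have "closure S \<subseteq> (\<Union>x\<in>K. cball x (e / 2))" using K(2) by (rule closure_minimal[rotated])
  also have "\<dots> \<subseteq> (\<Union>x\<in>K. ball x e)" using \<open>e > 0\<close> by (intro UN_mono) auto
  finally show ?thesis using K(1) by blast
  qed
  then show ?thesis
    using compact_eq_totally_bounded[of "closure S"] complete_eq_closed[of "closure S"] by simp
qed

text \<open>The midpoint \<open>w\<close> of two almost minimizers is a competitor, and by the parallelogram identity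
  its quadratic cost is smaller than their average by \<open>\<beta> / 8 * (norm (u - v))\<^sup>2\<close>.\<close>

lemma almost_minimizers_close:
  fixes u v :: "'a::real_inner" and G :: "'a \<Rightarrow> real"
  defines "w \<equiv> (1/2) *\<^sub>R (u + v)"
  assumes "\<beta> > 0" and min: "m \<le> G w + \<beta> / 2 * (norm w)\<^sup>2"
    and almost: "G u + \<beta> / 2 * (norm u)\<^sup>2 \<le> m + 2 * \<eta>" "G v + \<beta> / 2 * (norm v)\<^sup>2 \<le> m + 2 * \<eta>"
    and G: "G w - G u \<le> \<eta>" "G w - G v \<le> \<eta>"
  shows "(norm (u - v))\<^sup>2 \<le> 24 * \<eta> / \<beta>"
proof -
  have "(norm w)\<^sup>2 = ((norm u)\<^sup>2 + (norm v)\<^sup>2) / 2 - (norm (u - v))\<^sup>2 / 4"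
    unfolding w_def power2_norm_eq_inner by (simp add: inner_simps inner_commute field_simps)
  then have "\<beta> / 2 * (norm w)\<^sup>2 = (\<beta> / 2 * (norm u)\<^sup>2 + \<beta> / 2 * (norm v)\<^sup>2) / 2 - \<beta> / 8 * (norm (u - v))\<^sup>2"
    by (simp only:) (simp add: algebra_simps)
  \<comment> \<open>Linear arithmetic with the quadratic terms as atoms:
    \<open>m \<le> G w + (b + c) / 2 - d\<close> and
    \<open>G w \<le> (G u + G v) / 2 + \<eta>\<close> give
    \<open>m \<le> m + 2 * \<eta> + \<eta> - d\<close>.\<close>
  moreover have "d \<le> 3 * \<eta>" if "a = (b + c) / 2 - d" "m \<le> G w + a" "G u + b \<le> m + 2 * \<eta>" "G v + c \<le> m + 2 * \<eta>"
    for a b c d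
    using that G by (simp add: field_simps)
  ultimately have "\<beta> / 8 * (norm (u - v))\<^sup>2 \<le> 3 * \<eta>" using min almost by blast
  then show ?thesis using \<open>\<beta> > 0\<close> by (simp add: field_simps)
qed

lemma minimizers_precompact:
  fixes X :: "'a::{real_inner, complete_space} set" and G :: "'a \<Rightarrow> real" and GN :: "nat \<Rightarrow> 'a \<Rightarrow> real"
    and \<beta> :: real
  defines "f \<equiv> \<lambda>u. G u + \<beta> / 2 * (norm u)\<^sup>2"
    and "fN \<equiv> \<lambda>N u. GN N u + \<beta> / 2 * (norm u)\<^sup>2"
  assumes "\<beta> > 0" and bdd: "bdd_below (f ` X)"
    and unif: "\<And>\<eta>. \<eta> > 0 \<Longrightarrow> \<exists>N0\<ge>1. \<forall>N\<ge>N0. \<forall>u\<in>X. \<bar>GN N u - G u\<bar> \<le> \<eta>"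
    and cells: "\<And>\<eta>. \<eta> > 0 \<Longrightarrow> \<exists>\<C>. finite \<C> \<and> X = \<Union>\<C> \<and>
      (\<forall>C\<in>\<C>. convex C \<and> (\<forall>u\<in>C. \<forall>v\<in>C. \<bar>G u - G v\<bar> \<le> \<eta>))"
    and min: "\<And>N. N \<ge> 1 \<Longrightarrow> is_arg_min (fN N) (\<lambda>u. u \<in> X) (uhat N)"
  shows "compact (closure (uhat ` {1..}))"
proof (rule totally_bounded_imp_compact_closure)
  fix e :: real assume "e > 0"
  \<comment> \<open>Chosen so that the bound \<open>24 * \<eta> / \<beta>\<close> of
    \<open>almost_minimizers_close\<close> equals \<open>e\<^sup>2\<close>.\<close>
  define \<eta> where "\<eta> = \<beta> * e\<^sup>2 / 24"
  have "\<eta> > 0" using \<open>\<beta> > 0\<close> \<open>e > 0\<close> by (simp add: \<eta>_def)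
  obtain N0 where N0: "N0 \<ge> 1" "\<And>N u. N \<ge> N0 \<Longrightarrow> u \<in> X \<Longrightarrow> \<bar>GN N u - G u\<bar> \<le> \<eta>"
    using unif[OF \<open>\<eta> > 0\<close>] by blast
  obtain \<C> where \<C>: "finite \<C>" "X = \<Union>\<C>"
    and convex: "\<And>C. C \<in> \<C> \<Longrightarrow> convex C"
    and osc: "\<And>C u v. C \<in> \<C> \<Longrightarrow> u \<in> C \<Longrightarrow> v \<in> C \<Longrightarrow> \<bar>G u - G v\<bar> \<le> \<eta>"
    using cells[OF \<open>\<eta> > 0\<close>] by blast
  have uhat: "uhat N \<in> X" "\<And>v. v \<in> X \<Longrightarrow> fN N (uhat N) \<le> fN N v" if "N \<ge> 1" for N
    using min[OF that] by (auto simp: is_arg_min_def not_less)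
  \<comment> \<open>Two errors of size \<open>\<eta>\<close>: one at the minimizer of
    \<open>fN N\<close>, one at the competitor.\<close>
  have almost: "f (uhat N) \<le> (INF u\<in>X. f u) + 2 * \<eta>" if "N \<ge> N0" for N
  proof -
    have N: "N \<ge> 1" using that N0(1) by simp
    have "f (uhat N) - 2 * \<eta> \<le> (INF u\<in>X. f u)"
    proof (rule cINF_greatest)
      show "X \<noteq> {}" using uhat(1)[OF N] by blast
      fix v assume v: "v \<in> X"
      show "f (uhat N) - 2 * \<eta> \<le> f v"
        using uhat(2)[OF N v] N0(2)[OF that v] N0(2)[OF that uhat(1)[OF N]]
        unfolding f_def fN_def by linarith
    qed
    then show ?thesis by simp
  qed
  have close: "norm (uhat N - uhat N') \<le> e"
    if C: "C \<in> \<C>" "uhat N \<in> C" "uhat N' \<in> C" and N: "N \<ge> N0" "N' \<ge> N0" for C N N'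
  proof -
    let ?w = "(1/2) *\<^sub>R (uhat N + uhat N')"
    have w: "?w \<in> C" using convexD[OF convex[OF C(1)] C(2,3), of "1/2" "1/2"] by (simp add: scaleR_add_right)
    then have "(INF u\<in>X. f u) \<le> f ?w" using \<C>(2) C(1) by (intro cINF_lower bdd) blast
    then have "(norm (uhat N - uhat N'))\<^sup>2 \<le> 24 * \<eta> / \<beta>"
      using almost[OF N(1)] almost[OF N(2)] osc[OF C(1) w C(2)] osc[OF C(1) w C(3)]
      unfolding f_def by (intro almost_minimizers_close[OF \<open>\<beta> > 0\<close>]) auto
    also have "\<dots> = e\<^sup>2" using \<open>\<beta> > 0\<close> by (simp add: \<eta>_def)
    finally show ?thesis using \<open>e > 0\<close> by (simp add: power2_le_iff_abs_le)
  qed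
  \<comment> \<open>One late minimizer per visited cell. For a cell that none visits
    \<open>SOME\<close> is arbitrary, which only adds a harmless centre to the finite net.\<close>
  define p where "p = (\<lambda>C. uhat (SOME N. N \<ge> N0 \<and> uhat N \<in> C))"
  show "\<exists>K. finite K \<and> uhat ` {1..} \<subseteq> (\<Union>x\<in>K. cball x e)"
  proof (intro exI[of _ "uhat ` {..<N0} \<union> p ` \<C>"] conjI subsetI)
    show "finite (uhat ` {..<N0} \<union> p ` \<C>)" using \<C>(1) by simp
    fix x assume "x \<in> uhat ` {1..}"
    then obtain N where N: "x = uhat N" "N \<ge> 1" by auto
    show "x \<in> (\<Union>y\<in>uhat ` {..<N0} \<union> p ` \<C>. cball y e)"
    proof (cases "N < N0")
      case True
      then show ?thesis using N \<open>e > 0\<close> by force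
    next
      case False
      obtain C where C: "C \<in> \<C>" "uhat N \<in> C" using uhat(1)[OF N(2)] \<C>(2) by blast
      let ?N' = "SOME N. N \<ge> N0 \<and> uhat N \<in> C"
      have "?N' \<ge> N0 \<and> uhat ?N' \<in> C" by (rule someI[of _ N]) (use False C in auto)
      then have "norm (uhat ?N' - uhat N) \<le> e" using close[OF C(1) _ C(2)] False by simp
      then have "x \<in> cball (p C) e" using N by (simp add: p_def dist_norm)
      then show ?thesis using C(1) by blast
    qed
  qed
qed

text \<open>The convergence is in norm, so continuity of the cost takes the place of weak lower
  semicontinuity.\<close>

lemma minimizers_limit:
  fixes X :: "'a::real_inner set" and G :: "'a \<Rightarrow> real" and GN :: "nat \<Rightarrow> 'a \<Rightarrow> real"
    and \<beta> :: real
  defines "f \<equiv> \<lambda>u. G u + \<beta> / 2 * (norm u)\<^sup>2"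
    and "fN \<equiv> \<lambda>N u. GN N u + \<beta> / 2 * (norm u)\<^sup>2"
  assumes X: "closed X" and cont: "continuous_on X G"
    and unif: "\<And>\<eta>. \<eta> > 0 \<Longrightarrow> \<exists>N0\<ge>1. \<forall>N\<ge>N0. \<forall>u\<in>X. \<bar>GN N u - G u\<bar> \<le> \<eta>"
    and min: "\<And>N. N \<ge> 1 \<Longrightarrow> is_arg_min (fN N) (\<lambda>u. u \<in> X) (uhat N)"
    and r: "strict_mono r" and lim: "(\<lambda>m. uhat (r m)) \<longlonglongrightarrow> u"
  shows "is_arg_min f (\<lambda>u. u \<in> X) u"
proof -
  have uhat: "uhat N \<in> X" "\<And>v. v \<in> X \<Longrightarrow> fN N (uhat N) \<le> fN N v" if "N \<ge> 1" for N
    using min[OF that] by (auto simp: is_arg_min_def not_less)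
  have r_ge: "r m \<ge> N" if "m \<ge> N" for m N
    using that seq_suble[OF r, of m] by simp
  \<comment> \<open>\<open>uhat 0\<close> is unconstrained, but \<open>r m \<ge> m\<close> avoids it
    from \<open>m = 1\<close> on.\<close>
  have in_X: "\<forall>\<^sub>F m in sequentially. uhat (r m) \<in> X"
    using uhat(1) r_ge by (auto simp: eventually_sequentially intro!: exI[of _ 1])
  have u: "u \<in> X" by (rule Lim_in_closed_set[OF X in_X _ lim]) simp
  have "continuous_on X f" unfolding f_def by (intro continuous_intros cont)
  then have flim: "(\<lambda>m. f (uhat (r m))) \<longlonglongrightarrow> f u"
    using continuous_on_tendsto_compose[OF _ lim u in_X] by blast
  have "f u \<le> f v" if v: "v \<in> X" for v
  proof (rule field_le_epsilon)
    fix e :: real assume "e > 0"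
    then obtain N0 where N0: "N0 \<ge> 1" "\<And>N u. N \<ge> N0 \<Longrightarrow> u \<in> X \<Longrightarrow> \<bar>GN N u - G u\<bar> \<le> e / 2"
      using unif[of "e / 2"] by (metis half_gt_zero)
    have "f (uhat (r m)) \<le> f v + e" if "m \<ge> N0" for m
    proof -
      have N: "r m \<ge> N0" "r m \<ge> 1" using r_ge[OF that] N0(1) by auto
      show ?thesis
        using uhat(2)[OF N(2) v] N0(2)[OF N(1) v] N0(2)[OF N(1) uhat(1)[OF N(2)]]
        unfolding f_def fN_def by linarith
    qed
    then show "f u \<le> f v + e" by (intro LIMSEQ_le_const2[OF flim]) blast
  qed
  then show ?thesis using u by (auto simp: is_arg_min_def not_less)
qed

section \<open>The ensemble problem\<close>

lemma integrable_continuous_on_compact: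
  fixes h :: "'a::topological_space \<Rightarrow> real"
  assumes "prob_space M" and sets: "sets M = sets (restrict_space borel K)"
    and "compact K" and h: "continuous_on K h"
  shows "integrable M h"
proof -
  interpret prob_space M by fact
  have space: "space M = K" using sets_eq_imp_space_eq[OF sets] by (simp add: space_restrict_space)
  have "bounded (h ` K)" by (intro compact_imp_bounded compact_continuous_image h \<open>compact K\<close>)
  then obtain B where "\<And>x. x \<in> K \<Longrightarrow> norm (h x) \<le> B" unfolding bounded_iff by (meson imageI)
  moreover have "h \<in> borel_measurable M"
    using borel_measurable_continuous_on_restrict[OF h] measurable_cong_sets[OF sets refl] by blast
  ultimately show ?thesis by (intro integrable_const_bound[of _ B]) (auto simp: space)
qed

lemma (in prob_space) integral_diff_le:
  fixes f g :: "'a \<Rightarrow> real"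
  assumes int: "integrable M f" "integrable M g" and le: "\<And>x. x \<in> space M \<Longrightarrow> \<bar>f x - g x\<bar> \<le> \<eta>"
  shows "\<bar>(LINT x|M. f x) - (LINT x|M. g x)\<bar> \<le> \<eta>"
proof -
  have "\<bar>(LINT x|M. f x) - (LINT x|M. g x)\<bar> = \<bar>LINT x|M. f x - g x\<bar>" using int by simp
  also have "\<dots> \<le> (LINT x|M. \<bar>f x - g x\<bar>)" by (rule integral_abs_bound)
  also have "\<dots> \<le> (LINT x|M. \<eta>)" using int le by (intro integral_mono) auto
  finally show ?thesis by (simp add: prob_space)
qed

lemma prob_space_weighted_dirac_sum:
  assumes "\<And>j. j \<in> {1..N} \<Longrightarrow> \<theta> j \<in> \<Theta>" "\<And>j. j \<in> {1..N} \<Longrightarrow> \<alpha> j > 0" "(\<Sum>j=1..N. \<alpha> j) = 1"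
  shows "prob_space (weighted_dirac_sum \<Theta> N \<alpha> \<theta>)"
proof
  have "\<Theta> = space (restrict_space borel \<Theta>)" by (simp add: space_restrict_space)
  then have "\<Theta> \<in> sets (restrict_space borel \<Theta>)" by (metis sets.top)
  then have "emeasure (weighted_dirac_sum \<Theta> N \<alpha> \<theta>) \<Theta> = (\<Sum>j=1..N. ennreal (\<alpha> j))"
    using assms(1) by (simp add: emeasure_weighted_dirac_sum)
  also have "\<dots> = ennreal (\<Sum>j=1..N. \<alpha> j)"
    using assms(2) by (intro sum_ennreal) (auto intro: less_imp_le)
  finally show "emeasure (weighted_dirac_sum \<Theta> N \<alpha> \<theta>) (space (weighted_dirac_sum \<Theta> N \<alpha> \<theta>)) = 1"
    using assms(3) by simp
qed

section \<open>Cost at a fixed parameter\<close>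

locale ensemble_problem = controlled_system \<Theta> F0 F x0 L
  for \<Theta> :: "'p::euclidean_space set"
    and F0 :: "real^'n \<Rightarrow> 'p \<Rightarrow> real^'n"
    and F :: "real^'n \<Rightarrow> 'p \<Rightarrow> real^'k^'n"
    and x0 :: "'p \<Rightarrow> real^'n"
    and L :: real +
  fixes a :: "real \<Rightarrow> real^'n \<Rightarrow> 'p \<Rightarrow> real" and \<nu> :: "real measure"
  assumes continuous_cost: "continuous_on ({0..1} \<times> UNIV \<times> \<Theta>) (\<lambda>(t, x, \<eta>). a t x \<eta>)"
    and cost_nonneg: "\<And>t x \<eta>. t \<in> {0..1} \<Longrightarrow> \<eta> \<in> \<Theta> \<Longrightarrow> a t x \<eta> \<ge> 0"
    and prob_time: "prob_space \<nu>" and sets_time: "sets \<nu> = sets (restrict_space borel {0..1})"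
begin

definition param_cost :: "(real^'k) L2 \<Rightarrow> 'p \<Rightarrow> real" where
  "param_cost u \<theta> = (LINT t|\<nu>. a t (traj u \<theta> t) \<theta>)"

lemma ensemble_cost_param_cost:
  "ensemble_cost F0 F x0 a \<beta> \<nu> \<mu> = (\<lambda>u. (LINT \<theta>|\<mu>. param_cost u \<theta>) + \<beta> / 2 * (norm u)\<^sup>2)"
  by (simp add: fun_eq_iff ensemble_cost_def param_cost_def)

lemma space_time: "space \<nu> = {0..1}"
  using sets_eq_imp_space_eq[OF sets_time] by (simp add: space_restrict_space)

lemma param_cost_nonneg: "\<theta> \<in> \<Theta> \<Longrightarrow> param_cost u \<theta> \<ge> 0"
  unfolding param_cost_def using space_time cost_nonneg by (intro Bochner_Integration.integral_nonneg) auto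

text \<open>The radius \<open>R\<close> is meant to be the common bound of all trajectories from
  \<open>traj_bounded\<close>, which brings the cost down to a compact set.\<close>

lemma cost_uniformly_continuous:
  assumes "\<eta> > 0"
  obtains d where "d > 0" "\<And>t x y \<theta>1 \<theta>2. t \<in> {0..1} \<Longrightarrow> norm x \<le> R \<Longrightarrow> norm y \<le> R \<Longrightarrow>
    \<theta>1 \<in> \<Theta> \<Longrightarrow> \<theta>2 \<in> \<Theta> \<Longrightarrow> norm (x - y) \<le> d \<Longrightarrow> norm (\<theta>1 - \<theta>2) \<le> d \<Longrightarrow> \<bar>a t x \<theta>1 - a t y \<theta>2\<bar> \<le> \<eta>"
proof -
  let ?K = "{0..1::real} \<times> cball (0::real^'n) R \<times> \<Theta>"
  have "uniformly_continuous_on ?K (\<lambda>(t, x, \<eta>). a t x \<eta>)"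
    by (intro compact_uniformly_continuous continuous_on_subset[OF continuous_cost] compact_Times compact_params) auto
  then obtain d where d: "d > 0" "\<And>z z'. z \<in> ?K \<Longrightarrow> z' \<in> ?K \<Longrightarrow> dist z' z < d \<Longrightarrow>
      dist ((\<lambda>(t, x, \<eta>). a t x \<eta>) z') ((\<lambda>(t, x, \<eta>). a t x \<eta>) z) < \<eta>"
    using assms unfolding uniformly_continuous_on_def by metis
  show thesis
  \<comment> \<open>Two displacements of at most \<open>d / 3\<close> add up to less than
    \<open>d\<close>, so closed conditions can replace the strict one.\<close>
  proof (rule that[of "d / 3"])
    fix t x y \<theta>1 \<theta>2
    assume h: "t \<in> {0..1::real}" "norm (x :: real^'n) \<le> R" "norm (y :: real^'n) \<le> R" "\<theta>1 \<in> \<Theta>" "\<theta>2 \<in> \<Theta>"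
      "norm (x - y) \<le> d / 3" "norm (\<theta>1 - \<theta>2) \<le> d / 3"
    have "dist (t, x, \<theta>1) (t, y, \<theta>2) \<le> norm (x - y) + norm (\<theta>1 - \<theta>2)"
      using norm_Pair_le[of "x - y" "\<theta>1 - \<theta>2"] by (simp add: dist_norm)
    also have "\<dots> < d" using h(6,7) d(1) by linarith
    finally show "\<bar>a t x \<theta>1 - a t y \<theta>2\<bar> \<le> \<eta>"
      using d(2)[of "(t, y, \<theta>2)" "(t, x, \<theta>1)"] h(1-5) by (simp add: dist_real_def)
  qed (use d(1) in simp)
qed

lemma integrable_time_cost:
  assumes "\<theta> \<in> \<Theta>"
  shows "integrable \<nu> (\<lambda>t. a t (traj u \<theta> t) \<theta>)"
proof (rule integrable_continuous_on_compact[OF prob_time sets_time compact_Icc])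
  have "continuous_on {0..1} (\<lambda>t. (\<lambda>(t, x, \<eta>). a t x \<eta>) (t, traj u \<theta> t, \<theta>))"
    by (rule continuous_on_compose2[OF continuous_cost])
      (use assms in \<open>auto intro!: continuous_intros continuous_traj\<close>)
  then show "continuous_on {0..1} (\<lambda>t. a t (traj u \<theta> t) \<theta>)" by simp
qed

lemma param_cost_diff_le:
  assumes "\<theta>1 \<in> \<Theta>" "\<theta>2 \<in> \<Theta>"
    and "\<And>t. t \<in> {0..1} \<Longrightarrow> \<bar>a t (traj u \<theta>1 t) \<theta>1 - a t (traj v \<theta>2 t) \<theta>2\<bar> \<le> \<eta>"
  shows "\<bar>param_cost u \<theta>1 - param_cost v \<theta>2\<bar> \<le> \<eta>"
  unfolding param_cost_def
  by (intro prob_space.integral_diff_le prob_time integrable_time_cost) (use assms space_time in auto)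

lemma param_cost_control_stability:
  assumes "\<eta> > 0" and "\<rho> \<ge> 0"
  obtains M \<delta> where "\<delta> > 0" "\<And>u v \<theta>. norm u \<le> \<rho> \<Longrightarrow> norm v \<le> \<rho> \<Longrightarrow>
    (\<And>j. j \<le> M \<Longrightarrow> norm (primitive (real j / real M) u - primitive (real j / real M) v) \<le> \<delta>) \<Longrightarrow>
    \<theta> \<in> \<Theta> \<Longrightarrow> \<bar>param_cost u \<theta> - param_cost v \<theta>\<bar> \<le> \<eta>"
proof -
  obtain R where R: "R > 0" "\<And>u \<theta> t. norm u \<le> \<rho> \<Longrightarrow> \<theta> \<in> \<Theta> \<Longrightarrow> t \<in> {0..1} \<Longrightarrow> norm (traj u \<theta> t) \<le> R"
    by (rule traj_bounded) blast
  obtain d where d: "d > 0" "\<And>t x y \<theta>1 \<theta>2. t \<in> {0..1} \<Longrightarrow> norm x \<le> R \<Longrightarrow> norm y \<le> R \<Longrightarrow>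
    \<theta>1 \<in> \<Theta> \<Longrightarrow> \<theta>2 \<in> \<Theta> \<Longrightarrow> norm (x - y) \<le> d \<Longrightarrow> norm (\<theta>1 - \<theta>2) \<le> d \<Longrightarrow> \<bar>a t x \<theta>1 - a t y \<theta>2\<bar> \<le> \<eta>"
    by (rule cost_uniformly_continuous[OF \<open>\<eta> > 0\<close>]) blast
  obtain M \<delta> where M: "\<delta> > 0" "\<And>u v \<theta> t. norm u \<le> \<rho> \<Longrightarrow> norm v \<le> \<rho> \<Longrightarrow>
    (\<And>j. j \<le> M \<Longrightarrow> norm (primitive (real j / real M) u - primitive (real j / real M) v) \<le> \<delta>) \<Longrightarrow>
    \<theta> \<in> \<Theta> \<Longrightarrow> t \<in> {0..1} \<Longrightarrow> norm (traj u \<theta> t - traj v \<theta> t) \<le> d"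
    by (rule traj_control_stability[OF \<open>d > 0\<close> \<open>\<rho> \<ge> 0\<close>]) blast
  show thesis
  proof (rule that[OF M(1), of M])
    fix u v :: "(real^'k) L2" and \<theta>
    assume h: "norm u \<le> \<rho>" "norm v \<le> \<rho>"
      "\<And>j. j \<le> M \<Longrightarrow> norm (primitive (real j / real M) u - primitive (real j / real M) v) \<le> \<delta>" and \<theta>: "\<theta> \<in> \<Theta>"
    show "\<bar>param_cost u \<theta> - param_cost v \<theta>\<bar> \<le> \<eta>"
    proof (rule param_cost_diff_le[OF \<theta> \<theta>])
      fix t :: real assume t: "t \<in> {0..1}"
      show "\<bar>a t (traj u \<theta> t) \<theta> - a t (traj v \<theta> t) \<theta>\<bar> \<le> \<eta>"
        using d(1) by (intro d(2) t R(2) h(1,2) \<theta> M(2)[OF h]) auto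
    qed
  qed
qed

text \<open>This makes \<open>param_cost u\<close> an admissible test function for the weak
  convergence of the measures.\<close>

lemma continuous_param_cost: "continuous_on \<Theta> (param_cost u)"
  unfolding continuous_on_iff
proof (intro ballI allI impI)
  fix \<theta> and e :: real assume \<theta>: "\<theta> \<in> \<Theta>" and "e > 0"
  obtain R where R: "R > 0" "\<And>v \<theta> t. norm v \<le> norm u \<Longrightarrow> \<theta> \<in> \<Theta> \<Longrightarrow> t \<in> {0..1} \<Longrightarrow> norm (traj v \<theta> t) \<le> R"
    by (rule traj_bounded) blast
  obtain d where d: "d > 0" "\<And>t x y \<theta>1 \<theta>2. t \<in> {0..1} \<Longrightarrow> norm x \<le> R \<Longrightarrow> norm y \<le> R \<Longrightarrow>
    \<theta>1 \<in> \<Theta> \<Longrightarrow> \<theta>2 \<in> \<Theta> \<Longrightarrow> norm (x - y) \<le> d \<Longrightarrow> norm (\<theta>1 - \<theta>2) \<le> d \<Longrightarrow> \<bar>a t x \<theta>1 - a t y \<theta>2\<bar> \<le> e / 2"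
    by (rule cost_uniformly_continuous[OF half_gt_zero[OF \<open>e > 0\<close>]]) blast
  define S where "S = (\<lambda>\<theta>'. stability_const (norm u) *
    (norm (x0 \<theta>' - x0 \<theta>) + L * weight_bound (norm u) * norm (\<theta>' - \<theta>)))"
  have "continuous_on \<Theta> S" unfolding S_def by (intro continuous_intros continuous_x0)
  moreover have "S \<theta> = 0" by (simp add: S_def)
  ultimately obtain d' where d': "d' > 0" "\<And>\<theta>'. \<theta>' \<in> \<Theta> \<Longrightarrow> dist \<theta>' \<theta> < d' \<Longrightarrow> \<bar>S \<theta>'\<bar> < d"
    using \<theta> d(1) unfolding continuous_on_iff dist_real_def by (metis diff_zero)
  have "dist (param_cost u \<theta>') (param_cost u \<theta>) < e" if \<theta>': "\<theta>' \<in> \<Theta>" "dist \<theta>' \<theta> < min d d'" for \<theta>'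
  proof -
    have "\<bar>param_cost u \<theta>' - param_cost u \<theta>\<bar> \<le> e / 2"
    proof (rule param_cost_diff_le[OF \<theta>'(1) \<theta>])
      fix t :: real assume t: "t \<in> {0..1}"
      have "norm (traj u \<theta>' t - traj u \<theta> t) \<le> S \<theta>'"
        unfolding S_def by (rule traj_param_stability[OF order_refl \<theta>'(1) \<theta> t])
      also have "\<dots> \<le> d" using d'(2)[OF \<theta>'(1)] \<theta>'(2) by linarith
      finally show "\<bar>a t (traj u \<theta>' t) \<theta>' - a t (traj u \<theta> t) \<theta>\<bar> \<le> e / 2"
        using \<theta>' \<theta> t by (intro d(2) R(2)) (auto simp: dist_norm)
    qed
    then show ?thesis using \<open>e > 0\<close> by (simp add: dist_real_def)
  qed
  then show "\<exists>d>0. \<forall>\<theta>'\<in>\<Theta>. dist \<theta>' \<theta> < d \<longrightarrow> dist (param_cost u \<theta>') (param_cost u \<theta>) < e"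
    using d(1) d'(1) by (intro exI[of _ "min d d'"]) auto
qed

section \<open>Costs averaged over the parameters\<close>

definition mean_cost :: "'p measure \<Rightarrow> (real^'k) L2 \<Rightarrow> real" where
  "mean_cost \<mu> u = (LINT \<theta>|\<mu>. param_cost u \<theta>)"

text \<open>The bound is the same for every probability measure, so one family of cells serves
  \<open>\<mu>\<close> and all the discrete measures.\<close>

lemma mean_cost_diff_le:
  assumes prob: "prob_space \<mu>" and sets: "sets \<mu> = sets (restrict_space borel \<Theta>)"
    and "\<And>\<theta>. \<theta> \<in> \<Theta> \<Longrightarrow> \<bar>param_cost u \<theta> - param_cost v \<theta>\<bar> \<le> \<eta>"
  shows "\<bar>mean_cost \<mu> u - mean_cost \<mu> v\<bar> \<le> \<eta>"
  unfolding mean_cost_def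
proof (rule prob_space.integral_diff_le[OF prob])
  have int: "integrable \<mu> (param_cost u)" for u
    by (rule integrable_continuous_on_compact[OF prob sets compact_params continuous_param_cost])
  show "integrable \<mu> (param_cost u)" "integrable \<mu> (param_cost v)" by (rule int)+
  show "\<bar>param_cost u \<theta> - param_cost v \<theta>\<bar> \<le> \<eta>" if "\<theta> \<in> space \<mu>" for \<theta>
    using assms(3) that sets_eq_imp_space_eq[OF sets] by (simp add: space_restrict_space)
qed

lemma mean_cost_nonneg: "space \<mu> = \<Theta> \<Longrightarrow> mean_cost \<mu> u \<ge> 0"
  unfolding mean_cost_def using param_cost_nonneg by (intro Bochner_Integration.integral_nonneg) auto

lemma param_cost_cells:
  assumes "\<eta> > 0" and "\<rho> \<ge> 0"
  obtains \<C> where "finite \<C>" "cball 0 \<rho> = \<Union>\<C>" "\<And>C. C \<in> \<C> \<Longrightarrow> convex C"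
    "\<And>C u v \<theta>. C \<in> \<C> \<Longrightarrow> u \<in> C \<Longrightarrow> v \<in> C \<Longrightarrow> \<theta> \<in> \<Theta> \<Longrightarrow> \<bar>param_cost u \<theta> - param_cost v \<theta>\<bar> \<le> \<eta>"
proof -
  obtain M \<delta> where M: "\<delta> > 0" "\<And>u v \<theta>. norm u \<le> \<rho> \<Longrightarrow> norm v \<le> \<rho> \<Longrightarrow>
    (\<And>j. j \<le> M \<Longrightarrow> norm (primitive (real j / real M) u - primitive (real j / real M) v) \<le> \<delta>) \<Longrightarrow>
    \<theta> \<in> \<Theta> \<Longrightarrow> \<bar>param_cost u \<theta> - param_cost v \<theta>\<bar> \<le> \<eta>"
    by (rule param_cost_control_stability[OF assms]) blast
  obtain \<C> :: "(real^'k) L2 set set" where \<C>: "finite \<C>" "cball 0 \<rho> \<subseteq> \<Union>\<C>"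
    "\<And>C. C \<in> \<C> \<Longrightarrow> convex C" "\<And>C. C \<in> \<C> \<Longrightarrow> C \<subseteq> cball 0 \<rho>"
    "\<And>C u v j. C \<in> \<C> \<Longrightarrow> u \<in> C \<Longrightarrow> v \<in> C \<Longrightarrow> j \<le> M \<Longrightarrow>
       norm (primitive (real j / real M) u - primitive (real j / real M) v) \<le> \<delta>"
    by (rule primitive_grid_cells[OF M(1)]) blast
  show thesis
  proof (rule that[OF \<C>(1) _ \<C>(3)])
    show "cball 0 \<rho> = \<Union>\<C>" using \<C>(2,4) by blast
    fix C u v \<theta> assume C: "C \<in> \<C>" "u \<in> C" "v \<in> C" and \<theta>: "\<theta> \<in> \<Theta>"
    have "u \<in> cball 0 \<rho>" "v \<in> cball 0 \<rho>" using \<C>(4)[OF C(1)] C(2,3) by blast+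
    then have "norm u \<le> \<rho>" "norm v \<le> \<rho>" by simp_all
    then show "\<bar>param_cost u \<theta> - param_cost v \<theta>\<bar> \<le> \<eta>" using \<C>(5)[OF C] \<theta> by (rule M(2))
  qed
qed

text \<open>Strong continuity drops out of the estimate in terms of primitives, because each
  primitive value depends on the control with Lipschitz constant 1.\<close>

lemma continuous_mean_cost:
  assumes prob: "prob_space \<mu>" and sets: "sets \<mu> = sets (restrict_space borel \<Theta>)" and "\<rho> \<ge> 0"
  shows "continuous_on (cball 0 \<rho>) (mean_cost \<mu>)"
  unfolding continuous_on_iff
proof (intro ballI allI impI)
  fix u :: "(real^'k) L2" and e :: real assume u: "u \<in> cball 0 \<rho>" and "e > 0"
  obtain M \<delta> where M: "\<delta> > 0" "\<And>u v \<theta>. norm u \<le> \<rho> \<Longrightarrow> norm v \<le> \<rho> \<Longrightarrow>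
    (\<And>j. j \<le> M \<Longrightarrow> norm (primitive (real j / real M) u - primitive (real j / real M) v) \<le> \<delta>) \<Longrightarrow>
    \<theta> \<in> \<Theta> \<Longrightarrow> \<bar>param_cost u \<theta> - param_cost v \<theta>\<bar> \<le> e / 2"
    by (rule param_cost_control_stability[OF half_gt_zero[OF \<open>e > 0\<close>] \<open>\<rho> \<ge> 0\<close>]) blast
  have "dist (mean_cost \<mu> v) (mean_cost \<mu> u) < e" if v: "v \<in> cball 0 \<rho>" "dist v u < \<delta>" for v
  proof -
    have "norm (primitive (real j / real M) v - primitive (real j / real M) u) \<le> \<delta>" if "j \<le> M" for j
    proof -
      have t: "real j / real M \<in> {0..1}" using that by (cases "M = 0") (auto simp: field_simps)
      show ?thesis
        using norm_primitive_le[OF t, of "v - u"] linear_diff[OF linear_primitive[OF t], of v u] v(2)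
        by (simp add: dist_norm)
    qed
    then have "\<bar>mean_cost \<mu> v - mean_cost \<mu> u\<bar> \<le> e / 2"
      using u v(1) by (intro mean_cost_diff_le prob sets M(2)) auto
    then show ?thesis using \<open>e > 0\<close> by (simp add: dist_real_def)
  qed
  then show "\<exists>d>0. \<forall>v\<in>cball 0 \<rho>. dist v u < d \<longrightarrow> dist (mean_cost \<mu> v) (mean_cost \<mu> u) < e"
    using M(1) by blast
qed

lemma mean_cost_uniform_limit:
  assumes \<mu>: "prob_space \<mu>" "sets \<mu> = sets (restrict_space borel \<Theta>)"
    and \<mu>N: "\<And>N. N \<ge> 1 \<Longrightarrow> prob_space (\<mu>N N)" "\<And>N. sets (\<mu>N N) = sets (restrict_space borel \<Theta>)"
    and weak: "\<And>f :: 'p \<Rightarrow> real. continuous_on \<Theta> f \<Longrightarrow> (\<lambda>N. LINT \<theta>|\<mu>N N. f \<theta>) \<longlonglongrightarrow> (LINT \<theta>|\<mu>. f \<theta>)"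
    and "\<rho> \<ge> 0" "\<eta> > 0"
  shows "\<exists>N0\<ge>1. \<forall>N\<ge>N0. \<forall>u\<in>cball 0 \<rho>. \<bar>mean_cost (\<mu>N N) u - mean_cost \<mu> u\<bar> \<le> \<eta>"
proof -
  have lim: "(\<lambda>N. mean_cost (\<mu>N N) u) \<longlonglongrightarrow> mean_cost \<mu> u" for u
    unfolding mean_cost_def by (intro weak continuous_param_cost)
  have cover: "\<exists>\<C>. finite \<C> \<and> cball 0 \<rho> = \<Union>\<C> \<and> (\<forall>C\<in>\<C>. \<forall>u\<in>C. \<forall>v\<in>C.
      \<bar>mean_cost \<mu> u - mean_cost \<mu> v\<bar> \<le> \<eta> \<and>
      (\<forall>N\<ge>1. \<bar>mean_cost (\<mu>N N) u - mean_cost (\<mu>N N) v\<bar> \<le> \<eta>))" if "\<eta> > 0" for \<eta>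
  proof -
    obtain \<C> where \<C>: "finite \<C>" "cball 0 \<rho> = \<Union>\<C>" "\<And>C. C \<in> \<C> \<Longrightarrow> convex C"
      "\<And>C u v \<theta>. C \<in> \<C> \<Longrightarrow> u \<in> C \<Longrightarrow> v \<in> C \<Longrightarrow> \<theta> \<in> \<Theta> \<Longrightarrow> \<bar>param_cost u \<theta> - param_cost v \<theta>\<bar> \<le> \<eta>"
      by (rule param_cost_cells[OF \<open>\<eta> > 0\<close> \<open>\<rho> \<ge> 0\<close>]) blast
    show ?thesis
      by (intro exI[of _ \<C>] conjI ballI allI impI \<C>(1,2) mean_cost_diff_le[OF \<mu>] mean_cost_diff_le[OF \<mu>N])
        (use \<C>(4) in auto)
  qed
  show ?thesis
    by (rule uniform_limit_on_finite_cover[of "cball 0 \<rho>" "\<lambda>N. mean_cost (\<mu>N N)", OF lim cover \<open>\<eta> > 0\<close>]) blast+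
qed

end

theorem corollary3p4:
  fixes \<Theta> :: "'p::euclidean_space set"
    and F0 :: "real^'n \<Rightarrow> 'p \<Rightarrow> real^'n"
    and F :: "real^'n \<Rightarrow> 'p \<Rightarrow> real^'k^'n"
    and x0 :: "'p \<Rightarrow> real^'n"
    and a :: "real \<Rightarrow> real^'n \<Rightarrow> 'p \<Rightarrow> real"
    and \<nu> :: "real measure" and \<mu> :: "'p measure"
    and \<alpha> :: "nat \<Rightarrow> nat \<Rightarrow> real" and \<theta> :: "nat \<Rightarrow> nat \<Rightarrow> 'p"
    and L \<beta> \<rho> :: real
  assumes "compact \<Theta>"
    and "L > 0"
    and "\<And>x1 x2 \<theta>1 \<theta>2. \<theta>1 \<in> \<Theta> \<Longrightarrow> \<theta>2 \<in> \<Theta> \<Longrightarrow>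
      norm (F0 x1 \<theta>1 - F0 x2 \<theta>2) \<le> L * (norm (x1 - x2) + norm (\<theta>1 - \<theta>2))"
    and "\<And>i x1 x2 \<theta>1 \<theta>2. \<theta>1 \<in> \<Theta> \<Longrightarrow> \<theta>2 \<in> \<Theta> \<Longrightarrow>
      norm (column i (F x1 \<theta>1) - column i (F x2 \<theta>2)) \<le> L * (norm (x1 - x2) + norm (\<theta>1 - \<theta>2))"
    and "continuous_on \<Theta> x0"
    and "continuous_on ({0..1} \<times> UNIV \<times> \<Theta>) (\<lambda>(t, x, \<eta>). a t x \<eta>)"
    and "\<And>t x \<eta>. t \<in> {0..1} \<Longrightarrow> \<eta> \<in> \<Theta> \<Longrightarrow> a t x \<eta> \<ge> 0"
    and "\<beta> > 0"
    and "prob_space \<nu>" and "sets \<nu> = sets (restrict_space borel {0..1})"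
    and "prob_space \<mu>" and "sets \<mu> = sets (restrict_space borel \<Theta>)"
    and "\<And>N j. N \<ge> 1 \<Longrightarrow> j \<in> {1..N} \<Longrightarrow> \<theta> N j \<in> \<Theta>"
    and "\<And>N j. N \<ge> 1 \<Longrightarrow> j \<in> {1..N} \<Longrightarrow> \<alpha> N j > 0"
    and "\<And>N. N \<ge> 1 \<Longrightarrow> (\<Sum>j=1..N. \<alpha> N j) = 1"
    and "\<And>f :: 'p \<Rightarrow> real. continuous_on \<Theta> f \<Longrightarrow>
      (\<lambda>N. LINT \<eta>|weighted_dirac_sum \<Theta> N (\<alpha> N) (\<theta> N). f \<eta>) \<longlonglongrightarrow> (LINT \<eta>|\<mu>. f \<eta>)"
    and "\<rho> > 0"
    and "\<And>u. ensemble_cost F0 F x0 a \<beta> \<nu> \<mu> u = (INF v. ensemble_cost F0 F x0 a \<beta> \<nu> \<mu> v) \<Longrightarrow> norm u \<le> \<rho>"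
  shows "let X = {u :: (real^'k) L2. norm u \<le> \<rho>};
             \<F>N = (\<lambda>N. ensemble_cost F0 F x0 a \<beta> \<nu> (weighted_dirac_sum \<Theta> N (\<alpha> N) (\<theta> N)));
             \<F> = ensemble_cost F0 F x0 a \<beta> \<nu> \<mu>
         in (\<lambda>N. INF u\<in>X. \<F>N N u) \<longlonglongrightarrow> (INF u\<in>X. \<F> u) \<and>
            (\<forall>uhat. (\<forall>N\<ge>1. is_arg_min (\<F>N N) (\<lambda>u. u \<in> X) (uhat N)) \<longrightarrow>
               compact (closure (uhat ` {1..})) \<and>
               (\<forall>r u. strict_mono r \<and> (\<lambda>m. uhat (r m)) \<longlonglongrightarrow> u \<longrightarrow>
                  is_arg_min \<F> (\<lambda>u. u \<in> X) u))"
proof -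
  interpret ensemble_problem \<Theta> F0 F x0 L a \<nu>
    by (intro ensemble_problem.intro controlled_system.intro ensemble_problem_axioms.intro; fact assms)
  define \<mu>N where "\<mu>N = (\<lambda>N. weighted_dirac_sum \<Theta> N (\<alpha> N) (\<theta> N))"
  define X where "X = cball (0 :: (real^'k) L2) \<rho>"
  have X: "{u. norm u \<le> \<rho>} = X" by (auto simp: X_def)
  have "\<rho> \<ge> 0" using \<open>\<rho> > 0\<close> by simp
  note \<mu> = \<open>prob_space \<mu>\<close> \<open>sets \<mu> = sets (restrict_space borel \<Theta>)\<close>
  have \<mu>N: "prob_space (\<mu>N N)" if "N \<ge> 1" for N
    unfolding \<mu>N_def using assms(13-15)[OF that] by (rule prob_space_weighted_dirac_sum)
  have sets_\<mu>N: "sets (\<mu>N N) = sets (restrict_space borel \<Theta>)" for N by (simp add: \<mu>N_def)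
  define f where "f = (\<lambda>u. mean_cost \<mu> u + \<beta> / 2 * (norm u)\<^sup>2)"
  define fN where "fN = (\<lambda>N u. mean_cost (\<mu>N N) u + \<beta> / 2 * (norm u)\<^sup>2)"
  have unif: "\<exists>N0\<ge>1. \<forall>N\<ge>N0. \<forall>u\<in>X. \<bar>mean_cost (\<mu>N N) u - mean_cost \<mu> u\<bar> \<le> \<eta>" if "\<eta> > 0" for \<eta>
    unfolding X_def using assms(16) that
    by (intro mean_cost_uniform_limit \<mu> \<mu>N sets_\<mu>N \<open>\<rho> \<ge> 0\<close>) (auto simp: \<mu>N_def)
  \<comment> \<open>Index 0 is included: the empty sum is a measure on \<open>\<Theta>\<close>
    without mass, so nonnegativity and the lower bound on the cost hold for every
    \<open>N\<close>.\<close>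
  have "space \<mu> = \<Theta>" "space (\<mu>N N) = \<Theta>" for N
    using sets_eq_imp_space_eq[OF \<mu>(2)] by (auto simp: \<mu>N_def space_restrict_space)
  then have nonneg: "f u \<ge> 0" "fN N u \<ge> 0" for u N
    using mean_cost_nonneg \<open>\<beta> > 0\<close> by (auto simp: f_def fN_def)
  have bdd: "bdd_below (f ` X)" "bdd_below (fN N ` X)" for N
    using nonneg by (auto intro!: bdd_belowI[of _ 0])
  have inf: "(\<lambda>N. INF u\<in>X. fN N u) \<longlonglongrightarrow> (INF u\<in>X. f u)"
  proof (rule INF_tendsto_uniform[OF _ bdd])
    show "X \<noteq> {}" using \<open>\<rho> \<ge> 0\<close> by (simp add: X_def)
    show "\<exists>N0. \<forall>N\<ge>N0. \<forall>u\<in>X. \<bar>fN N u - f u\<bar> \<le> \<eta>" if "\<eta> > 0" for \<eta>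
      using unif[OF that] by (auto simp: f_def fN_def)
  qed
  have precompact: "compact (closure (uhat ` {1..}))"
    if min: "\<And>N. N \<ge> 1 \<Longrightarrow> is_arg_min (fN N) (\<lambda>u. u \<in> X) (uhat N)" for uhat
  proof (rule minimizers_precompact[OF \<open>\<beta> > 0\<close> _ unif])
    show "bdd_below ((\<lambda>u. mean_cost \<mu> u + \<beta> / 2 * (norm u)\<^sup>2) ` X)" using bdd(1) by (simp add: f_def)
    show "is_arg_min (\<lambda>u. mean_cost (\<mu>N N) u + \<beta> / 2 * (norm u)\<^sup>2) (\<lambda>u. u \<in> X) (uhat N)" if "N \<ge> 1" for N
      using min[OF that] by (simp add: fN_def)
    fix \<eta> :: real assume "\<eta> > 0"
    obtain \<C> where \<C>: "finite \<C>" "cball 0 \<rho> = \<Union>\<C>" "\<And>C. C \<in> \<C> \<Longrightarrow> convex C"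
      "\<And>C u v \<theta>. C \<in> \<C> \<Longrightarrow> u \<in> C \<Longrightarrow> v \<in> C \<Longrightarrow> \<theta> \<in> \<Theta> \<Longrightarrow> \<bar>param_cost u \<theta> - param_cost v \<theta>\<bar> \<le> \<eta>"
      by (rule param_cost_cells[OF \<open>\<eta> > 0\<close> \<open>\<rho> \<ge> 0\<close>]) blast
    show "\<exists>\<C>. finite \<C> \<and> X = \<Union>\<C> \<and> (\<forall>C\<in>\<C>. convex C \<and> (\<forall>u\<in>C. \<forall>v\<in>C. \<bar>mean_cost \<mu> u - mean_cost \<mu> v\<bar> \<le> \<eta>))"
      unfolding X_def
      by (intro exI[of _ \<C>] conjI ballI \<C>(1,2,3) mean_cost_diff_le[OF \<mu>]) (use \<C>(4) in auto)
  qed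
  have limits: "is_arg_min f (\<lambda>u. u \<in> X) u"
    if min: "\<And>N. N \<ge> 1 \<Longrightarrow> is_arg_min (fN N) (\<lambda>u. u \<in> X) (uhat N)"
      and r: "strict_mono r" "(\<lambda>m. uhat (r m)) \<longlonglongrightarrow> u" for uhat r u
    unfolding f_def
  proof (rule minimizers_limit[OF _ _ unif _ r])
    show "closed X" by (simp add: X_def)
    show "continuous_on X (mean_cost \<mu>)"
      unfolding X_def by (rule continuous_mean_cost[OF \<mu> \<open>\<rho> \<ge> 0\<close>])
    show "is_arg_min (\<lambda>u. mean_cost (\<mu>N N) u + \<beta> / 2 * (norm u)\<^sup>2) (\<lambda>u. u \<in> X) (uhat N)" if "N \<ge> 1" for N
      using min[OF that] by (simp add: fN_def)
  qed
  have cost: "ensemble_cost F0 F x0 a \<beta> \<nu> \<mu> = f"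
    "ensemble_cost F0 F x0 a \<beta> \<nu> (weighted_dirac_sum \<Theta> N (\<alpha> N) (\<theta> N)) = fN N" for N
    by (simp_all add: ensemble_cost_param_cost mean_cost_def f_def fN_def \<mu>N_def)
  show ?thesis
    unfolding Let_def X cost
  proof (intro conjI allI impI inf)
    fix uhat assume min: "\<forall>N\<ge>1. is_arg_min (fN N) (\<lambda>u. u \<in> X) (uhat N)"
    show "compact (closure (uhat ` {1..}))" by (rule precompact) (use min in blast)
    fix r u assume "strict_mono r \<and> (\<lambda>m. uhat (r m)) \<longlonglongrightarrow> u"
    then show "is_arg_min f (\<lambda>u. u \<in> X) u" by (intro limits[of uhat r]) (use min in blast)+
  qed
qed

end
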